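(* Let $X\subset\mathbb P^r_k$ be a variety of almost minimal degree which is the image $\varrho(\tilde X)$ of a (cone over a) rational normal scroll $\tilde X\subset\mathbb P^{r+1}_k$ with $\dim\operatorname{Sing}(\tilde X)=:h$ under a linear projection $\varrho:\mathbb P^{r+1}_k\setminus\{p\}\to\mathbb P^r_k$ from a point $p\in\mathbb P^{r+1}_k\setminus\tilde X$. Then: (a) $X$ is contained in a (cone over a) rational normal scroll $Y\subset\mathbb P^r_k$ such that $\operatorname{codim}_Y(X)=1$ and $h\le\dim\operatorname{Sing}(Y)\le h+3$; (b) $X$ is of arithmetic depth $t\le h+5$.
   Context: $k$ is an algebraically closed field, $r\ge2$, $S=k[x_0,\dots,x_r]$, $\mathbb P^r_k=\operatorname{Proj}S$. A non-degenerate reduced irreducible projective variety $X\subset\mathbb P^r_k$ of positive dimension is of almost minimal degree if $\deg X=\operatorname{codim}X+2$; its arithmetic depth is $\operatorname{depth}(S/I)$ where $I$ is its homogeneous vanishing ideal. A (cone over a) rational normal scroll in $\mathbb P^s_k=\operatorname{Proj}k[x_0,\dots,x_s]$ is, up to a linear change of coordinates, the subvariety whose homogeneous ideal is generated by the $2\times2$-minors of the $2\times(n-l+1)$-matrix $\begin{pmatrix} x_0\cdots x_{a_1-1} & x_{a_1+1}\cdots x_{a_2-1} & \cdots & x_{a_{l-1}+1}\cdots x_{n-1}\\ x_1\cdots x_{a_1} & x_{a_1+2}\cdots x_{a_2} & \cdots & x_{a_{l-1}+2}\cdots x_n\end{pmatrix}$ with $1\le n\le s$, $l\ge1$, $-1=a_0<a_1<\dots<a_l=n$,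 $a_i-a_{i-1}>1$; if $n<s$ it is a cone with vertex $\cong\mathbb P^{s-n-1}_k$. $\operatorname{Sing}(\cdot)$ denotes the singular locus (vertex), with $\mathbb P^{-1}_k=\emptyset$, $\dim\emptyset=-1$. *)

theory Defs
  imports Main "HOL-Library.Poly_Mapping" "HOL-Computational_Algebra.Polynomial"
begin

definition alg_closed :: "'k::field itself \<Rightarrow> bool" where
  "alg_closed _ \<longleftrightarrow> (\<forall>p :: 'k poly. degree p \<ge> 1 \<longrightarrow> (\<exists>x. poly p x = 0))"

type_synonym 'k mpoly = "(nat \<Rightarrow>\<^sub>0 nat) \<Rightarrow>\<^sub>0 'k"

definition mdeg :: "(nat \<Rightarrow>\<^sub>0 nat) \<Rightarrow> nat" where
  "mdeg m = (\<Sum>i\<in>Poly_Mapping.keys m. Poly_Mapping.lookup m i)"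

definition polys :: "nat \<Rightarrow> 'k::comm_ring_1 mpoly set" where
  "polys r = {f. \<forall>m\<in>Poly_Mapping.keys f. Poly_Mapping.keys m \<subseteq> {..r}}"

definition homog_of_deg :: "nat \<Rightarrow> 'k::comm_ring_1 mpoly \<Rightarrow> bool" where
  "homog_of_deg d f \<longleftrightarrow> (\<forall>m\<in>Poly_Mapping.keys f. mdeg m = d)"

definition homog :: "'k::comm_ring_1 mpoly \<Rightarrow> bool" where
  "homog f \<longleftrightarrow> (\<exists>d. homog_of_deg d f)"

definition const :: "'k::comm_ring_1 \<Rightarrow> 'k mpoly" where
  "const c = Poly_Mapping.single 0 c"

definition eval :: "'k::comm_ring_1 mpoly \<Rightarrow> (nat \<Rightarrow> 'k) \<Rightarrow> 'k" where
  "eval f x = (\<Sum>m\<in>Poly_Mapping.keys f. Poly_Mapping.lookup f m * (\<Prod>i\<in>Poly_Mapping.keys m. x i ^ Poly_Mapping.lookup m i))"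

section \<open>Projective space P^r as nonzero vectors of k^{r+1} (cones)\<close>

definition affsp :: "nat \<Rightarrow> (nat \<Rightarrow> 'k::comm_ring_1) set" where
  "affsp r = {x. \<forall>i>r. x i = 0}"

definition PP :: "nat \<Rightarrow> (nat \<Rightarrow> 'k::comm_ring_1) set" where
  "PP r = affsp r - {(\<lambda>_. 0)}"

definition zero_set :: "nat \<Rightarrow> 'k::comm_ring_1 mpoly set \<Rightarrow> (nat \<Rightarrow> 'k) set" where
  "zero_set r F = {x \<in> PP r. \<forall>f\<in>F. eval f x = 0}"

definition closed_proj :: "nat \<Rightarrow> (nat \<Rightarrow> 'k::comm_ring_1) set \<Rightarrow> bool" where
  "closed_proj r Z \<longleftrightarrow> (\<exists>F. F \<subseteq> polys r \<and> (\<forall>f\<in>F. homog f) \<and> Z = zero_set r F)"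

definition irred_proj :: "nat \<Rightarrow> (nat \<Rightarrow> 'k::comm_ring_1) set \<Rightarrow> bool" where
  "irred_proj r Z \<longleftrightarrow> Z \<noteq> {} \<and>
     (\<forall>Z1 Z2. closed_proj r Z1 \<longrightarrow> closed_proj r Z2 \<longrightarrow> Z = Z1 \<union> Z2 \<longrightarrow> Z = Z1 \<or> Z = Z2)"

text \<open>Projective variety = irreducible closed subset (reduced by construction).\<close>
definition proj_variety :: "nat \<Rightarrow> (nat \<Rightarrow> 'k::comm_ring_1) set \<Rightarrow> bool" where
  "proj_variety r X \<longleftrightarrow> closed_proj r X \<and> irred_proj r X"

definition van_ideal :: "nat \<Rightarrow> (nat \<Rightarrow> 'k::comm_ring_1) set \<Rightarrow> 'k mpoly set" where
  "van_ideal r X = {f \<in> polys r. \<forall>x\<in>X. eval f x = 0}"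

definition dim_proj :: "nat \<Rightarrow> (nat \<Rightarrow> 'k::comm_ring_1) set \<Rightarrow> int" where
  "dim_proj r Z = (if Z = {} then -1 else int (Sup {m. \<exists>C. (\<forall>i\<le>m. closed_proj r (C i) \<and> irred_proj r (C i))
      \<and> (\<forall>i<m. C i \<subset> C (Suc i)) \<and> C m \<subseteq> Z}))"

definition codim_proj :: "nat \<Rightarrow> (nat \<Rightarrow> 'k::comm_ring_1) set \<Rightarrow> int" where
  "codim_proj r Z = int r - dim_proj r Z"

definition nondegenerate :: "nat \<Rightarrow> (nat \<Rightarrow> 'k::comm_ring_1) set \<Rightarrow> bool" where
  "nondegenerate r X \<longleftrightarrow> (\<forall>f\<in>van_ideal r X. homog_of_deg 1 f \<longrightarrow> f = 0)"

definition hilbert_fun :: "nat \<Rightarrow> (nat \<Rightarrow> 'k::field) set \<Rightarrow> nat \<Rightarrow> nat" where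
  "hilbert_fun r X d = Sup {card B | B. finite B \<and> B \<subseteq> polys r \<and> (\<forall>b\<in>B. homog_of_deg d b) \<and>
      (\<forall>c. (\<Sum>b\<in>B. const (c b) * b) \<in> van_ideal r X \<longrightarrow> (\<forall>b\<in>B. c b = 0))}"

definition deg_proj :: "nat \<Rightarrow> (nat \<Rightarrow> 'k::field) set \<Rightarrow> int" where
  "deg_proj r X = (THE e. \<exists>P :: rat poly.
      (\<forall>\<^sub>F d in sequentially. of_nat (hilbert_fun r X d) = poly P (of_nat d))
      \<and> of_int e = fact (degree P) * lead_coeff P)"

definition almost_minimal_degree :: "nat \<Rightarrow> (nat \<Rightarrow> 'k::field) set \<Rightarrow> bool" where
  "almost_minimal_degree r X \<longleftrightarrow> proj_variety r X \<and> nondegenerate r X \<and> dim_proj r X \<ge> 1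
      \<and> deg_proj r X = codim_proj r X + 2"

section \<open>Arithmetic depth: depth(S/I) via homogeneous regular sequences in the irrelevant ideal\<close>

definition ideal_plus :: "nat \<Rightarrow> 'k::comm_ring_1 mpoly set \<Rightarrow> (nat \<Rightarrow> 'k mpoly) \<Rightarrow> nat \<Rightarrow> 'k mpoly set" where
  "ideal_plus r I f i = {g + (\<Sum>j<i. a j * f j) | g a. g \<in> I \<and> (\<forall>j<i. a j \<in> polys r)}"

definition regular_seq :: "nat \<Rightarrow> 'k::comm_ring_1 mpoly set \<Rightarrow> (nat \<Rightarrow> 'k mpoly) \<Rightarrow> nat \<Rightarrow> bool" where
  "regular_seq r I f t \<longleftrightarrow>
     (\<forall>i<t. f i \<in> polys r \<and> (\<exists>d\<ge>1. homog_of_deg d (f i)) \<and>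
        (\<forall>g\<in>polys r. f i * g \<in> ideal_plus r I f i \<longrightarrow> g \<in> ideal_plus r I f i))
     \<and> 1 \<notin> ideal_plus r I f t"

definition arith_depth :: "nat \<Rightarrow> (nat \<Rightarrow> 'k::comm_ring_1) set \<Rightarrow> nat" where
  "arith_depth r X = Sup {t. \<exists>f. regular_seq r (van_ideal r X) f t}"

definition linmap :: "nat \<Rightarrow> nat \<Rightarrow> (nat \<Rightarrow> nat \<Rightarrow> 'k::comm_ring_1) \<Rightarrow> (nat \<Rightarrow> 'k) \<Rightarrow> (nat \<Rightarrow> 'k)" where
  "linmap s t M x = (\<lambda>i. if i \<le> t then (\<Sum>j\<le>s. M i j * x j) else 0)"

text \<open>Column index set J: top entry x_j, bottom entry x_{j+1}.\<close>
definition scroll_cols :: "nat \<Rightarrow> nat \<Rightarrow> (nat \<Rightarrow> int) \<Rightarrow> nat set" where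
  "scroll_cols n l a = {j. j < n \<and> (\<forall>i\<in>{1..<l}. int j \<noteq> a i)}"

definition scroll_data_ok :: "nat \<Rightarrow> nat \<Rightarrow> nat \<Rightarrow> (nat \<Rightarrow> int) \<Rightarrow> bool" where
  "scroll_data_ok s n l a \<longleftrightarrow> 1 \<le> n \<and> n \<le> s \<and> l \<ge> 1 \<and> a 0 = -1 \<and> a l = int n
     \<and> (\<forall>i\<in>{1..l}. a i - a (i - 1) > 1)"

text \<open>Zero set in P^s of the 2x2 minors of the scroll matrix.\<close>
definition std_scroll :: "nat \<Rightarrow> nat \<Rightarrow> nat \<Rightarrow> (nat \<Rightarrow> int) \<Rightarrow> (nat \<Rightarrow> 'k::comm_ring_1) set" where
  "std_scroll s n l a = {x \<in> PP s. \<forall>i\<in>scroll_cols n l a. \<forall>j\<in>scroll_cols n l a.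
       x i * x (j + 1) = x j * x (i + 1)}"

text \<open>is_scroll s Y v: Y \<subseteq> P^s is (a cone over) a rational normal scroll whose vertex
  Sing(Y) \<cong> P^(s-n-1) has dimension v.\<close>
definition is_scroll :: "nat \<Rightarrow> (nat \<Rightarrow> 'k::comm_ring_1) set \<Rightarrow> int \<Rightarrow> bool" where
  "is_scroll s Y v \<longleftrightarrow> (\<exists>M n l a. bij_betw (linmap s s M) (affsp s) (affsp s) \<and>
      scroll_data_ok s n l a \<and> v = int s - int n - 1 \<and> Y = linmap s s M ` std_scroll s n l a)"

definition is_projection_from :: "nat \<Rightarrow> (nat \<Rightarrow> 'k::comm_ring_1) \<Rightarrow> (nat \<Rightarrow> nat \<Rightarrow> 'k) \<Rightarrow> bool" where
  "is_projection_from r p P \<longleftrightarrow> p \<in> PP (Suc r) \<and>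
     (\<forall>x\<in>affsp (Suc r). linmap (Suc r) r P x = (\<lambda>_. 0) \<longleftrightarrow> (\<exists>c. x = (\<lambda>i. c * p i)))"

end

theory Submission
  imports Defs "HOL-Library.Function_Algebras" "HOL-Library.FuncSet"
begin

text \<open>The matrix of the scroll has rank \<open>2\<close> at the centre \<open>p\<close>. Its column combinations vanishing at
  \<open>p\<close> form a matrix of linear forms on the target space with two rows and two columns less, and no
  nontrivial combination of these columns has proportional entries. By Kronecker's normal form of
  matrix pencils, the locus where this matrix has rank at most \<open>1\<close> is a scroll \<open>Y\<close>; it contains \<open>X\<close> with
  codimension \<open>1\<close>, and at most four linearly independent entries are lost, which bounds the vertex.

  A linear form \<open>z\<close> with \<open>z p \<noteq> 0\<close> generates the coordinate ring \<open>B\<close> of the scroll over that of \<open>X\<close>, say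
  \<open>A\<close>, and the entries of the small matrix multiply \<open>z\<close> into \<open>A\<close>. So \<open>B / A\<close> lives on the vertex of
  \<open>Y\<close>, whose affine cone has dimension at most \<open>h + 4\<close>. On that cone any \<open>h + 5\<close> members of a regular
  sequence of length \<open>h + 6\<close> are algebraically dependent, so some polynomials \<open>Q j\<close>, with the \<open>j\<close>-th
  member not occurring in \<open>Q j\<close>, multiply \<open>z\<close> into \<open>A\<close>. Polynomials in a regular sequence cancel as in a
  factorial ring, hence \<open>z\<close> itself lies in \<open>A\<close>, contradicting the nondegeneracy of the scroll.\<close>

section \<open>Multivariate polynomials as functions\<close>

text \<open>The second row of a column combination is the first with every index raised by one, so
  the lowest nonzero index rises: \<open>shift\<close> has no eigenvector, and only scroll blocks
  occur in the normal form. The four lost entries are the two rows of two columns whose values at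
  the centre are (1,0) and (0,1). Since the target has one coordinate less than the source, four
  lost entries raise the vertex dimension by at most 3; it cannot drop, because the entries of the
  small matrix all vanish at the centre and some entry of the large one does not. With v the vertex
  dimension of Y, the depth bound is v + 2, the classical depth A <= dim (B / A) + 1. That
  inequality is reached with fractions only: on the scroll z Q j = b j, so Q j b 0 = Q 0 b j in A,
  hence Q 0 divides b 0, and z = b 0 / Q 0 lies in A because B is a domain. Dimension is defined by
  chains of irreducible sets, so algebraic independence has to bound their length from above. The
  degree hypothesis excludes the case that no column remains: X would be the whole space, of degree
  1 instead of 2.\<close>

definition mono_eval :: "(nat \<Rightarrow>\<^sub>0 nat) \<Rightarrow> (nat \<Rightarrow> 'k::comm_ring_1) \<Rightarrow> 'k" where
  "mono_eval m x = (\<Prod>i\<in>Poly_Mapping.keys m. x i ^ Poly_Mapping.lookup m i)"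

lemma mono_eval_superset:
  assumes "finite K" "Poly_Mapping.keys m \<subseteq> K"
  shows "mono_eval m x = (\<Prod>i\<in>K. x i ^ Poly_Mapping.lookup m i)"
  unfolding mono_eval_def using assms
  by (intro prod.mono_neutral_left) (auto simp: in_keys_iff)

lemma mono_eval_add: "mono_eval (m + n) x = mono_eval m x * mono_eval n x"
proof -
  let ?K = "Poly_Mapping.keys m \<union> Poly_Mapping.keys n"
  have "Poly_Mapping.keys (m + n) \<subseteq> ?K" by (rule keys_add)
  then show ?thesis
    using mono_eval_superset[of ?K m x] mono_eval_superset[of ?K n x] mono_eval_superset[of ?K "m + n" x]
    by (simp add: lookup_add power_add prod.distrib)
qed

lemma mono_eval_zero [simp]: "mono_eval 0 x = 1"
  by (simp add: mono_eval_def)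

lemma mono_eval_single: "mono_eval (Poly_Mapping.single i n) x = x i ^ n"
  by (cases "n = 0") (auto simp: mono_eval_def)

lemma eval_superset:
  assumes "finite K" "Poly_Mapping.keys f \<subseteq> K"
  shows "eval f x = (\<Sum>m\<in>K. Poly_Mapping.lookup f m * mono_eval m x)"
  unfolding eval_def mono_eval_def[symmetric] using assms
  by (intro sum.mono_neutral_left) (auto simp: in_keys_iff)

lemma eval_zero [simp]: "eval 0 x = 0"
  by (simp add: eval_def)

lemma eval_add: "eval (f + g) x = eval f x + eval g x"
proof -
  let ?K = "Poly_Mapping.keys f \<union> Poly_Mapping.keys g"
  have "Poly_Mapping.keys (f + g) \<subseteq> ?K" by (rule keys_add)
  then show ?thesis
    using eval_superset[of ?K f x] eval_superset[of ?K g x] eval_superset[of ?K "f + g" x]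
    by (simp add: lookup_add ring_distribs sum.distrib)
qed

lemma eval_single: "eval (Poly_Mapping.single m c) x = c * mono_eval m x"
  by (cases "c = 0") (auto simp: eval_def mono_eval_def)

lemma eval_const [simp]: "eval (const c) x = c"
  by (simp add: const_def eval_single)

lemma eval_one [simp]: "eval 1 x = 1"
  using eval_const[of 1 x] by (simp add: const_def)

lemma eval_sum: "eval (\<Sum>a\<in>A. f a) x = (\<Sum>a\<in>A. eval (f a) x)"
  by (induction A rule: infinite_finite_induct) (auto simp: eval_add)

lemma eval_uminus: "eval (- f) x = - eval f x"
  using eval_add[of f "- f" x] by (simp add: eq_neg_iff_add_eq_0 add.commute)

lemma eval_diff: "eval (f - g) x = eval f x - eval g x"
  using eval_add[of f "- g" x] by (simp add: eval_uminus)

lemma sum_single_eq: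
  fixes f :: "'a \<Rightarrow>\<^sub>0 'b::comm_monoid_add"
  shows "(\<Sum>m\<in>Poly_Mapping.keys f. Poly_Mapping.single m (Poly_Mapping.lookup f m)) = f"
proof (rule poly_mapping_eqI)
  fix k
  show "Poly_Mapping.lookup (\<Sum>m\<in>Poly_Mapping.keys f. Poly_Mapping.single m (Poly_Mapping.lookup f m)) k
      = Poly_Mapping.lookup f k"
    by (auto simp: lookup_sum lookup_single when_def in_keys_iff)
qed

text \<open>Reduces products to pairs of monomials; evaluation, support and degree of a product are
  all read off from it.\<close>

lemma mult_eq_sum_single:
  fixes f g :: "'a::comm_monoid_add \<Rightarrow>\<^sub>0 'b::comm_semiring_0"
  shows "f * g = (\<Sum>m\<in>Poly_Mapping.keys f. \<Sum>n\<in>Poly_Mapping.keys g.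
      Poly_Mapping.single (m + n) (Poly_Mapping.lookup f m * Poly_Mapping.lookup g n))"
proof -
  have "f * g = (\<Sum>m\<in>Poly_Mapping.keys f. Poly_Mapping.single m (Poly_Mapping.lookup f m)) *
     (\<Sum>n\<in>Poly_Mapping.keys g. Poly_Mapping.single n (Poly_Mapping.lookup g n))"
    by (simp add: sum_single_eq)
  then show ?thesis by (simp add: sum_product mult_single)
qed

lemma eval_mult: "eval (f * g) x = eval f x * eval g x"
proof -
  have "eval (f * g) x = (\<Sum>m\<in>Poly_Mapping.keys f. \<Sum>n\<in>Poly_Mapping.keys g.
      Poly_Mapping.lookup f m * Poly_Mapping.lookup g n * (mono_eval m x * mono_eval n x))"
    by (subst mult_eq_sum_single) (simp add: eval_sum eval_single mono_eval_add)
  also have "\<dots> = eval f x * eval g x"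
    unfolding eval_def mono_eval_def[symmetric] sum_product by (simp add: algebra_simps)
  finally show ?thesis .
qed

lemma eval_prod: "eval (\<Prod>a\<in>A. f a) x = (\<Prod>a\<in>A. eval (f a) x)"
  by (induction A rule: infinite_finite_induct) (auto simp: eval_mult)

lemma eval_power: "eval (f ^ n) x = eval f x ^ n"
  by (induction n) (auto simp: eval_mult)

lemmas eval_simps = eval_add eval_uminus eval_diff eval_mult eval_prod eval_power eval_sum

definition var :: "nat \<Rightarrow> 'k::comm_ring_1 mpoly" where
  "var i = Poly_Mapping.single (Poly_Mapping.single i 1) 1"

lemma eval_var [simp]: "eval (var i) x = x i"
  by (simp add: var_def eval_single mono_eval_single)

text \<open>An arbitrary set of variables is allowed, since parametrizations of scrolls need an
  extra variable for the ratio of the rows and omit others.\<close>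

definition vpolys :: "nat set \<Rightarrow> 'k::comm_ring_1 mpoly set" where
  "vpolys V = {f. \<forall>m\<in>Poly_Mapping.keys f. Poly_Mapping.keys m \<subseteq> V}"

lemma polys_eq_vpolys: "polys r = vpolys {..r}"
  by (simp add: polys_def vpolys_def)

lemma vpolys_zero [simp]: "0 \<in> vpolys V"
  by (simp add: vpolys_def)

lemma vpolys_single: "Poly_Mapping.keys m \<subseteq> V \<Longrightarrow> Poly_Mapping.single m c \<in> vpolys V"
  by (cases "c = 0") (auto simp: vpolys_def)

lemma vpolys_const [simp]: "const c \<in> vpolys V"
  by (simp add: const_def vpolys_single)

lemma vpolys_one [simp]: "1 \<in> vpolys V"
  using vpolys_const[of 1 V] by (simp add: const_def)

lemma vpolys_var [simp]: "var i \<in> vpolys V \<longleftrightarrow> i \<in> V"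
  by (auto simp: var_def vpolys_def)

lemma vpolys_add [intro]: "f \<in> vpolys V \<Longrightarrow> g \<in> vpolys V \<Longrightarrow> f + g \<in> vpolys V"
  using keys_add[of f g] by (auto simp: vpolys_def)

lemma vpolys_uminus [intro]: "f \<in> vpolys V \<Longrightarrow> - f \<in> vpolys V"
  by (auto simp: vpolys_def in_keys_iff)

lemma vpolys_diff [intro]: "f \<in> vpolys V \<Longrightarrow> g \<in> vpolys V \<Longrightarrow> f - g \<in> vpolys V"
  using vpolys_add[of f V "- g"] by auto

lemma vpolys_sum [intro]: "(\<And>a. a \<in> A \<Longrightarrow> f a \<in> vpolys V) \<Longrightarrow> (\<Sum>a\<in>A. f a) \<in> vpolys V"
  by (induction A rule: infinite_finite_induct) auto

lemma vpolys_mult [intro]: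
  assumes "f \<in> vpolys V" "g \<in> vpolys V" shows "f * g \<in> vpolys V"
proof -
  have "Poly_Mapping.keys (m + n) \<subseteq> V" if "m \<in> Poly_Mapping.keys f" "n \<in> Poly_Mapping.keys g" for m n
    using keys_add[of m n] assms that by (auto simp: vpolys_def)
  then show ?thesis
    by (subst mult_eq_sum_single) (auto intro!: vpolys_sum vpolys_single)
qed

lemma vpolys_prod [intro]: "(\<And>a. a \<in> A \<Longrightarrow> f a \<in> vpolys V) \<Longrightarrow> (\<Prod>a\<in>A. f a) \<in> vpolys V"
  by (induction A rule: infinite_finite_induct) auto

lemma vpolys_power [intro]: "f \<in> vpolys V \<Longrightarrow> f ^ n \<in> vpolys V"
  by (induction n) auto

lemmas vpolys_intros = vpolys_add vpolys_uminus vpolys_diff vpolys_mult vpolys_prod vpolys_power vpolys_sum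

section \<open>Homogeneous components\<close>

lemma mdeg_superset:
  assumes "finite K" "Poly_Mapping.keys m \<subseteq> K"
  shows "mdeg m = (\<Sum>i\<in>K. Poly_Mapping.lookup m i)"
  unfolding mdeg_def using assms
  by (intro sum.mono_neutral_left) (auto simp: in_keys_iff)

lemma mdeg_add: "mdeg (m + n) = mdeg m + mdeg n"
proof -
  let ?K = "Poly_Mapping.keys m \<union> Poly_Mapping.keys n"
  have "Poly_Mapping.keys (m + n) \<subseteq> ?K" by (rule keys_add)
  then show ?thesis
    using mdeg_superset[of ?K m] mdeg_superset[of ?K n] mdeg_superset[of ?K "m + n"]
    by (simp add: lookup_add sum.distrib)
qed

lemma mdeg_zero [simp]: "mdeg 0 = 0"
  by (simp add: mdeg_def)

lemma mdeg_single [simp]: "mdeg (Poly_Mapping.single i n) = n"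
  by (cases "n = 0") (auto simp: mdeg_def)

lemma homog_of_deg_zero [simp]: "homog_of_deg d 0"
  by (simp add: homog_of_deg_def)

lemma homog_of_deg_single: "mdeg m = d \<Longrightarrow> homog_of_deg d (Poly_Mapping.single m c)"
  by (cases "c = 0") (auto simp: homog_of_deg_def)

lemma homog_of_deg_const [simp]: "homog_of_deg 0 (const c)"
  by (simp add: const_def homog_of_deg_single)

lemma homog_of_deg_one [simp]: "homog_of_deg 0 1"
  using homog_of_deg_const[of 1] by (simp add: const_def)

lemma homog_of_deg_var [simp]: "homog_of_deg (Suc 0) (var i)"
  by (simp add: var_def homog_of_deg_single)

lemma homog_of_deg_add: "homog_of_deg d f \<Longrightarrow> homog_of_deg d g \<Longrightarrow> homog_of_deg d (f + g)"
  using keys_add[of f g] by (auto simp: homog_of_deg_def)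

lemma homog_of_deg_uminus: "homog_of_deg d f \<Longrightarrow> homog_of_deg d (- f)"
  by (auto simp: homog_of_deg_def in_keys_iff)

lemma homog_of_deg_diff: "homog_of_deg d f \<Longrightarrow> homog_of_deg d g \<Longrightarrow> homog_of_deg d (f - g)"
  using homog_of_deg_add[of d f "- g"] by (auto intro: homog_of_deg_uminus)

lemma homog_of_deg_sum: "(\<And>a. a \<in> A \<Longrightarrow> homog_of_deg d (f a)) \<Longrightarrow> homog_of_deg d (\<Sum>a\<in>A. f a)"
  by (induction A rule: infinite_finite_induct) (auto intro: homog_of_deg_add)

lemma homog_of_deg_mult:
  assumes "homog_of_deg d f" "homog_of_deg e g" shows "homog_of_deg (d + e) (f * g)"
proof -
  have "mdeg (m + n) = d + e" if "m \<in> Poly_Mapping.keys f" "n \<in> Poly_Mapping.keys g" for m n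
    using assms that by (simp add: mdeg_add homog_of_deg_def)
  then show ?thesis
    by (subst mult_eq_sum_single) (auto intro!: homog_of_deg_sum homog_of_deg_single)
qed

lemma homog_of_deg_prod:
  "(\<And>a. a \<in> A \<Longrightarrow> homog_of_deg (d a) (f a)) \<Longrightarrow> homog_of_deg (\<Sum>a\<in>A. d a) (\<Prod>a\<in>A. f a)"
  by (induction A rule: infinite_finite_induct) (auto intro: homog_of_deg_mult)

lemma homog_of_deg_power: "homog_of_deg d f \<Longrightarrow> homog_of_deg (n * d) (f ^ n)"
  by (induction n) (auto intro: homog_of_deg_mult)

lemma mono_eval_scale: "mono_eval m (\<lambda>i. c * x i) = c ^ mdeg m * mono_eval m x"
  by (simp add: mono_eval_def mdeg_def power_mult_distrib prod.distrib power_sum)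

lemma eval_scale: "homog_of_deg d f \<Longrightarrow> eval f (\<lambda>i. c * x i) = c ^ d * eval f x"
  unfolding eval_def mono_eval_def[symmetric]
  by (auto simp: mono_eval_scale sum_distrib_left homog_of_deg_def intro!: sum.cong)

definition hcomp :: "nat \<Rightarrow> 'k::comm_ring_1 mpoly \<Rightarrow> 'k mpoly" where
  "hcomp e f = (\<Sum>m\<in>{m \<in> Poly_Mapping.keys f. mdeg m = e}. Poly_Mapping.single m (Poly_Mapping.lookup f m))"

lemma lookup_hcomp: "Poly_Mapping.lookup (hcomp e f) m = (if mdeg m = e then Poly_Mapping.lookup f m else 0)"
  by (auto simp: hcomp_def lookup_sum lookup_single when_def in_keys_iff)

lemma keys_hcomp: "Poly_Mapping.keys (hcomp e f) = {m \<in> Poly_Mapping.keys f. mdeg m = e}"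
  by (auto simp: in_keys_iff lookup_hcomp split: if_splits)

lemma hcomp_add: "hcomp e (f + g) = hcomp e f + hcomp e g"
  by (rule poly_mapping_eqI) (simp add: lookup_hcomp lookup_add)

lemma hcomp_zero [simp]: "hcomp e 0 = 0"
  by (simp add: hcomp_def)

lemma hcomp_sum: "hcomp e (\<Sum>a\<in>A. f a) = (\<Sum>a\<in>A. hcomp e (f a))"
  by (induction A rule: infinite_finite_induct) (auto simp: hcomp_add)

lemma hcomp_vpolys [intro]: "f \<in> vpolys V \<Longrightarrow> hcomp e f \<in> vpolys V"
  by (auto simp: vpolys_def keys_hcomp)

lemma homog_hcomp [simp]: "homog_of_deg e (hcomp e f)"
  by (simp add: homog_of_deg_def keys_hcomp)

lemma hcomp_single: "hcomp e (Poly_Mapping.single m c) = (if mdeg m = e then Poly_Mapping.single m c else 0)"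
  by (rule poly_mapping_eqI) (auto simp: lookup_hcomp lookup_single when_def)

lemma hcomp_homog: "homog_of_deg d f \<Longrightarrow> hcomp e f = (if e = d then f else 0)"
  by (rule poly_mapping_eqI) (auto simp: lookup_hcomp homog_of_deg_def in_keys_iff)

lemma sum_hcomp: "(\<Sum>e\<in>mdeg ` Poly_Mapping.keys f. hcomp e f) = f"
  by (rule poly_mapping_eqI) (auto simp: lookup_sum lookup_hcomp in_keys_iff)

lemma hcomp_mult_homog:
  assumes "homog_of_deg d f"
  shows "hcomp e (f * g) = (if d \<le> e then f * hcomp (e - d) g else 0)"
proof -
  have g: "g = (\<Sum>n\<in>Poly_Mapping.keys g. Poly_Mapping.single n (Poly_Mapping.lookup g n))"
    by (simp add: sum_single_eq)
  have *: "hcomp e (f * Poly_Mapping.single n c) = (if d \<le> e then f * hcomp (e - d) (Poly_Mapping.single n c) else 0)" for n c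
  proof -
    have h: "homog_of_deg (d + mdeg n) (f * Poly_Mapping.single n c)"
      by (intro homog_of_deg_mult assms homog_of_deg_single refl)
    show ?thesis by (auto simp: hcomp_homog[OF h] hcomp_single)
  qed
  show ?thesis
    by (subst (1 2) g) (simp add: sum_distrib_left hcomp_sum *)
qed

section \<open>Strings of a shift operator\<close>

text \<open>A copy of \<open>vector_space\<close> without registered interpretations: new facts about the original would be
  shadowed by their instances for real vector spaces.\<close>
locale vec_space = vector_space
begin

text \<open>Injectivity is part of the notion because independence of the image set does not notice
  repeated vectors; the cardinality of the index set then counts dimensions.\<close>

definition indep_fam :: "('i \<Rightarrow> 'b) \<Rightarrow> 'i set \<Rightarrow> bool" where
  "indep_fam f I \<longleftrightarrow> inj_on f I \<and> independent (f ` I)"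

lemma indep_famI:
  assumes "finite I" "\<And>c. (\<Sum>i\<in>I. c i *s f i) = 0 \<Longrightarrow> \<forall>i\<in>I. c i = 0"
  shows "indep_fam f I"
proof -
  have inj: "inj_on f I"
  proof (rule inj_onI, rule ccontr)
    fix i j assume ij: "i \<in> I" "j \<in> I" "f i = f j" "i \<noteq> j"
    define c where "c = (\<lambda>_. 0)(i := 1, j := - 1 :: 'a)"
    have "(\<Sum>k\<in>I. c k *s f k) = (\<Sum>k\<in>{i, j}. c k *s f k)"
      using ij assms(1) by (intro sum.mono_neutral_right) (auto simp: c_def)
    also have "\<dots> = 0" using ij by (simp add: c_def)
    finally have "c i = 0" using assms(2) ij by blast
    then show False using ij by (simp add: c_def)
  qed
  moreover have "independent (f ` I)"
  proof
    assume "dependent (f ` I)"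
    then obtain u where "\<exists>v\<in>f ` I. u v \<noteq> 0" "(\<Sum>v\<in>f ` I. u v *s v) = 0"
      using dependent_finite[of "f ` I"] assms(1) by auto
    then show False using assms(2)[of "\<lambda>i. u (f i)"] by (auto simp: sum.reindex[OF inj])
  qed
  ultimately show ?thesis by (simp add: indep_fam_def)
qed

lemma nontrivial_relation:
  assumes "finite I" "finite B" "f ` I \<subseteq> span B" "card B < card I"
  shows "\<exists>c. (\<exists>i\<in>I. c i \<noteq> 0) \<and> (\<Sum>i\<in>I. c i *s f i) = 0"
proof (rule ccontr)
  assume "\<not> ?thesis"
  then have "indep_fam f I" by (intro indep_famI[OF assms(1)]) blast
  then have "card I = card (f ` I)" "independent (f ` I)" by (auto simp: indep_fam_def card_image)
  then show False using independent_span_bound[OF assms(2) _ assms(3)] assms(4) by auto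
qed

lemma indep_famD:
  assumes "indep_fam f I" "finite I" "(\<Sum>i\<in>I. c i *s f i) = 0" "i \<in> I"
  shows "c i = 0"
proof -
  have inj: "inj_on f I" and ind: "independent (f ` I)" using assms(1) by (auto simp: indep_fam_def)
  have "(\<Sum>v\<in>f ` I. c (the_inv_into I f v) *s v) = 0"
    using assms(3) by (simp add: sum.reindex[OF inj] the_inv_into_f_f[OF inj])
  then have "\<forall>v\<in>f ` I. c (the_inv_into I f v) = 0"
    using ind dependent_finite[of "f ` I"] assms(2) by auto
  then show ?thesis using assms(4) the_inv_into_f_f[OF inj] by auto
qed

lemma span_famE:
  assumes "v \<in> span (f ` I)" "finite I"
  obtains c where "v = (\<Sum>i\<in>I. c i *s f i)"
proof -
  have "\<exists>c. v = (\<Sum>i\<in>I. c i *s f i)"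
    using assms(1)
  proof (induction rule: span_induct_alt)
    case base
    then show ?case by (intro exI[of _ "\<lambda>_. 0"]) simp
  next
    case (step a x y)
    then obtain i c where i: "i \<in> I" "x = f i" "y = (\<Sum>i\<in>I. c i *s f i)" by auto
    have "a *s x + y = (\<Sum>k\<in>I. (c k + (if k = i then a else 0)) *s f k)"
      using i assms(2) by (simp add: scale_left_distrib sum.distrib if_distrib[of "\<lambda>c. c *s _"] add.commute cong: if_cong)
    then show ?case by (rule exI[of _ "\<lambda>k. c k + (if k = i then a else 0)"])
  qed
  then show ?thesis using that by blast
qed

lemma sum_in_span: "(\<And>i. i \<in> I \<Longrightarrow> f i \<in> S) \<Longrightarrow> (\<Sum>i\<in>I. c i *s f i) \<in> span S"
  by (intro span_sum span_scale span_base)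

lemma basis_of_subspace:
  assumes "subspace V" "V \<subseteq> span F" "finite F" "S \<subseteq> V" "independent S"
  obtains B where "S \<subseteq> B" "B \<subseteq> V" "independent B" "span B = V" "finite B"
proof -
  obtain B where B: "S \<subseteq> B" "B \<subseteq> V" "independent B" "V \<subseteq> span B"
    using maximal_independent_subset_extend[OF assms(4,5)] by blast
  moreover have "span B \<subseteq> V" using B(2) assms(1) by (simp add: span_minimal)
  moreover have "finite B" using independent_span_bound[OF assms(3) B(3)] B(2) assms(2) by blast
  ultimately show ?thesis using that by blast
qed

lemma dim_psubset:
  assumes "subspace V" "subspace W" "V \<subset> W" "W \<subseteq> span F" "finite F"
  shows "dim V < dim W"
proof -
  have VF: "V \<subseteq> span F" using assms by blast
  obtain B where B: "B \<subseteq> V" "independent B" "span B = V" "finite B"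
    using basis_of_subspace[OF assms(1) VF assms(5) empty_subsetI independent_empty] by auto
  obtain v where v: "v \<in> W" "v \<notin> V" using assms by blast
  have ind: "independent (insert v B)" using v B by (simp add: independent_insert)
  obtain C where C: "insert v B \<subseteq> C" "C \<subseteq> W" "independent C" "span C = W" "finite C"
    using basis_of_subspace[OF assms(2,4,5) _ ind] v B assms(3) by auto
  have "dim V = card B" "dim W = card C" using B C dim_eq_card_independent dim_span by metis+
  moreover have "v \<notin> B" using v B(1) by blast
  ultimately show ?thesis using card_mono[OF C(5,1)] B(4) by simp
qed

text \<open>The normal form of a pair \<open>W \<subseteq> U\<close> with a shift \<open>B\<close> from \<open>W\<close> to \<open>U\<close>, a special case of Kronecker's
  classification of matrix pencils. Passing to the pair \<open>W \<inter> B W \<subseteq> B W\<close> removes the first vector of every string.\<close>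
lemma string_basis:
  fixes \<mu> :: "'b \<Rightarrow> nat"
  assumes "subspace W" "subspace U" "W \<subseteq> U" "finite F" "U \<subseteq> span F"
    and "Vector_Spaces.linear scale scale B" "inj_on B W" "B ` W \<subseteq> U"
    and "\<forall>w\<in>W. \<forall>w'\<in>W. w \<noteq> 0 \<longrightarrow> w = B w' \<longrightarrow> \<mu> w' < \<mu> w"
  shows "\<exists>(l::nat) (L::nat) (b::nat \<Rightarrow> nat) u. l \<le> L \<and> (\<forall>i<l. 0 < b i) \<and> (\<forall>i\<in>{l..<L}. b i = 0) \<and>
     indep_fam u (SIGMA i:{..<L}. {..b i}) \<and> span (u ` (SIGMA i:{..<L}. {..b i})) = U \<and>
     span (u ` (SIGMA i:{..<l}. {..<b i})) = W \<and> (\<forall>i<l. \<forall>j<b i. B (u (i, j)) = u (i, Suc j))"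
  using assms
proof (induction "dim W" arbitrary: W U rule: less_induct)
  case less
  interpret B: Vector_Spaces.linear scale scale B by fact
  show ?case
  proof (cases "W = {0}")
    case True
    \<comment> \<open>With no shift to respect, every basis of \<open>U\<close> consists of strings
      of one vector; hence \<open>l = 0\<close>.\<close>
    obtain C where C: "C \<subseteq> U" "independent C" "span C = U" "finite C"
      using basis_of_subspace[OF less.prems(2,5,4) empty_subsetI independent_empty] by auto
    obtain g where g: "bij_betw g {..<card C} C"
      using ex_bij_betw_nat_finite[OF C(4)] by (auto simp: atLeast0LessThan)
    let ?S = "SIGMA i:{..<card C}. {..0::nat}"
    have S: "?S = (\<lambda>i. (i, 0)) ` {..<card C}" by auto
    have img: "(\<lambda>p. g (fst p)) ` ?S = C" unfolding S image_image using g by (simp add: bij_betw_def)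
    have inj: "inj_on (\<lambda>p. g (fst p)) ?S" using g by (auto simp: inj_on_def bij_betw_def)
    show ?thesis
      by (rule exI[of _ 0], rule exI[of _ "card C"], rule exI[of _ "\<lambda>_. 0"], rule exI[of _ "\<lambda>p. g (fst p)"])
        (use True img inj C in \<open>simp add: indep_fam_def\<close>)
  next
    case False
    define W' where "W' = W \<inter> B ` W"
    define U' where "U' = B ` W"
    have sU': "subspace U'" unfolding U'_def by (rule B.subspace_image) fact
    have sW': "subspace W'" unfolding W'_def U'_def[symmetric] using less.prems(1) sU' by (rule subspace_inter)
    \<comment> \<open>A nonzero vector of \<open>W\<close> with minimal \<open>\<mu>\<close> cannot
      be \<open>B\<close> of a vector of \<open>W\<close>. So the dimension drops and the induction
      applies to \<open>W' \<subseteq> U'\<close>.\<close>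
    have "W' \<noteq> W"
    proof
      assume eq: "W' = W"
      obtain w0 where "w0 \<in> W - {0}" using False subspace_0[OF less.prems(1)] by blast
      then obtain w where w: "w \<in> W - {0}" "\<And>v. v \<in> W - {0} \<Longrightarrow> \<mu> w \<le> \<mu> v"
        using ex_has_least_nat[of "\<lambda>w. w \<in> W - {0}" w0 \<mu>] by blast
      then obtain v where v: "v \<in> W" "w = B v" using eq unfolding W'_def by auto
      then have "v \<noteq> 0" using w(1) B.zero by auto
      then show False using less.prems(9)[rule_format, of w v] w v by fastforce
    qed
    then have "W' \<subset> W" by (auto simp: W'_def)
    then have dimlt: "dim W' < dim W"
      using less.prems by (intro dim_psubset[OF sW' less.prems(1), of F]) auto
    have BW': "B ` W' \<subseteq> U'" "W' \<subseteq> U'" by (auto simp: W'_def U'_def)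
    have injW': "inj_on B W'" using less.prems(7) by (auto simp: W'_def inj_on_def)
    have UF: "U' \<subseteq> span F" unfolding U'_def using less.prems(5,8) by (rule subset_trans[rotated])
    have mu: "\<forall>w\<in>W'. \<forall>w'\<in>W'. w \<noteq> 0 \<longrightarrow> w = B w' \<longrightarrow> \<mu> w' < \<mu> w"
      using less.prems(9) by (auto simp: W'_def)
    obtain l0 L0 :: nat and b0 :: "nat \<Rightarrow> nat" and u0 where IH: "l0 \<le> L0" "\<forall>i<l0. 0 < b0 i" "\<forall>i\<in>{l0..<L0}. b0 i = 0"
      "indep_fam u0 (SIGMA i:{..<L0}. {..b0 i})" "span (u0 ` (SIGMA i:{..<L0}. {..b0 i})) = U'"
      "span (u0 ` (SIGMA i:{..<l0}. {..<b0 i})) = W'" "\<forall>i<l0. \<forall>j<b0 i. B (u0 (i, j)) = u0 (i, Suc j)"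
      using less.hyps[OF dimlt sW' sU' BW'(2) less.prems(4) UF less.prems(6) injW' BW'(1) mu]
      by blast
    define S0 where "S0 = (SIGMA i:{..<L0}. {..b0 i})"
    define R0 where "R0 = (SIGMA i:{..<l0}. {..<b0 i})"
    have fin: "finite S0" "finite R0" unfolding S0_def R0_def by (rule finite_SigmaI; simp)+
    \<comment> \<open>Every string gets a \<open>B\<close>-preimage of its first vector as new first
      vector, which exists because the strings lie in the image of \<open>W\<close>. The old
      positions move up by one.\<close>
    define u1 where "u1 p = (case snd p of 0 \<Rightarrow> the_inv_into W B (u0 (fst p, 0)) | Suc j \<Rightarrow> u0 (fst p, j))" for p
    have u1_Suc: "u1 (i, Suc j) = u0 (i, j)" for i j by (simp add: u1_def)
    have u0U: "u0 p \<in> U'" if "p \<in> S0" for p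
      unfolding IH(5)[symmetric] S0_def[symmetric] using that by (intro span_base) auto
    have pos: "i < l0" if "i < L0" "j < b0 i" for i j
      using IH(3) that by (metis atLeastLessThan_iff gr_implies_not0 not_le_imp_less)
    have u0W: "u0 p \<in> W'" if "p \<in> R0" for p
      unfolding IH(6)[symmetric] R0_def[symmetric] using that by (intro span_base) auto
    have u1_0: "u1 (i, 0) \<in> W" "B (u1 (i, 0)) = u0 (i, 0)" if "i < L0" for i
    proof -
      have "u0 (i, 0) \<in> B ` W" using u0U[of "(i, 0)"] that by (auto simp: S0_def U'_def)
      then show "u1 (i, 0) \<in> W" "B (u1 (i, 0)) = u0 (i, 0)"
        by (auto simp: u1_def the_inv_into_into[OF less.prems(7)] f_the_inv_into_f[OF less.prems(7)])
    qed
    have u1W: "u1 p \<in> W" if "p \<in> S0" for p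
    proof -
      obtain i j where p: "p = (i, j)" "i < L0" "j \<le> b0 i" using \<open>p \<in> S0\<close> by (auto simp: S0_def)
      show ?thesis
      proof (cases j)
        case (Suc j')
        then have "(i, j') \<in> R0" using p pos[of i j'] by (auto simp: R0_def)
        then show ?thesis using u0W p Suc by (auto simp: u1_Suc W'_def)
      qed (use u1_0 p in auto)
    qed
    have Bu1: "B (u1 p) = u0 p" if "p \<in> S0" for p
    proof -
      obtain i j where p: "p = (i, j)" "i < L0" "j \<le> b0 i" using \<open>p \<in> S0\<close> by (auto simp: S0_def)
      show ?thesis
      proof (cases j)
        case (Suc j')
        then show ?thesis using IH(7) pos[of i j'] p by (auto simp: u1_Suc)
      qed (use u1_0 p in auto)
    qed
    have B_sum: "B (\<Sum>p\<in>S0. c p *s u1 p) = (\<Sum>p\<in>S0. c p *s u0 p)" for c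
      by (simp add: B.sum B.scale Bu1)
    \<comment> \<open>\<open>B\<close> is injective on \<open>W\<close> and maps these vectors to
      vectors that span its image.\<close>
    have spanW: "span (u1 ` S0) = W"
    proof
      show "span (u1 ` S0) \<subseteq> W" using u1W less.prems(1) by (intro span_minimal) auto
      show "W \<subseteq> span (u1 ` S0)"
      proof
        fix w assume w: "w \<in> W"
        then have "B w \<in> span (u0 ` S0)" using IH(5) by (simp add: S0_def U'_def)
        then obtain c where c: "B w = (\<Sum>p\<in>S0. c p *s u0 p)" using fin by (blast elim: span_famE)
        have "(\<Sum>p\<in>S0. c p *s u1 p) \<in> W"
          using u1W less.prems(1) by (intro subspace_sum subspace_scale) auto
        then have "w = (\<Sum>p\<in>S0. c p *s u1 p)"
          using inj_onD[OF less.prems(7) _ w, of "\<Sum>p\<in>S0. c p *s u1 p"] c B_sum[of c] by simp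
        then show "w \<in> span (u1 ` S0)" by (auto intro: sum_in_span)
      qed
    qed
    define sh where "sh = (\<lambda>(i::nat, j). (i, Suc j))"
    define T1 where "T1 = (SIGMA i:{..<L0}. {..Suc (b0 i)})"
    define Z where "Z = (\<lambda>i::nat. (i, 0::nat)) ` {..<L0}"
    have inj_sh: "inj_on sh A" for A by (auto simp: inj_on_def sh_def)
    have T1: "T1 = Z \<union> sh ` S0" "Z \<inter> sh ` S0 = {}"
    proof -
      show "Z \<inter> sh ` S0 = {}" by (auto simp: Z_def sh_def)
      show "T1 = Z \<union> sh ` S0"
      proof (intro equalityI subsetI)
        fix p assume "p \<in> T1"
        then obtain i j where p: "p = (i, j)" "i < L0" "j \<le> Suc (b0 i)" by (auto simp: T1_def)
        show "p \<in> Z \<union> sh ` S0"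
        proof (cases j)
          case (Suc j')
          then show ?thesis using p by (auto simp: sh_def S0_def intro!: image_eqI[of _ _ "(i, j')"])
        qed (use p in \<open>auto simp: Z_def\<close>)
      qed (auto simp: Z_def sh_def S0_def T1_def)
    qed
    have S0: "S0 = Z \<union> sh ` R0" "Z \<inter> sh ` R0 = {}"
    proof -
      show "Z \<inter> sh ` R0 = {}" by (auto simp: Z_def sh_def)
      show "S0 = Z \<union> sh ` R0"
      proof (intro equalityI subsetI)
        fix p assume "p \<in> S0"
        then obtain i j where p: "p = (i, j)" "i < L0" "j \<le> b0 i" by (auto simp: S0_def)
        show "p \<in> Z \<union> sh ` R0"
        proof (cases j)
          case (Suc j')
          then show ?thesis using p pos[of i j'] by (auto simp: sh_def R0_def intro!: image_eqI[of _ _ "(i, j')"])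
        qed (use p in \<open>auto simp: Z_def\<close>)
      qed (use IH(1) in \<open>auto simp: Z_def sh_def S0_def R0_def\<close>)
    qed
    have finZ: "finite Z" "finite T1" unfolding Z_def T1_def by (rule finite_imageI finite_SigmaI; simp)+
    have u1_sh: "u1 (sh p) = u0 p" for p by (cases p) (simp add: sh_def u1_Suc)
    have split: "(\<Sum>p\<in>Z \<union> sh ` A. c p *s u1 p) = (\<Sum>p\<in>Z. c p *s u1 p) + (\<Sum>p\<in>A. c (sh p) *s u0 p)"
      if "finite A" "Z \<inter> sh ` A = {}" for c A
      using that finZ by (subst sum.union_disjoint) (auto simp: sum.reindex[OF inj_sh] u1_sh)
    have indep: "indep_fam u1 T1"
    proof (rule indep_famI[OF finZ(2)])
      fix c assume "(\<Sum>p\<in>T1. c p *s u1 p) = 0"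
      then have sum0: "(\<Sum>p\<in>Z. c p *s u1 p) + (\<Sum>p\<in>S0. c (sh p) *s u0 p) = 0"
        using split[OF fin(1) T1(2)] T1(1) by simp
      \<comment> \<open>In a relation the new first vectors contribute an \<open>x\<close> that lies
        in \<open>W\<close> and in its image, hence in \<open>W'\<close>. There \<open>x\<close> is
        also a combination of \<open>u0\<close> on \<open>R0\<close>, that is, of later string
        members. The difference of both expressions is a relation on \<open>S0\<close>, which
        \<open>B\<close> maps to one among the independent \<open>u0\<close>.\<close>
      define x where "x = (\<Sum>p\<in>Z. c p *s u1 p)"
      have "x \<in> W" unfolding x_def using u1W S0 less.prems(1)
        by (intro subspace_sum subspace_scale) auto
      moreover have "x = - (\<Sum>p\<in>S0. c (sh p) *s u0 p)" using sum0 by (simp add: x_def eq_neg_iff_add_eq_0)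
      then have "x \<in> U'" using u0U sU' by (auto intro!: subspace_neg subspace_sum subspace_scale)
      ultimately have "x \<in> span (u0 ` R0)" using IH(6) by (simp add: W'_def U'_def R0_def)
      then obtain d where d: "x = (\<Sum>p\<in>R0. d p *s u0 p)" using fin by (blast elim: span_famE)
      define c' where "c' p = (if p \<in> Z then c p else - d (the_inv_into R0 sh p))" for p
      have c'_sh: "c' (sh p) = - d p" if "p \<in> R0" for p
        using that S0(2) by (auto simp: c'_def the_inv_into_f_f[OF inj_sh])
      have c'_Z: "c' p = c p" if "p \<in> Z" for p using that by (simp add: c'_def)
      have "(\<Sum>p\<in>S0. c' p *s u1 p) = (\<Sum>p\<in>Z. c' p *s u1 p) + (\<Sum>p\<in>R0. c' (sh p) *s u0 p)"
        using split[OF fin(2) S0(2)] S0(1) by simp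
      also have "\<dots> = x + (\<Sum>p\<in>R0. - d p *s u0 p)"
        by (intro arg_cong2[where f = "(+)"]) (simp add: x_def c'_Z cong: sum.cong, simp add: c'_sh cong: sum.cong)
      also have "\<dots> = 0" by (simp add: d sum_negf)
      finally have "(\<Sum>p\<in>S0. c' p *s u0 p) = 0" using B_sum[of c'] B.zero by simp
      then have c'0: "c' p = 0" if "p \<in> S0" for p
        using indep_famD[OF IH(4)] fin that by (simp add: S0_def)
      have cZ: "c p = 0" if "p \<in> Z" for p using c'0[of p] that S0(1) by (simp add: c'_def)
      then have "(\<Sum>p\<in>S0. c (sh p) *s u0 p) = 0" using sum0 by simp
      then have "c (sh p) = 0" if "p \<in> S0" for p
        using indep_famD[OF IH(4), of "\<lambda>p. c (sh p)"] fin that by (simp add: S0_def)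
      then show "\<forall>p\<in>T1. c p = 0" using cZ T1(1) by auto
    qed
    have u1U: "u1 ` T1 \<subseteq> U"
    proof
      fix v assume "v \<in> u1 ` T1"
      then obtain p where p: "v = u1 p" "p \<in> T1" by blast
      have "Z \<subseteq> S0" using S0(1) by blast
      have "v \<in> W \<or> v \<in> U'"
      proof (cases "p \<in> Z")
        case True
        then show ?thesis using u1W \<open>Z \<subseteq> S0\<close> p(1) by blast
      next
        case False
        then obtain q where "q \<in> S0" "p = sh q" using p(2) T1(1) by blast
        then show ?thesis using u0U[of q] u1_sh[of q] p(1) by simp
      qed
      then consider "v \<in> W" | "v \<in> U'" by blast
      then show "v \<in> U" using less.prems(3,8) by cases (auto simp: U'_def)
    qed
    \<comment> \<open>What is missing for a basis of \<open>U\<close> is appended as strings of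
      length one, numbered from \<open>L0\<close> on.\<close>
    obtain C where C: "u1 ` T1 \<subseteq> C" "C \<subseteq> U" "independent C" "span C = U" "finite C"
      using basis_of_subspace[OF less.prems(2,5,4) u1U] indep by (auto simp: indep_fam_def)
    define N where "N = C - u1 ` T1"
    obtain g where g: "bij_betw g {..<card N} N"
      using ex_bij_betw_nat_finite[of N] C(5) by (auto simp: atLeast0LessThan N_def)
    define L where "L = L0 + card N"
    define b where "b i = (if i < L0 then Suc (b0 i) else 0)" for i
    define u where "u p = (if fst p < L0 then u1 p else g (fst p - L0))" for p
    define T2 where "T2 = (\<lambda>k. (L0 + k, 0::nat)) ` {..<card N}"
    have T: "(SIGMA i:{..<L}. {..b i}) = T1 \<union> T2"
    proof (intro equalityI subsetI)
      fix p assume "p \<in> (SIGMA i:{..<L}. {..b i})"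
      then obtain i j where p: "p = (i, j)" "i < L" "j \<le> b i" by auto
      show "p \<in> T1 \<union> T2"
      proof (cases "i < L0")
        case False
        then show ?thesis using p by (auto simp: b_def T2_def L_def intro!: image_eqI[of _ _ "i - L0"])
      qed (use p in \<open>auto simp: b_def T1_def\<close>)
    qed (auto simp: T1_def T2_def b_def L_def)
    have uT1: "u p = u1 p" if "p \<in> T1" for p using that by (auto simp: u_def T1_def)
    have uT2: "u (L0 + k, 0) = g k" for k by (simp add: u_def)
    have img2: "u ` T2 = N" using g by (simp add: T2_def image_image uT2 bij_betw_def)
    have img1: "u ` T1 = u1 ` T1" using uT1 by (intro image_cong) auto
    have img: "u ` (T1 \<union> T2) = C" using img1 img2 C(1) by (auto simp: image_Un N_def)
    have inj: "inj_on u (T1 \<union> T2)"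
    proof -
      have "inj_on u T1" using indep uT1 by (auto simp: indep_fam_def inj_on_def)
      moreover have "inj_on u T2" using g by (auto simp: T2_def inj_on_def uT2 bij_betw_def)
      moreover have "u ` T1 \<inter> u ` T2 = {}" unfolding img1 img2 by (auto simp: N_def)
      ultimately show ?thesis by (auto simp: inj_on_def)
    qed
    have S0b: "(SIGMA i:{..<L0}. {..<b i}) = S0"
      by (auto simp: S0_def b_def)
    have "S0 \<subseteq> T1" by (auto simp: S0_def T1_def)
    then have "u ` S0 = u1 ` S0" using uT1 by (intro image_cong) auto
    then have "span (u ` (SIGMA i:{..<L0}. {..<b i})) = W" using spanW S0b by simp
    moreover have "\<forall>i<L0. \<forall>j<b i. B (u (i, j)) = u (i, Suc j)"
      using Bu1 by (auto simp: b_def u_def u1_Suc S0_def less_Suc_eq_le)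
    moreover have "indep_fam u (SIGMA i:{..<L}. {..b i})" "span (u ` (SIGMA i:{..<L}. {..b i})) = U"
      unfolding T img using inj img C by (auto simp: indep_fam_def)
    ultimately show ?thesis
      by (intro exI[of _ L0] exI[of _ L] exI[of _ b] exI[of _ u]) (auto simp: b_def L_def)
  qed
qed

end

section \<open>Spaces of functions\<close>

definition fscale :: "'k::field \<Rightarrow> ('x \<Rightarrow> 'k) \<Rightarrow> 'x \<Rightarrow> 'k" where
  "fscale c f = (\<lambda>x. c * f x)"

lemma fscale_apply [simp]: "fscale c f x = c * f x"
  by (simp add: fscale_def)

interpretation fs: vec_space "fscale :: 'k::field \<Rightarrow> ('x \<Rightarrow> 'k) \<Rightarrow> 'x \<Rightarrow> 'k"
  by unfold_locales (auto simp: fun_eq_iff algebra_simps)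

lemma sum_fun_apply [simp]: "(\<Sum>i\<in>I. f i) x = (\<Sum>i\<in>I. f i x)"
  for f :: "'i \<Rightarrow> 'x \<Rightarrow> 'k::comm_monoid_add"
  by (induction I rule: infinite_finite_induct) auto

subsection \<open>Algebraic dependence by counting monomials\<close>

text \<open>Functions on points, with every exponent bounded separately, so that their number is at
  most a plain power, \<open>Suc \<delta> ^ card V\<close>.\<close>

definition monomials :: "nat set \<Rightarrow> nat \<Rightarrow> ((nat \<Rightarrow> 'k::field) \<Rightarrow> 'k) set" where
  "monomials V \<delta> = (\<lambda>\<nu> y. \<Prod>i\<in>V. y i ^ \<nu> i) ` (V \<rightarrow>\<^sub>E {..\<delta>})"

lemma finite_monomials: "finite V \<Longrightarrow> finite (monomials V \<delta>)"
  by (simp add: monomials_def finite_PiE)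

lemma card_monomials: "finite V \<Longrightarrow> card (monomials V \<delta> :: ((nat \<Rightarrow> 'k::field) \<Rightarrow> 'k) set) \<le> Suc \<delta> ^ card V"
  unfolding monomials_def
  by (rule order_trans[OF card_image_le]) (auto simp: finite_PiE card_PiE)

lemma monomialsI:
  assumes "\<And>i. i \<in> V \<Longrightarrow> \<nu> i \<le> \<delta>"
  shows "(\<lambda>y. \<Prod>i\<in>V. y i ^ \<nu> i) \<in> monomials V \<delta>"
  unfolding monomials_def
  by (rule image_eqI[of _ _ "restrict \<nu> V"]) (use assms in \<open>auto simp: fun_eq_iff intro!: prod.cong\<close>)

lemma monomials_mono: "\<delta> \<le> \<delta>' \<Longrightarrow> monomials V \<delta> \<subseteq> monomials V \<delta>'"
  unfolding monomials_def by (intro image_mono PiE_mono) auto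

lemma span_monomials_mult:
  assumes "F \<in> fs.span (monomials V \<delta>)" "G \<in> fs.span (monomials V \<delta>')"
  shows "F * G \<in> fs.span (monomials V (\<delta> + \<delta>'))"
  using assms(1)
proof (induction rule: fs.span_induct_alt)
  case (step c M F)
  have "M * G \<in> fs.span (monomials V (\<delta> + \<delta>'))"
    using assms(2)
  proof (induction rule: fs.span_induct_alt)
    case (step c' M' G)
    obtain \<nu> where nu: "\<nu> \<in> V \<rightarrow>\<^sub>E {..\<delta>}" "M = (\<lambda>y. \<Prod>i\<in>V. y i ^ \<nu> i)"
      using \<open>M \<in> monomials V \<delta>\<close> by (auto simp: monomials_def)
    obtain \<nu>' where nu': "\<nu>' \<in> V \<rightarrow>\<^sub>E {..\<delta>'}" "M' = (\<lambda>y. \<Prod>i\<in>V. y i ^ \<nu>' i)"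
      using \<open>M' \<in> monomials V \<delta>'\<close> by (auto simp: monomials_def)
    have "M * M' = (\<lambda>y. \<Prod>i\<in>V. y i ^ (\<nu> i + \<nu>' i))"
      by (simp add: nu nu' fun_eq_iff power_add prod.distrib)
    also have "\<dots> \<in> monomials V (\<delta> + \<delta>')"
      using nu nu' by (intro monomialsI add_mono) (auto simp: PiE_iff)
    finally have "M * M' \<in> fs.span (monomials V (\<delta> + \<delta>'))" by (rule fs.span_base)
    moreover have "M * (fscale c' M' + G) = fscale c' (M * M') + M * G"
      by (simp add: fun_eq_iff algebra_simps)
    ultimately show ?case using fs.span_add[OF fs.span_scale[of "M * M'" _ c'] step.IH] by (simp only:)
  qed (simp only: mult_zero_right mult_zero_left fs.span_zero)
  moreover have "(fscale c M + F) * G = fscale c (M * G) + F * G"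
    by (simp add: fun_eq_iff algebra_simps)
  ultimately show ?case using fs.span_add[OF fs.span_scale[of "M * G" _ c] step.IH] by (simp only:)
qed (simp only: mult_zero_right mult_zero_left fs.span_zero)

lemma span_monomials_one: "1 \<in> fs.span (monomials V \<delta>)"
  by (rule fs.span_base) (use monomialsI[of V "\<lambda>_. 0" \<delta>] in \<open>simp add: one_fun_def\<close>)

lemma span_monomials_power:
  "F \<in> fs.span (monomials V \<delta>) \<Longrightarrow> F ^ n \<in> fs.span (monomials V (n * \<delta>))"
  by (induction n) (auto intro: span_monomials_mult span_monomials_one)

lemma span_monomials_prod:
  "(\<And>i. i \<in> I \<Longrightarrow> F i \<in> fs.span (monomials V (\<delta> i))) \<Longrightarrow>
    (\<Prod>i\<in>I. F i) \<in> fs.span (monomials V (\<Sum>i\<in>I. \<delta> i))"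
  by (induction I rule: infinite_finite_induct) (auto intro: span_monomials_mult span_monomials_one)

lemma eval_in_span_monomials:
  fixes f :: "'k::field mpoly"
  assumes "f \<in> vpolys V" "finite V"
  shows "\<exists>\<delta>. eval f \<in> fs.span (monomials V \<delta>)"
proof -
  define \<delta> where "\<delta> = (\<Sum>m\<in>Poly_Mapping.keys f. \<Sum>i\<in>V. Poly_Mapping.lookup m i)"
  have "(mono_eval m :: (nat \<Rightarrow> 'k) \<Rightarrow> 'k) \<in> monomials V \<delta>" if m: "m \<in> Poly_Mapping.keys f" for m
  proof -
    have "Poly_Mapping.lookup m i \<le> \<delta>" if "i \<in> V" for i
    proof -
      have "Poly_Mapping.lookup m i \<le> (\<Sum>i\<in>V. Poly_Mapping.lookup m i)"
        using that assms(2) by (intro member_le_sum) auto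
      also have "\<dots> \<le> \<delta>" unfolding \<delta>_def using m by (intro member_le_sum) auto
      finally show ?thesis .
    qed
    moreover have "(mono_eval m :: (nat \<Rightarrow> 'k) \<Rightarrow> 'k) = (\<lambda>y. \<Prod>i\<in>V. y i ^ Poly_Mapping.lookup m i)"
      using mono_eval_superset[OF assms(2), of m] assms(1) m by (auto simp: vpolys_def)
    ultimately show ?thesis using monomialsI[of V "Poly_Mapping.lookup m" \<delta>] by simp
  qed
  moreover have "eval f = (\<Sum>m\<in>Poly_Mapping.keys f. fscale (Poly_Mapping.lookup f m) (mono_eval m))"
    by (simp add: fun_eq_iff eval_def mono_eval_def)
  ultimately show ?thesis by (auto intro!: exI[of _ \<delta>] fs.sum_in_span)
qed

text \<open>Exponent vectors are zero outside of \<open>A\<close>, not undefined, so that deleting a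
  variable is an update with 0.\<close>

definition exponents :: "nat set \<Rightarrow> nat \<Rightarrow> (nat \<Rightarrow> nat) set" where
  "exponents A e = (\<lambda>\<mu> i. if i \<in> A then \<mu> i else 0) ` (A \<rightarrow>\<^sub>E {..e})"

lemma finite_exponents: "finite A \<Longrightarrow> finite (exponents A e)"
  by (simp add: exponents_def finite_PiE)

lemma card_exponents: "finite A \<Longrightarrow> card (exponents A e) = Suc e ^ card A"
  unfolding exponents_def
proof (subst card_image)
  show "inj_on (\<lambda>\<mu> i. if i \<in> A then \<mu> i else 0) (A \<rightarrow>\<^sub>E {..e})"
  proof (rule inj_onI, rule ext)
    fix \<mu> \<nu> and i :: nat
    assume *: "\<mu> \<in> A \<rightarrow>\<^sub>E {..e}" "\<nu> \<in> A \<rightarrow>\<^sub>E {..e}"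
      "(\<lambda>i. if i \<in> A then \<mu> i else 0) = (\<lambda>i. if i \<in> A then \<nu> i else 0)"
    show "\<mu> i = \<nu> i"
      using fun_cong[OF *(3), of i] PiE_arb[OF *(1), of i] PiE_arb[OF *(2), of i] by (cases "i \<in> A") simp_all
  qed
qed (simp add: card_PiE)

lemma exponentsD: "\<mu> \<in> exponents A e \<Longrightarrow> \<mu> i \<le> e" "\<mu> \<in> exponents A e \<Longrightarrow> i \<notin> A \<Longrightarrow> \<mu> i = 0"
  by (auto simp: exponents_def PiE_iff)

text \<open>Pure counting, valid over every field: there are more products of the \<open>g i\<close>
  with exponents up to \<open>e\<close> than monomials that can occur in them.\<close>

lemma algebraically_dependent:
  fixes g :: "nat \<Rightarrow> 'k::field mpoly"
  assumes "finite V" "finite A" "card V < card A" and g: "\<And>i. i \<in> A \<Longrightarrow> g i \<in> vpolys V"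
  shows "\<exists>K c. finite K \<and> K \<noteq> {} \<and> (\<forall>\<mu>\<in>K. c \<mu> \<noteq> 0 \<and> (\<forall>i. i \<notin> A \<longrightarrow> \<mu> i = 0)) \<and>
    (\<forall>y. (\<Sum>\<mu>\<in>K. c \<mu> * (\<Prod>i\<in>A. eval (g i) y ^ \<mu> i)) = 0)"
proof -
  obtain \<delta> where \<delta>: "\<And>i. i \<in> A \<Longrightarrow> eval (g i) \<in> fs.span (monomials V (\<delta> i))"
    using eval_in_span_monomials[OF g assms(1)] by metis
  define k where "k = Suc (\<Sum>i\<in>A. \<delta> i)"
  \<comment> \<open>Monomials with exponents up to \<open>k * e\<close> number at most
    \<open>k ^ card V * Suc e ^ card V\<close>; this \<open>e\<close> makes the first factor smaller
    than \<open>Suc e\<close>.\<close>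
  define e where "e = k ^ card V"
  define F where "F \<mu> = (\<Prod>i\<in>A. eval (g i) ^ \<mu> i)" for \<mu> :: "nat \<Rightarrow> nat"
  have F: "F \<mu> \<in> fs.span (monomials V (k * e))" if mu: "\<mu> \<in> exponents A e" for \<mu>
  proof -
    have "F \<mu> \<in> fs.span (monomials V (\<Sum>i\<in>A. \<mu> i * \<delta> i))"
      unfolding F_def by (intro span_monomials_prod span_monomials_power \<delta>)
    moreover have "(\<Sum>i\<in>A. \<mu> i * \<delta> i) \<le> (\<Sum>i\<in>A. e * \<delta> i)"
      by (intro sum_mono mult_right_mono exponentsD[OF mu]) auto
    then have "(\<Sum>i\<in>A. \<mu> i * \<delta> i) \<le> k * e" by (simp add: k_def sum_distrib_left[symmetric] mult.commute)
    ultimately show ?thesis using fs.span_mono[OF monomials_mono] by blast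
  qed
  have "card (monomials V (k * e) :: ((nat \<Rightarrow> 'k) \<Rightarrow> 'k) set) \<le> Suc (k * e) ^ card V"
    by (rule card_monomials) fact
  also have "\<dots> \<le> (k * Suc e) ^ card V" by (rule power_mono) (auto simp: k_def)
  also have "\<dots> = e * Suc e ^ card V" by (simp only: power_mult_distrib e_def)
  also have "\<dots> < Suc e * Suc e ^ card V" by simp
  also have "\<dots> = Suc e ^ Suc (card V)" by simp
  also have "\<dots> \<le> Suc e ^ card A" using assms(3) by (intro power_increasing) auto
  also have "\<dots> = card (exponents A e)" using card_exponents[OF assms(2)] by simp
  finally obtain c where c: "\<exists>\<mu>\<in>exponents A e. c \<mu> \<noteq> 0" "(\<Sum>\<mu>\<in>exponents A e. fscale (c \<mu>) (F \<mu>)) = 0"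
    using fs.nontrivial_relation[OF finite_exponents[OF assms(2)] finite_monomials[OF assms(1)], of F] F by blast
  have Fy: "F \<mu> y = (\<Prod>i\<in>A. eval (g i) y ^ \<mu> i)" for \<mu> y
  proof -
    have pw: "(h ^ n) y = h y ^ n" for h :: "(nat \<Rightarrow> 'k) \<Rightarrow> 'k" and n by (induction n) auto
    have "(\<Prod>i\<in>A. h i) y = (\<Prod>i\<in>A. h i y)" for h :: "nat \<Rightarrow> (nat \<Rightarrow> 'k) \<Rightarrow> 'k" and A
      by (induction A rule: infinite_finite_induct) auto
    then show ?thesis by (simp add: F_def pw)
  qed
  have "(\<Sum>\<mu>\<in>exponents A e. c \<mu> * F \<mu> y) = 0" for y using fun_cong[OF c(2), of y] by simp
  moreover have "(\<Sum>\<mu>\<in>{\<mu>\<in>exponents A e. c \<mu> \<noteq> 0}. c \<mu> * F \<mu> y) = (\<Sum>\<mu>\<in>exponents A e. c \<mu> * F \<mu> y)" for y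
    using finite_exponents[OF assms(2)] by (intro sum.mono_neutral_left) auto
  ultimately show ?thesis
    using c(1) finite_exponents[OF assms(2)] exponentsD(2)
    by (intro exI[of _ "{\<mu>\<in>exponents A e. c \<mu> \<noteq> 0}"] exI[of _ c]) (auto simp: Fy)
qed

subsection \<open>Linear maps between the spaces \<open>affsp\<close>\<close>

definition unit_vec :: "nat \<Rightarrow> nat \<Rightarrow> 'k::field" where
  "unit_vec i = (\<lambda>j. if j = i then 1 else 0)"

lemma unit_vec_apply: "unit_vec i j = (if j = i then 1 else 0)"
  by (simp add: unit_vec_def)

lemma unit_vec_affsp: "i \<le> s \<Longrightarrow> unit_vec i \<in> affsp s"
  by (auto simp: affsp_def unit_vec_def)

lemma subspace_affsp: "fs.subspace (affsp s)"
  by (auto simp: fs.subspace_def affsp_def)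

lemma sum_unit_vec: "finite A \<Longrightarrow> (\<Sum>i\<in>A. c i * unit_vec i j) = (if j \<in> A then c j else 0)"
  by (simp add: unit_vec_def if_distrib[of "\<lambda>x. _ * x"] cong: if_cong)

lemma affsp_expand:
  assumes "x \<in> affsp s"
  shows "x = (\<Sum>i\<le>s. fscale (x i) (unit_vec i))"
proof
  fix j
  have "j \<notin> {..s} \<Longrightarrow> x j = 0" using assms by (simp add: affsp_def)
  then show "x j = (\<Sum>i\<le>s. fscale (x i) (unit_vec i)) j"
    unfolding sum_fun_apply fscale_apply by (subst sum_unit_vec) auto
qed

lemma affsp_subset_span: "affsp s \<subseteq> fs.span (unit_vec ` {..s})"
proof
  fix x :: "nat \<Rightarrow> 'a" assume "x \<in> affsp s"
  then show "x \<in> fs.span (unit_vec ` {..s})"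
    by (subst affsp_expand) (auto intro: fs.sum_in_span)
qed

lemma card_unit_vecs: "card (unit_vec ` {..s} :: (nat \<Rightarrow> 'k::field) set) \<le> Suc s"
  using card_image_le[of "{..s}" unit_vec] by simp

lemma linmap_affsp [simp]: "linmap s t M x \<in> affsp t"
  by (auto simp: linmap_def affsp_def)

lemma linmap_add: "linmap s t M (x + y) = linmap s t M x + linmap s t M y"
  by (auto simp: linmap_def fun_eq_iff algebra_simps sum.distrib)

lemma linmap_scale: "linmap s t M (fscale c x) = fscale c (linmap s t M x)"
  by (auto simp: linmap_def fun_eq_iff sum_distrib_left algebra_simps)

lemma linear_linmap: "Vector_Spaces.linear fscale fscale (linmap s t M)"
  using fs.vector_space_axioms by unfold_locales (auto simp: linmap_add linmap_scale)

lemma linmap_zero [simp]: "linmap s t M 0 = 0"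
  by (auto simp: linmap_def fun_eq_iff)

lemma linmap_diff: "linmap s t M (x - y) = linmap s t M x - linmap s t M y"
  by (auto simp: linmap_def fun_eq_iff right_diff_distrib sum_subtractf)

lemma linmap_sum: "linmap s t M (\<Sum>i\<in>I. fscale (c i) (v i)) = (\<Sum>i\<in>I. fscale (c i) (linmap s t M (v i)))"
proof -
  interpret l: Vector_Spaces.linear fscale fscale "linmap s t M" by (rule linear_linmap)
  show ?thesis by (simp only: l.sum l.scale)
qed

lemma linmap_columns:
  "linmap s t (\<lambda>i j. v j i) x = (\<Sum>j\<le>s. fscale (x j) (v j))" if "\<And>j. j \<le> s \<Longrightarrow> v j \<in> affsp t"
  using that by (auto simp: linmap_def fun_eq_iff affsp_def mult.commute intro!: sum.cong)

lemma linmap_comp: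
  "linmap t u M (linmap s t N x) = linmap s u (\<lambda>i j. \<Sum>k\<le>t. M i k * N k j) x"
  by (auto simp: linmap_def fun_eq_iff sum_distrib_left sum_distrib_right mult.assoc intro: sum.swap)

text \<open>Surjectivity by dimension: a vector outside of the image, together with the images of
  the unit vectors, would give \<open>r + 2\<close> independent vectors in a space spanned by
  \<open>r + 1\<close>.\<close>

lemma linmap_bij:
  fixes M :: "nat \<Rightarrow> nat \<Rightarrow> 'k::field"
  assumes "\<And>x. x \<in> affsp r \<Longrightarrow> linmap r r M x = 0 \<Longrightarrow> x = 0"
  shows "bij_betw (linmap r r M) (affsp r) (affsp r)"
proof -
  let ?f = "linmap r r M"
  let ?u = "\<lambda>i. ?f (unit_vec i)"
  have inj: "inj_on ?f (affsp r)"
  proof (rule inj_onI)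
    fix x y assume *: "x \<in> affsp r" "y \<in> affsp r" "?f x = ?f y"
    then have "?f (x - y) = 0" by (simp add: linmap_diff)
    moreover have "x - y \<in> affsp r" using * by (auto simp: affsp_def)
    ultimately have "x - y = 0" using assms by blast
    then show "x = y" by simp
  qed
  have ind: "fs.indep_fam ?u {..r}"
  proof (rule fs.indep_famI)
    fix c assume "(\<Sum>i\<le>r. fscale (c i) (?u i)) = 0"
    then have "?f (\<Sum>i\<le>r. fscale (c i) (unit_vec i)) = 0" by (simp add: linmap_sum)
    moreover have "(\<Sum>i\<le>r. fscale (c i) (unit_vec i)) \<in> affsp r"
      by (auto simp: affsp_def sum_unit_vec)
    ultimately have "(\<Sum>i\<le>r. fscale (c i) (unit_vec i)) = 0" using assms by blast
    then have "(\<Sum>i\<le>r. c i * unit_vec i j) = 0" for j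
      by (metis (no_types, lifting) fscale_apply sum.cong sum_fun_apply zero_fun_apply)
    then have "(if j \<le> r then c j else 0) = 0" for j by (simp add: sum_unit_vec)
    then show "\<forall>i\<in>{..r}. c i = 0" by (metis atMost_iff)
  qed simp
  have "affsp r \<subseteq> ?f ` affsp r"
  proof (rule ccontr)
    assume "\<not> affsp r \<subseteq> ?f ` affsp r"
    then obtain y where y: "y \<in> affsp r" "y \<notin> ?f ` affsp r" by blast
    have "fs.span (?u ` {..r}) \<subseteq> ?f ` affsp r"
    proof
      fix v assume "v \<in> fs.span (?u ` {..r})"
      then obtain c where c: "v = (\<Sum>i\<le>r. fscale (c i) (?u i))" by (blast elim: fs.span_famE)
      then have "v = ?f (\<Sum>i\<le>r. fscale (c i) (unit_vec i))" by (simp add: linmap_sum)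
      moreover have "(\<Sum>i\<le>r. fscale (c i) (unit_vec i)) \<in> affsp r" by (auto simp: affsp_def sum_unit_vec)
      ultimately show "v \<in> ?f ` affsp r" by blast
    qed
    then have "y \<notin> fs.span (?u ` {..r})" using y by blast
    then have "fs.independent (insert y (?u ` {..r}))"
      using ind by (simp add: fs.independent_insert fs.indep_fam_def)
    moreover have "insert y (?u ` {..r}) \<subseteq> fs.span (unit_vec ` {..r})"
      using y affsp_subset_span[of r] linmap_affsp by blast
    ultimately have "card (insert y (?u ` {..r})) \<le> card (unit_vec ` {..r} :: (nat \<Rightarrow> 'k) set)"
      using fs.independent_span_bound by blast
    moreover have "card (?u ` {..r}) = Suc r"
      using ind by (auto simp: fs.indep_fam_def card_image)
    moreover have "y \<notin> ?u ` {..r}" using y by (auto intro: unit_vec_affsp)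
    ultimately show False using card_unit_vecs[of r, where 'k = 'k] by simp
  qed
  then show ?thesis using inj by (auto simp: bij_betw_def)
qed

lemma linmap_inverse:
  fixes M :: "nat \<Rightarrow> nat \<Rightarrow> 'k::field"
  assumes "bij_betw (linmap r r M) (affsp r) (affsp r)"
  obtains N where "\<And>x. x \<in> affsp r \<Longrightarrow> linmap r r N (linmap r r M x) = x"
    and "\<And>y. y \<in> affsp r \<Longrightarrow> linmap r r M (linmap r r N y) = y"
proof -
  let ?f = "linmap r r M"
  let ?g = "the_inv_into (affsp r) ?f"
  have fg: "?f (?g y) = y" "?g y \<in> affsp r" if "y \<in> affsp r" for y
    using that assms f_the_inv_into_f_bij_betw[OF assms, of y] bij_betwE[OF bij_betw_the_inv_into[OF assms]] by auto
  define N where "N = (\<lambda>i j. ?g (unit_vec j) i)"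
  have 1: "?f (linmap r r N y) = y" if y: "y \<in> affsp r" for y
  proof -
    have "linmap r r N y = (\<Sum>j\<le>r. fscale (y j) (?g (unit_vec j)))"
      unfolding N_def by (rule linmap_columns) (auto intro: fg unit_vec_affsp)
    then have "?f (linmap r r N y) = (\<Sum>j\<le>r. fscale (y j) (unit_vec j))"
      by (simp add: linmap_sum fg unit_vec_affsp)
    then show ?thesis using affsp_expand[OF y] by simp
  qed
  have "linmap r r N (?f x) = x" if "x \<in> affsp r" for x
    using 1[of "?f x"] that assms by (auto simp: bij_betw_def dest!: inj_onD)
  with 1 show ?thesis using that by blast
qed

lemma indep_unit_vec: "fs.indep_fam (unit_vec :: nat \<Rightarrow> nat \<Rightarrow> 'k::field) {..r}"
proof (rule fs.indep_famI)
  fix c :: "nat \<Rightarrow> 'k" assume 0: "(\<Sum>i\<le>r. fscale (c i) (unit_vec i)) = 0"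
  have "(if j \<le> r then c j else 0) = 0" for j
    using fun_cong[OF 0, of j] by (simp add: sum_unit_vec)
  then show "\<forall>i\<in>{..r}. c i = 0" by (metis atMost_iff)
qed simp

lemma sum_unit_vec_fscale:
  assumes "finite A" "k \<in> A"
  shows "(\<Sum>j\<in>A. fscale (unit_vec k j) (w j)) = w k"
proof -
  have "(\<Sum>j\<in>A. fscale (unit_vec k j) (w j)) = (\<Sum>j\<in>{k}. fscale (unit_vec k j) (w j))"
    using assms by (intro sum.mono_neutral_right) (auto simp: unit_vec_def fun_eq_iff)
  then show ?thesis by (simp add: unit_vec_def fscale_def)
qed

section \<open>Polynomial curves and irreducibility\<close>

text \<open>Over a finite field the product of all \<open>X - a\<close>, increased by 1, has
  positive degree and no root.\<close>

lemma alg_closed_infinite: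
  assumes "alg_closed TYPE('k::field)"
  shows "infinite (UNIV :: 'k set)"
proof
  assume fin: "finite (UNIV :: 'k set)"
  define p :: "'k poly" where "p = (\<Prod>a\<in>UNIV. [:- a, 1:]) + 1"
  have "degree (\<Prod>a\<in>(UNIV :: 'k set). [:- a, 1:]) = card (UNIV :: 'k set)"
    using fin by (subst degree_prod_eq_sum_degree) auto
  moreover have "card (UNIV :: 'k set) \<ge> 1" using fin by (simp add: Suc_leI finite_UNIV_card_ge_0)
  ultimately have "degree p \<ge> 1"
    by (simp add: p_def degree_add_eq_left)
  then obtain x where "poly p x = 0" using assms by (auto simp: alg_closed_def)
  moreover have "poly (\<Prod>a\<in>(UNIV :: 'k set). [:- a, 1:]) x = 0"
    using fin by (auto simp: poly_prod)
  ultimately show False by (simp add: p_def)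
qed

lemma poly_zero_if_vanishes:
  assumes "infinite (UNIV :: 'k::field set)" "finite A" "\<And>x. x \<notin> A \<Longrightarrow> poly p x = (0 :: 'k)"
  shows "p = 0"
proof (rule ccontr)
  assume "p \<noteq> 0"
  then have "finite {x. poly p x = 0}" by (rule poly_roots_finite)
  moreover have "UNIV \<subseteq> A \<union> {x. poly p x = 0}" using assms(3) by auto
  ultimately show False using assms(1,2) finite_subset finite_UnI by blast
qed

text \<open>A substitute for polynomial functions: only the restrictions to polynomial curves have
  to be polynomials. That is all that arguments with limits and connecting curves use.\<close>

definition curve_poly :: "((nat \<Rightarrow> 'k::field) \<Rightarrow> 'k) \<Rightarrow> bool" where
  "curve_poly F \<longleftrightarrow> (\<forall>p. \<exists>q. \<forall>t. F (\<lambda>i. poly (p i) t) = poly q t)"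

lemma curve_poly_const [intro]: "curve_poly (\<lambda>_. c)"
  unfolding curve_poly_def by (intro allI exI[of _ "[:c:]"]) simp

lemma curve_poly_coord [intro]: "curve_poly (\<lambda>x. x i)"
  by (auto simp: curve_poly_def)

lemma curve_poly_add [intro]: "curve_poly F \<Longrightarrow> curve_poly G \<Longrightarrow> curve_poly (\<lambda>x. F x + G x)"
  unfolding curve_poly_def by (metis poly_add)

lemma curve_poly_mult [intro]: "curve_poly F \<Longrightarrow> curve_poly G \<Longrightarrow> curve_poly (\<lambda>x. F x * G x)"
  unfolding curve_poly_def by (metis poly_mult)

lemma curve_poly_diff [intro]: "curve_poly F \<Longrightarrow> curve_poly G \<Longrightarrow> curve_poly (\<lambda>x. F x - G x)"
  unfolding curve_poly_def by (metis poly_diff)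

lemma curve_poly_power [intro]: "curve_poly F \<Longrightarrow> curve_poly (\<lambda>x. F x ^ n)"
  by (induction n) auto

lemma curve_poly_sum [intro]: "(\<And>i. i \<in> I \<Longrightarrow> curve_poly (F i)) \<Longrightarrow> curve_poly (\<lambda>x. \<Sum>i\<in>I. F i x)"
  by (induction I rule: infinite_finite_induct) auto

lemma curve_poly_prod [intro]: "(\<And>i. i \<in> I \<Longrightarrow> curve_poly (F i)) \<Longrightarrow> curve_poly (\<lambda>x. \<Prod>i\<in>I. F i x)"
  by (induction I rule: infinite_finite_induct) auto

lemma curve_poly_eval: "(\<And>i. curve_poly (G i)) \<Longrightarrow> curve_poly (\<lambda>x. eval f (\<lambda>i. G i x))"
  unfolding eval_def by (intro curve_poly_sum curve_poly_mult curve_poly_prod curve_poly_power curve_poly_const)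

lemma curve_poly_linmap: "curve_poly (\<lambda>x. linmap s t M x i)"
  unfolding linmap_def
  by (cases "i \<le> t") (auto intro!: curve_poly_sum curve_poly_mult)

lemma curve_poly_eval_linmap: "curve_poly (\<lambda>x. eval f (linmap s t M x))"
  using curve_poly_eval[of "\<lambda>i x. linmap s t M x i" f] curve_poly_linmap by blast

text \<open>If two closed sets cover \<open>Z\<close> but miss \<open>x\<close> and \<open>y\<close>
  respectively, they have equations \<open>f\<close>, \<open>g\<close> whose product vanishes along
  the curve from \<open>x\<close> to \<open>y\<close>, although neither factor does.\<close>

lemma irred_proj_if_curves:
  assumes inf: "infinite (UNIV :: 'k::field set)" and "Z \<noteq> {}" "Z \<subseteq> PP r"
    and curve: "\<And>x y :: nat \<Rightarrow> 'k. x \<in> Z \<Longrightarrow> y \<in> Z \<Longrightarrow> \<exists>p. x = (\<lambda>i. poly (p i) 0) \<and> y = (\<lambda>i. poly (p i) 1) \<and>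
      (\<forall>t. (\<lambda>i. poly (p i) t) \<noteq> 0 \<longrightarrow> (\<lambda>i. poly (p i) t) \<in> Z)"
  shows "irred_proj r Z"
  unfolding irred_proj_def
proof (intro conjI allI impI)
  fix Z1 Z2 assume "closed_proj r Z1" "closed_proj r Z2" and Z: "Z = Z1 \<union> Z2"
  then obtain F1 F2 where F: "Z1 = zero_set r F1" "Z2 = zero_set r F2" by (auto simp: closed_proj_def)
  show "Z = Z1 \<or> Z = Z2"
  proof (rule ccontr)
    assume "\<not> ?thesis"
    then obtain x y where xy: "x \<in> Z" "x \<notin> Z1" "y \<in> Z" "y \<notin> Z2" using Z by blast
    then obtain f g where fg: "f \<in> F1" "eval f x \<noteq> 0" "g \<in> F2" "eval g y \<noteq> 0"
      using F \<open>Z \<subseteq> PP r\<close> by (auto simp: zero_set_def)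
    obtain p where p: "x = (\<lambda>i. poly (p i) 0)" "y = (\<lambda>i. poly (p i) 1)"
      "\<And>t. (\<lambda>i. poly (p i) t) \<noteq> 0 \<Longrightarrow> (\<lambda>i. poly (p i) t) \<in> Z" using curve[OF xy(1,3)] by blast
    have cp: "curve_poly (eval h)" for h :: "'k mpoly" using curve_poly_eval[of "\<lambda>i x. x i" h] by auto
    obtain qf where qf: "\<And>t. eval f (\<lambda>i. poly (p i) t) = poly qf t" using cp[of f] by (auto simp: curve_poly_def)
    obtain qg where qg: "\<And>t. eval g (\<lambda>i. poly (p i) t) = poly qg t" using cp[of g] by (auto simp: curve_poly_def)
    have "x \<noteq> 0" using xy(1) \<open>Z \<subseteq> PP r\<close> by (auto simp: PP_def zero_fun_def)
    then obtain k where k: "x k \<noteq> 0" by (auto simp: fun_eq_iff)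
    have "poly (qf * qg * p k) t = 0" for t
    proof (cases "(\<lambda>i. poly (p i) t) = 0")
      case True
      then have "poly (p k) t = 0" by (metis zero_fun_apply)
      then show ?thesis by simp
    next
      case False
      then have "(\<lambda>i. poly (p i) t) \<in> Z1 \<union> Z2" using p(3) Z by blast
      then have "eval f (\<lambda>i. poly (p i) t) = 0 \<or> eval g (\<lambda>i. poly (p i) t) = 0"
        using F fg by (auto simp: zero_set_def)
      then show ?thesis by (auto simp: qf qg)
    qed
    then have "qf * qg * p k = 0" using poly_zero_if_vanishes[OF inf, of "{}"] by blast
    moreover have "qf \<noteq> 0" using fg(2) qf[of 0] p(1) by auto
    moreover have "qg \<noteq> 0" using fg(4) qg[of 1] p(2) by auto
    moreover have "p k \<noteq> 0" using k p(1) by auto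
    ultimately show False by simp
  qed
qed fact

subsection \<open>Determinantal description of scrolls\<close>

text \<open>Only the set of columns is kept, and it is arbitrary; a single column has no minors and
  yields all of projective space.\<close>

definition det_scroll :: "nat \<Rightarrow> nat set \<Rightarrow> (nat \<Rightarrow> 'k::comm_ring_1) set" where
  "det_scroll s J = {x \<in> PP s. \<forall>i\<in>J. \<forall>j\<in>J. x i * x (Suc j) = x j * x (Suc i)}"

lemma std_scroll_eq: "std_scroll s n l a = det_scroll s (scroll_cols n l a)"
  by (simp add: std_scroll_def det_scroll_def)

lemma PP_iff: "x \<in> PP s \<longleftrightarrow> x \<in> affsp s \<and> x \<noteq> 0"
  by (auto simp: PP_def zero_fun_def)

lemma PP_nonzeroE:
  assumes "x \<in> PP s" obtains i where "x i \<noteq> 0"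
  using assms by (auto simp: PP_def fun_eq_iff)

text \<open>Rank at most one means proportional rows; the second alternative is the ratio at
  infinity.\<close>

lemma det_scroll_cases:
  fixes x :: "nat \<Rightarrow> 'k::field"
  assumes "x \<in> det_scroll s J"
  obtains \<tau> where "\<And>j. j \<in> J \<Longrightarrow> x (Suc j) = \<tau> * x j" | "\<And>j. j \<in> J \<Longrightarrow> x j = 0"
proof (cases "\<exists>k\<in>J. x k \<noteq> 0")
  case True
  then obtain k where k: "k \<in> J" "x k \<noteq> 0" by blast
  have "x (Suc j) = x (Suc k) / x k * x j" if "j \<in> J" for j
    using assms k that by (auto simp: det_scroll_def field_simps)
  then show ?thesis using that by blast
qed (use that in blast)

lemma det_scrollI:
  assumes "x \<in> PP s" "\<And>j. j \<in> J \<Longrightarrow> x (Suc j) = \<tau> * x j"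
  shows "x \<in> det_scroll s J"
  using assms by (auto simp: det_scroll_def)

lemma det_scroll_scale: "x \<in> det_scroll s J \<Longrightarrow> c \<noteq> 0 \<Longrightarrow> fscale c x \<in> det_scroll s J"
  by (auto simp: det_scroll_def PP_def affsp_def fun_eq_iff)

text \<open>The points outside of the chart are limits of the curves \<open>t \<mapsto> (t ^ k i * x (i + k i))\<close>, where
  \<open>i + k i\<close> is the last index of the string through \<open>i\<close>.\<close>
lemma vanishes_on_det_scroll:
  fixes F :: "(nat \<Rightarrow> 'k::field) \<Rightarrow> 'k"
  assumes inf: "infinite (UNIV :: 'k set)" and J: "J \<subseteq> {..<s}" and F: "curve_poly F"
    and chart: "\<And>x \<tau>. x \<in> PP s \<Longrightarrow> (\<And>j. j \<in> J \<Longrightarrow> x (Suc j) = \<tau> * x j) \<Longrightarrow> F x = 0"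
    and x: "x \<in> det_scroll s J"
  shows "F x = 0"
  using x
proof (cases rule: det_scroll_cases)
  case (1 \<tau>)
  then show ?thesis using chart[of x \<tau>] x by (auto simp: det_scroll_def)
next
  case 2
  have xs: "x \<in> affsp s" using x by (simp add: det_scroll_def PP_def)
  define k where "k i = (LEAST k. i + k \<notin> J)" for i
  have ex: "i + (s - i) \<notin> J" for i using J by auto
  have k0: "k i = 0" if "i \<notin> J" for i using that by (simp add: k_def Least_eq_0)
  have kS: "k j = Suc (k (Suc j))" if "j \<in> J" for j
    unfolding k_def using Least_Suc[of "\<lambda>k. j + k \<notin> J", OF ex] that by simp
  \<comment> \<open>For \<open>t \<noteq> 0\<close> the rows have ratio \<open>1 / t\<close>. At
    \<open>t = 0\<close> only coordinates outside of \<open>J\<close> survive, and these include all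
    nonzero coordinates of \<open>x\<close>.\<close>
  define p where "p i = monom (x (i + k i)) (k i)" for i
  obtain q where q: "\<And>t. F (\<lambda>i. poly (p i) t) = poly q t" using F by (auto simp: curve_poly_def)
  obtain m where m: "x m \<noteq> 0" using x by (auto simp: det_scroll_def elim: PP_nonzeroE)
  then have "m \<notin> J" using 2 by auto
  have "poly q t = 0" if "t \<notin> {0}" for t
  proof -
    have "F (\<lambda>i. poly (p i) t) = 0"
    proof (rule chart)
      have "poly (p i) t = 0" if "i > s" for i
        using that xs J k0[of i] by (auto simp: p_def poly_monom affsp_def)
      moreover have "poly (p m) t \<noteq> 0" using k0[OF \<open>m \<notin> J\<close>] m by (simp add: p_def poly_monom)
      ultimately show "(\<lambda>i. poly (p i) t) \<in> PP s" by (auto simp: PP_def affsp_def fun_eq_iff)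
      show "poly (p (Suc j)) t = 1 / t * poly (p j) t" if "j \<in> J" for j
        using kS[OF that] \<open>t \<notin> {0}\<close> by (simp add: p_def poly_monom)
    qed
    then show ?thesis by (simp add: q)
  qed
  then have "q = 0" using poly_zero_if_vanishes[OF inf, of "{0}"] by blast
  moreover have "poly (p i) 0 = x i" for i
    using k0[of i] kS[of i] 2[of i] by (cases "i \<in> J") (auto simp: p_def poly_monom)
  ultimately show ?thesis using q[of 0] by simp
qed

text \<open>Two points with finite ratio are joined by a curve inside the scroll, so the vanishing
  of \<open>F * G\<close> can be tested in one variable. In effect the coordinate ring of a scroll
  is a domain.\<close>

lemma det_scroll_domain:
  fixes F G :: "(nat \<Rightarrow> 'k::field) \<Rightarrow> 'k"
  assumes inf: "infinite (UNIV :: 'k set)" and J: "J \<subseteq> {..<s}" and F: "curve_poly F" and G: "curve_poly G"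
    and FG: "\<And>x. x \<in> det_scroll s J \<Longrightarrow> F x * G x = 0"
  shows "(\<forall>x\<in>det_scroll s J. F x = 0) \<or> (\<forall>x\<in>det_scroll s J. G x = 0)"
proof (rule ccontr)
  assume "\<not> ?thesis"
  then have "\<not> (\<forall>x\<in>det_scroll s J. F x = 0)" "\<not> (\<forall>x\<in>det_scroll s J. G x = 0)" by auto
  then obtain x1 \<tau>1 x2 \<tau>2 where x1: "x1 \<in> PP s" "\<And>j. j \<in> J \<Longrightarrow> x1 (Suc j) = \<tau>1 * x1 j" "F x1 \<noteq> 0"
    and x2: "x2 \<in> PP s" "\<And>j. j \<in> J \<Longrightarrow> x2 (Suc j) = \<tau>2 * x2 j" "G x2 \<noteq> 0"
    using vanishes_on_det_scroll[OF inf J F] vanishes_on_det_scroll[OF inf J G] by metis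
  \<comment> \<open>Interpolates the two ratios and the first entries of the strings linearly; the
    other entries follow by multiplication with the ratio, so the curve stays in the scroll.\<close>
  define p where "p = rec_nat [:x1 0, x2 0 - x1 0:]
    (\<lambda>j q. if j \<in> J then [:\<tau>1, \<tau>2 - \<tau>1:] * q else [:x1 (Suc j), x2 (Suc j) - x1 (Suc j):])"
  have p0: "p 0 = [:x1 0, x2 0 - x1 0:]" by (simp add: p_def)
  have pS: "p (Suc j) = (if j \<in> J then [:\<tau>1, \<tau>2 - \<tau>1:] * p j else [:x1 (Suc j), x2 (Suc j) - x1 (Suc j):])" for j
    by (simp add: p_def)
  have px1: "poly (p i) 0 = x1 i" for i by (induction i) (auto simp: p0 pS x1(2) algebra_simps)
  have px2: "poly (p i) 1 = x2 i" for i by (induction i) (auto simp: p0 pS x2(2) algebra_simps)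
  obtain qf where qf: "\<And>t. F (\<lambda>i. poly (p i) t) = poly qf t" using F by (auto simp: curve_poly_def)
  obtain qg where qg: "\<And>t. G (\<lambda>i. poly (p i) t) = poly qg t" using G by (auto simp: curve_poly_def)
  obtain m where m: "x1 m \<noteq> 0" using x1(1) by (auto elim: PP_nonzeroE)
  have "poly (qf * qg * p m) t = 0" for t
  proof (cases "poly (p m) t = 0")
    case False
    have "poly (p i) t = 0" if gt: "i > s" for i
    proof -
      obtain j where j: "i = Suc j" using gt by (cases i) auto
      then have "j \<notin> J" using gt J by auto
      with j show ?thesis using gt x1(1) x2(1) by (simp add: pS PP_def affsp_def)
    qed
    then have "(\<lambda>i. poly (p i) t) \<in> PP s" using False by (auto simp: PP_def affsp_def fun_eq_iff)
    then have "(\<lambda>i. poly (p i) t) \<in> det_scroll s J"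
      by (rule det_scrollI[of _ _ _ "poly [:\<tau>1, \<tau>2 - \<tau>1:] t"]) (simp add: pS algebra_simps)
    then show ?thesis using FG[of "\<lambda>i. poly (p i) t"] by (simp add: qf qg)
  qed simp
  then have "qf * qg * p m = 0" using poly_zero_if_vanishes[OF inf, of "{}"] by blast
  moreover have "qf \<noteq> 0" using x1(3) qf[of 0] by (auto simp: px1)
  moreover have "qg \<noteq> 0" using x2(3) qg[of 1] by (auto simp: px2)
  moreover have "p m \<noteq> 0" using m px1[of m] by auto
  ultimately show False by simp
qed

lemma ones_in_det_scroll: "(\<lambda>i. if i \<le> s then 1 else 0) \<in> det_scroll s J" if "J \<subseteq> {..<s}"
  using that by (intro det_scrollI[where \<tau> = 1]) (auto simp: PP_def affsp_def fun_eq_iff)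

lemma irred_proj_image_det_scroll:
  fixes P :: "nat \<Rightarrow> nat \<Rightarrow> 'k::field"
  assumes inf: "infinite (UNIV :: 'k set)" and J: "J \<subseteq> {..<s}" and Z: "linmap s r P ` det_scroll s J \<subseteq> PP r"
  shows "irred_proj r (linmap s r P ` det_scroll s J)"
  unfolding irred_proj_def
proof (intro conjI allI impI)
  show "linmap s r P ` det_scroll s J \<noteq> {}" using ones_in_det_scroll[OF J] by blast
  fix Z1 Z2 assume "closed_proj r Z1" "closed_proj r Z2" and U: "linmap s r P ` det_scroll s J = Z1 \<union> Z2"
  then obtain F1 F2 where F: "Z1 = zero_set r F1" "Z2 = zero_set r F2" by (auto simp: closed_proj_def)
  show "linmap s r P ` det_scroll s J = Z1 \<or> linmap s r P ` det_scroll s J = Z2"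
  proof (rule ccontr)
    assume "\<not> ?thesis"
    then obtain x y where xy: "x \<in> det_scroll s J" "linmap s r P x \<notin> Z1" "y \<in> det_scroll s J" "linmap s r P y \<notin> Z2"
      using U by blast
    then obtain f g where fg: "f \<in> F1" "eval f (linmap s r P x) \<noteq> 0" "g \<in> F2" "eval g (linmap s r P y) \<noteq> 0"
      using F Z by (auto simp: zero_set_def)
    have "eval f (linmap s r P z) * eval g (linmap s r P z) = 0" if "z \<in> det_scroll s J" for z
    proof -
      have "linmap s r P z \<in> Z1 \<union> Z2" using U that by blast
      then show ?thesis using F fg by (auto simp: zero_set_def)
    qed
    then show False
      using det_scroll_domain[OF inf J curve_poly_eval_linmap[of f s r P] curve_poly_eval_linmap[of g s r P]] fg xy by blast
  qed
qed

section \<open>Dimension\<close>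

definition mpoly_subst :: "'k::comm_ring_1 mpoly \<Rightarrow> (nat \<Rightarrow> 'k mpoly) \<Rightarrow> 'k mpoly" where
  "mpoly_subst f G = (\<Sum>m\<in>Poly_Mapping.keys f. const (Poly_Mapping.lookup f m) *
     (\<Prod>i\<in>Poly_Mapping.keys m. G i ^ Poly_Mapping.lookup m i))"

lemma eval_mpoly_subst: "eval (mpoly_subst f G) y = eval f (\<lambda>i. eval (G i) y)"
  by (simp add: mpoly_subst_def eval_simps eval_def[of f])

lemma mpoly_subst_vpolys:
  assumes "f \<in> vpolys V" and G: "\<And>i. i \<in> V \<Longrightarrow> G i \<in> vpolys W"
  shows "mpoly_subst f G \<in> vpolys W"
proof -
  have "i \<in> V" if "m \<in> Poly_Mapping.keys f" "i \<in> Poly_Mapping.keys m" for m i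
    using assms(1) that by (auto simp: vpolys_def)
  then show ?thesis
    unfolding mpoly_subst_def by (intro vpolys_sum vpolys_mult vpolys_prod vpolys_power vpolys_const G)
qed

text \<open>Nontriviality is expressed by a nonempty \<open>K\<close> with nonzero coefficients
  only. The maximal size of an independent family plays the role of the dimension of the affine
  cone.\<close>

definition alg_dep :: "nat set \<Rightarrow> (nat \<Rightarrow> 'k::field mpoly) \<Rightarrow> (nat \<Rightarrow> 'k) set \<Rightarrow> bool" where
  "alg_dep A g T \<longleftrightarrow> (\<exists>K c. finite K \<and> K \<noteq> {} \<and> (\<forall>\<mu>\<in>K. c \<mu> \<noteq> 0 \<and> (\<forall>i. i \<notin> A \<longrightarrow> \<mu> i = 0)) \<and>
    (\<forall>x\<in>T. (\<Sum>\<mu>\<in>K. c \<mu> * (\<Prod>i\<in>A. eval (g i) x ^ \<mu> i)) = 0))"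

lemma alg_dep_subset: "alg_dep A g T \<Longrightarrow> S \<subseteq> T \<Longrightarrow> alg_dep A g S"
  unfolding alg_dep_def by blast

text \<open>The cone over the scroll is parametrized by the ratio of the rows and one coordinate for
  each index that is not the successor of a column, \<open>s + 2 - card J\<close> parameters in
  all.\<close>

lemma alg_dep_image_det_scroll:
  fixes P :: "nat \<Rightarrow> nat \<Rightarrow> 'k::field"
  assumes inf: "infinite (UNIV :: 'k set)" and J: "J \<subseteq> {..<s}" and A: "finite A" "card A + card J > s + 2"
    and g: "\<And>i. i \<in> A \<Longrightarrow> g i \<in> polys r"
  shows "alg_dep A g (linmap s r P ` det_scroll s J)"
proof -
  \<comment> \<open>The variable \<open>Suc s\<close> is the ratio; the others are the first entries
    of the strings.\<close>
  define V where "V = insert (Suc s) ({..s} - Suc ` J)"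
  have finJ: "finite J" using J finite_subset by blast
  have sub: "Suc ` J \<subseteq> {..s}" using J by auto
  have cJ: "card (Suc ` J) = card J" by (rule card_image) simp
  have "card V = Suc (card ({..s} - Suc ` J))" unfolding V_def by (rule card_insert_disjoint) auto
  also have "card ({..s} - Suc ` J) = Suc s - card J"
    using card_Diff_subset[OF finite_imageI[OF finJ] sub] cJ by simp
  finally have cV: "card V = Suc (Suc s - card J)" .
  moreover have "card J \<le> s" using card_mono[OF _ J] by simp
  moreover have finV: "finite V" by (simp add: V_def)
  ultimately have lt: "card V < card A" using A(2) by linarith
  define pm where "pm = rec_nat (var 0) (\<lambda>j q. if j \<in> J then var (Suc s) * q else (var (Suc j) :: 'k mpoly))"
  have pm0: "pm 0 = var 0" and pmS: "pm (Suc j) = (if j \<in> J then var (Suc s) * pm j else var (Suc j))" for j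
    by (simp_all add: pm_def)
  have pmV: "pm i \<in> vpolys V" if "i \<le> s" for i
    using that
  proof (induction i)
    case (Suc i)
    then show ?case by (auto simp: pmS V_def intro!: vpolys_mult)
  qed (auto simp: pm0 V_def)
  define G where "G i = mpoly_subst (g i) (\<lambda>k. \<Sum>j\<le>s. const (P k j) * pm j)" for i
  have GV: "G i \<in> vpolys V" if "i \<in> A" for i
    unfolding G_def using g[OF that] unfolding polys_eq_vpolys
    by (rule mpoly_subst_vpolys) (auto intro!: vpolys_sum vpolys_mult pmV)
  obtain K c where K: "finite K" "K \<noteq> {}" "\<forall>\<mu>\<in>K. c \<mu> \<noteq> 0 \<and> (\<forall>i. i \<notin> A \<longrightarrow> \<mu> i = 0)"
    "\<And>y. (\<Sum>\<mu>\<in>K. c \<mu> * (\<Prod>i\<in>A. eval (G i) y ^ \<mu> i)) = 0"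
    using algebraically_dependent[of V A G] A(1) lt GV finV by blast
  define F where "F x = (\<Sum>\<mu>\<in>K. c \<mu> * (\<Prod>i\<in>A. eval (g i) (linmap s r P x) ^ \<mu> i))" for x
  have "F x = 0" if "x \<in> det_scroll s J" for x
  \<comment> \<open>The parametrization reaches only points with finite ratio; the limit argument
    extends the relation to the rest.\<close>
  proof (rule vanishes_on_det_scroll[OF inf J _ _ that])
    show "curve_poly F" unfolding F_def
      by (intro curve_poly_sum curve_poly_mult curve_poly_prod curve_poly_power curve_poly_const curve_poly_eval_linmap)
    fix x :: "nat \<Rightarrow> 'k" and \<tau> assume x: "x \<in> PP s" "\<And>j. j \<in> J \<Longrightarrow> x (Suc j) = \<tau> * x j"
    define y where "y = x(Suc s := \<tau>)"
    have pmy: "eval (pm i) y = x i" if "i \<le> s" for i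
      using that
    proof (induction i)
      case (Suc i)
      then show ?case using x(2)[of i] by (auto simp: pmS y_def eval_mult)
    qed (auto simp: pm0 y_def)
    have "eval (G i) y = eval (g i) (linmap s r P x)" if "i \<in> A" for i
    proof -
      have "eval (G i) y = eval (g i) (\<lambda>k. \<Sum>j\<le>s. P k j * x j)"
        unfolding G_def eval_mpoly_subst by (simp add: eval_simps pmy)
      also have "\<dots> = eval (g i) (linmap s r P x)"
        unfolding eval_def using g[OF that]
        by (intro sum.cong arg_cong2[where f = "(*)"] prod.cong refl)
          (auto simp: polys_def linmap_def dest!: bspec subsetD)
      finally show ?thesis .
    qed
    then show "F x = 0" using K(4)[of y] by (simp add: F_def)
  qed
  then show ?thesis unfolding alg_dep_def using K(1-3)
    by (intro exI[of _ K] exI[of _ c]) (auto simp: F_def)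
qed

lemma closed_proj_scale:
  "closed_proj r C \<Longrightarrow> x \<in> C \<Longrightarrow> c \<noteq> (0 :: 'k::field) \<Longrightarrow> (\<lambda>i. c * x i) \<in> C"
  by (auto simp: closed_proj_def zero_set_def PP_def affsp_def fun_eq_iff homog_def eval_scale)

lemma closed_proj_PP: "closed_proj r C \<Longrightarrow> C \<subseteq> PP r"
  by (auto simp: closed_proj_def zero_set_def)

lemma eval_scale_poly:
  fixes x :: "nat \<Rightarrow> 'k::field"
  shows "eval f (\<lambda>i. t * x i) = poly (\<Sum>e\<in>mdeg ` Poly_Mapping.keys f. monom (eval (hcomp e f) x) e) t"
proof -
  have "eval f (\<lambda>i. t * x i) = eval (\<Sum>e\<in>mdeg ` Poly_Mapping.keys f. hcomp e f) (\<lambda>i. t * x i)"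
    by (simp add: sum_hcomp)
  also have "\<dots> = (\<Sum>e\<in>mdeg ` Poly_Mapping.keys f. t ^ e * eval (hcomp e f) x)"
    by (simp add: eval_sum eval_scale[OF homog_hcomp])
  finally show ?thesis by (simp add: poly_sum poly_monom mult.commute)
qed

text \<open>On the line through \<open>x\<close>, \<open>f\<close> becomes a polynomial in
  \<open>t\<close> whose coefficients are the values of its components; infinitely many zeros kill
  them all, the constant term included.\<close>

lemma hcomp_vanishes:
  fixes x :: "nat \<Rightarrow> 'k::field"
  assumes inf: "infinite (UNIV :: 'k set)" and f: "\<And>t. t \<noteq> 0 \<Longrightarrow> eval f (\<lambda>i. t * x i) = 0"
  shows "eval (hcomp e f) x = 0" "eval f (\<lambda>_. 0) = 0"
proof -
  let ?q = "\<Sum>e\<in>mdeg ` Poly_Mapping.keys f. monom (eval (hcomp e f) x) e"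
  have q: "?q = 0" using poly_zero_if_vanishes[OF inf, of "{0}"] f eval_scale_poly[of f _ x] by simp
  show "eval f (\<lambda>_. 0) = 0" using eval_scale_poly[of f 0 x] unfolding q by simp
  show "eval (hcomp e f) x = 0"
  proof (cases "e \<in> mdeg ` Poly_Mapping.keys f")
    case True
    have "poly.coeff ?q e = 0" by (simp only: q coeff_0)
    then show ?thesis using True by (simp add: coeff_sum if_distrib cong: if_cong)
  next
    case False
    then have "hcomp e f = 0" by (intro poly_mapping_eqI) (auto simp: lookup_hcomp in_keys_iff)
    then show ?thesis by simp
  qed
qed

lemma closed_proj_hcomp_vanishes:
  fixes C :: "(nat \<Rightarrow> 'k::field) set"
  assumes "infinite (UNIV :: 'k set)" "closed_proj r C" "\<And>x. x \<in> C \<Longrightarrow> eval f x = 0" "x \<in> C"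
  shows "eval (hcomp e f) x = 0"
  using hcomp_vanishes(1)[OF assms(1)] assms(3) closed_proj_scale[OF assms(2,4)] by blast

text \<open>After division by the highest possible power of \<open>h\<close>, a relation restricted
  to \<open>C\<close>, where \<open>h\<close> vanishes, would become a relation among the
  \<open>g i\<close>. The origin is allowed in \<open>C\<close> so that an induction can start with
  the apex of the cone.\<close>

lemma alg_dep_extend:
  fixes C' :: "(nat \<Rightarrow> 'k::field) set"
  assumes inf: "infinite (UNIV :: 'k set)" and C': "closed_proj r C'" "irred_proj r C'" and C: "C \<subseteq> insert (\<lambda>_. 0) C'"
    and h: "h \<in> polys r" "homog h" "\<And>x. x \<in> C \<Longrightarrow> eval h x = 0" "\<exists>x\<in>C'. eval h x \<noteq> 0"
    and A: "finite A" "a \<notin> A" and g: "\<And>i. i \<in> A \<Longrightarrow> g i \<in> polys r" and "\<not> alg_dep A g C"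
  shows "\<not> alg_dep (insert a A) (g(a := h)) C'"
proof
  assume "alg_dep (insert a A) (g(a := h)) C'"
  then obtain K c where Kc: "finite K" "K \<noteq> {}" "\<forall>\<mu>\<in>K. c \<mu> \<noteq> 0 \<and> (\<forall>i. i \<notin> insert a A \<longrightarrow> \<mu> i = 0)"
    "\<forall>x\<in>C'. (\<Sum>\<mu>\<in>K. c \<mu> * (\<Prod>i\<in>insert a A. eval ((g(a := h)) i) x ^ \<mu> i)) = 0"
    unfolding alg_dep_def by blast
  have K: "finite K" "K \<noteq> {}" "\<And>\<mu>. \<mu> \<in> K \<Longrightarrow> c \<mu> \<noteq> 0"
    "\<And>\<mu> i. \<mu> \<in> K \<Longrightarrow> i \<notin> insert a A \<Longrightarrow> \<mu> i = 0"
    "\<And>x. x \<in> C' \<Longrightarrow> (\<Sum>\<mu>\<in>K. c \<mu> * (\<Prod>i\<in>insert a A. eval ((g(a := h)) i) x ^ \<mu> i)) = 0"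
    using Kc by blast+
  \<comment> \<open>The lowest exponent of \<open>h\<close>; dividing by \<open>h ^ k\<close> leaves
    \<open>R\<close>, which has terms free of \<open>h\<close>.\<close>
  define k where "k = Min ((\<lambda>\<mu>. \<mu> a) ` K)"
  have k_le: "k \<le> \<mu> a" if "\<mu> \<in> K" for \<mu> using that K(1) by (auto simp: k_def)
  have "k \<in> (\<lambda>\<mu>. \<mu> a) ` K" unfolding k_def using K(1,2) by (intro Min_in) auto
  then obtain \<mu>0 where \<mu>0: "\<mu>0 \<in> K" "\<mu>0 a = k" by auto
  define R where "R = (\<Sum>\<mu>\<in>K. const (c \<mu>) * ((\<Prod>i\<in>A. g i ^ \<mu> i) * h ^ (\<mu> a - k)))"
  have Rp: "R \<in> polys r" unfolding R_def polys_eq_vpolys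
    using g h(1) by (intro vpolys_intros vpolys_const) (auto simp: polys_eq_vpolys)
  have hR: "eval h x ^ k * eval R x = 0" if "x \<in> C'" for x
  proof -
    have "(\<Sum>\<mu>\<in>K. c \<mu> * (\<Prod>i\<in>insert a A. eval ((g(a := h)) i) x ^ \<mu> i)) = eval h x ^ k * eval R x"
      unfolding R_def eval_sum sum_distrib_left
    proof (intro sum.cong refl)
      fix \<mu> assume "\<mu> \<in> K"
      then have "eval h x ^ \<mu> a = eval h x ^ k * eval h x ^ (\<mu> a - k)"
        using k_le by (simp add: power_add[symmetric])
      moreover have "(\<Prod>i\<in>A. eval ((g(a := h)) i) x ^ \<mu> i) = (\<Prod>i\<in>A. eval (g i) x ^ \<mu> i)"
        using A(2) by (intro prod.cong) auto
      ultimately show "c \<mu> * (\<Prod>i\<in>insert a A. eval ((g(a := h)) i) x ^ \<mu> i) =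
          eval h x ^ k * eval (const (c \<mu>) * ((\<Prod>i\<in>A. g i ^ \<mu> i) * h ^ (\<mu> a - k))) x"
        using A by (simp add: eval_simps algebra_simps)
    qed
    then show ?thesis using K(5)[OF that] by simp
  qed
  obtain d where d: "homog_of_deg d h" using h(2) by (auto simp: homog_def)
  obtain F where F: "F \<subseteq> polys r" "\<forall>f\<in>F. homog f" "C' = zero_set r F" using C'(1) by (auto simp: closed_proj_def)
  \<comment> \<open>\<open>C'\<close> is covered by the zeros of \<open>h\<close> and those of
    \<open>R\<close>. The former are a proper subset, so irreducibility cancels
    \<open>h ^ k\<close>. The components of \<open>R\<close> are used because closed sets need
    homogeneous equations.\<close>
  define Z1 where "Z1 = zero_set r (insert h F)"
  define Z2 where "Z2 = zero_set r (F \<union> range (\<lambda>e. hcomp e R))"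
  have "closed_proj r Z1" unfolding closed_proj_def Z1_def using F h by (intro exI[of _ "insert h F"]) auto
  moreover have "closed_proj r Z2" unfolding closed_proj_def Z2_def
    using F Rp by (intro exI[of _ "F \<union> range (\<lambda>e. hcomp e R)"]) (auto simp: homog_def polys_eq_vpolys intro: homog_hcomp)
  moreover have "C' = Z1 \<union> Z2"
  proof (intro equalityI subsetI)
    fix x assume x: "x \<in> C'"
    show "x \<in> Z1 \<union> Z2"
    proof (cases "eval h x = 0")
      case True
      then show ?thesis using x F by (auto simp: Z1_def zero_set_def)
    next
      case False
      have "eval R (\<lambda>i. t * x i) = 0" if "t \<noteq> 0" for t
        using hR[OF closed_proj_scale[OF C'(1) x that]] False that by (simp add: eval_scale[OF d])
      then have "eval (hcomp e R) x = 0" for e by (rule hcomp_vanishes(1)[OF inf])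
      then show ?thesis using x F by (auto simp: Z2_def zero_set_def)
    qed
  qed (auto simp: Z1_def Z2_def F zero_set_def)
  moreover have "C' \<noteq> Z1" using h(4) by (auto simp: Z1_def zero_set_def)
  ultimately have "C' = Z2" using C'(2) by (auto simp: irred_proj_def)
  then have R0: "eval R x = 0" if "x \<in> C'" for x
  proof -
    have "eval (\<Sum>e\<in>mdeg ` Poly_Mapping.keys R. hcomp e R) x = 0"
      using that \<open>C' = Z2\<close> by (auto simp: eval_sum Z2_def zero_set_def intro!: sum.neutral)
    then show ?thesis by (simp add: sum_hcomp)
  qed
  obtain x0 where x0: "x0 \<in> C'" using h(4) by blast
  have "eval R (\<lambda>_. 0) = 0"
    by (rule hcomp_vanishes(2)[OF inf, of R x0]) (use R0 closed_proj_scale[OF C'(1) x0] in blast)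
  then have RC: "eval R x = 0" if "x \<in> C" for x using that C R0 by auto
  \<comment> \<open>The terms that survive on \<open>C\<close>. Their common exponent
    \<open>k\<close> at \<open>a\<close> is erased to obtain exponents supported in
    \<open>A\<close>.\<close>
  define K0 where "K0 = {\<mu>\<in>K. \<mu> a = k}"
  define K1 where "K1 = (\<lambda>\<mu>. \<mu>(a := 0)) ` K0"
  have inj: "inj_on (\<lambda>\<mu>. \<mu>(a := 0)) K0"
    by (rule inj_on_inverseI[of _ "\<lambda>\<mu>. \<mu>(a := k)"]) (auto simp: K0_def)
  have "(\<Sum>\<mu>\<in>K1. c (\<mu>(a := k)) * (\<Prod>i\<in>A. eval (g i) x ^ \<mu> i)) = 0" if "x \<in> C" for x
  proof -
    have "(\<Sum>\<mu>\<in>K1. c (\<mu>(a := k)) * (\<Prod>i\<in>A. eval (g i) x ^ \<mu> i))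
        = (\<Sum>\<mu>\<in>K0. c \<mu> * (\<Prod>i\<in>A. eval (g i) x ^ \<mu> i))"
      unfolding K1_def sum.reindex[OF inj] o_def
      using A(2) by (intro sum.cong refl arg_cong2[where f = "(*)"] prod.cong) (auto simp: K0_def fun_upd_idem)
    also have "\<dots> = (\<Sum>\<mu>\<in>K. c \<mu> * ((\<Prod>i\<in>A. eval (g i) x ^ \<mu> i) * eval h x ^ (\<mu> a - k)))"
    proof (rule sum.mono_neutral_cong_left)
      show "\<forall>\<mu>\<in>K - K0. c \<mu> * ((\<Prod>i\<in>A. eval (g i) x ^ \<mu> i) * eval h x ^ (\<mu> a - k)) = 0"
      proof
        fix \<mu> assume "\<mu> \<in> K - K0"
        then have "\<mu> a - k \<noteq> 0" using k_le[of \<mu>] by (auto simp: K0_def)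
        then show "c \<mu> * ((\<Prod>i\<in>A. eval (g i) x ^ \<mu> i) * eval h x ^ (\<mu> a - k)) = 0"
          using h(3)[OF that] by (simp add: power_0_left)
      qed
    qed (use K(1) in \<open>auto simp: K0_def\<close>)
    also have "\<dots> = eval R x" by (simp add: R_def eval_simps)
    finally show ?thesis using RC[OF that] by simp
  qed
  moreover have "finite K1" "K1 \<noteq> {}" using K(1) \<mu>0 by (auto simp: K1_def K0_def)
  moreover have "c (\<mu>(a := k)) \<noteq> 0 \<and> (\<forall>i. i \<notin> A \<longrightarrow> \<mu> i = 0)" if "\<mu> \<in> K1" for \<mu>
    using that K(3,4) A(2) by (auto simp: K1_def K0_def fun_upd_idem)
  ultimately have "alg_dep A g C"
    unfolding alg_dep_def by (intro exI[of _ K1] exI[of _ "\<lambda>\<mu>. c (\<mu>(a := k))"]) auto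
  then show False using \<open>\<not> alg_dep A g C\<close> by contradiction
qed

lemma alg_indep_empty: "\<not> alg_dep {} g {\<lambda>_. 0 :: 'k::field}"
proof
  assume "alg_dep {} g {\<lambda>_. 0 :: 'k}"
  then obtain K c where K: "K \<noteq> {}" "\<forall>\<mu>\<in>K. c \<mu> \<noteq> (0 :: 'k) \<and> (\<forall>i::nat. \<mu> i = (0 :: nat))" "(\<Sum>\<mu>\<in>K. c \<mu>) = 0"
    by (auto simp: alg_dep_def)
  have "\<mu> = (\<lambda>_. 0)" if "\<mu> \<in> K" for \<mu> using K(2) that by (intro ext) auto
  then have "K = {\<lambda>_. 0}" using K(1) by auto
  then show False using K by auto
qed

text \<open>Each strict inclusion offers an equation of the smaller set that is nonzero somewhere on
  the larger one. The step from the apex of the cone to the first set accounts for one more element,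
  hence \<open>m + 1\<close> of them.\<close>

lemma chain_alg_indep:
  fixes C :: "nat \<Rightarrow> (nat \<Rightarrow> 'k::field) set"
  assumes inf: "infinite (UNIV :: 'k set)"
    and "\<And>i. i \<le> m \<Longrightarrow> closed_proj r (C i) \<and> irred_proj r (C i)" "\<And>i. i < m \<Longrightarrow> C i \<subset> C (Suc i)"
  shows "\<exists>g. (\<forall>i\<le>m. g i \<in> polys r) \<and> \<not> alg_dep {..m} g (C m)"
  using assms(2,3)
proof (induction m)
  case 0
  then have C0: "closed_proj r (C 0)" "irred_proj r (C 0)" by auto
  then obtain x where x: "x \<in> C 0" by (auto simp: irred_proj_def)
  then have "x \<in> PP r" using closed_proj_PP[OF C0(1)] by auto
  then obtain k where k: "x k \<noteq> 0" by (rule PP_nonzeroE)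
  then have kr: "k \<le> r" using \<open>x \<in> PP r\<close> by (metis (mono_tags, lifting) Diff_iff PP_def affsp_def mem_Collect_eq not_le)
  have "\<not> alg_dep {} (\<lambda>_. 0) {\<lambda>_. 0 :: 'k}" by (rule alg_indep_empty)
  then have *: "\<not> alg_dep {0} ((\<lambda>_. 0)(0 := var k)) (C 0)"
    using k kr x by (intro alg_dep_extend[OF inf C0, of "{\<lambda>_. 0}"])
      (auto simp: polys_eq_vpolys homog_def intro: homog_of_deg_var)
  define g :: "nat \<Rightarrow> 'k mpoly" where "g = (\<lambda>_. 0)(0 := var k)"
  have "\<not> alg_dep {..0} g (C 0)" unfolding atMost_0 g_def by (rule *)
  moreover have "\<forall>i\<le>0. g i \<in> polys r" using kr by (simp add: g_def polys_eq_vpolys)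
  ultimately show ?case by blast
next
  case (Suc m)
  obtain g where g: "\<forall>i\<le>m. g i \<in> polys r" "\<not> alg_dep {..m} g (C m)"
    using Suc.IH Suc.prems by (meson le_SucI less_SucI)
  have C': "closed_proj r (C (Suc m))" "irred_proj r (C (Suc m))" and "closed_proj r (C m)"
    using Suc.prems(1)[of "Suc m"] Suc.prems(1)[of m] by auto
  then obtain F where F: "F \<subseteq> polys r" "\<forall>f\<in>F. homog f" "C m = zero_set r F" by (auto simp: closed_proj_def)
  have sub: "C m \<subset> C (Suc m)" using Suc.prems(2) by simp
  then obtain x where "x \<in> C (Suc m)" "x \<notin> C m" by blast
  then obtain h where h: "h \<in> F" "eval h x \<noteq> 0" using F closed_proj_PP[OF C'(1)] by (auto simp: zero_set_def)
  have "\<not> alg_dep (insert (Suc m) {..m}) (g(Suc m := h)) (C (Suc m))"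
    using h F sub g \<open>x \<in> C (Suc m)\<close> by (intro alg_dep_extend[OF inf C', of "C m"]) (auto simp: zero_set_def)
  then have "\<not> alg_dep {..Suc m} (g(Suc m := h)) (C (Suc m))" unfolding atMost_Suc .
  moreover have "\<forall>i\<le>Suc m. (g(Suc m := h)) i \<in> polys r" using g(1) h(1) F(1) by (auto simp: le_Suc_eq)
  ultimately show ?case by blast
qed

text \<open>Provides chains for lower bounds of dimensions. In a basis of the whole space that
  extends one of \<open>V\<close>, the remaining coordinates are equations of \<open>V\<close>;
  lines through two points give irreducibility.\<close>

lemma closed_proj_irred_proj_subspace:
  fixes V :: "(nat \<Rightarrow> 'k::field) set"
  assumes inf: "infinite (UNIV :: 'k set)" and V: "fs.subspace V" "V \<subseteq> affsp r" "V \<noteq> {0}"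
  shows "closed_proj r (V - {0})" "irred_proj r (V - {0})"
proof -
  obtain B where B: "B \<subseteq> V" "fs.independent B" "fs.span B = V" "finite B"
    using fs.basis_of_subspace[OF V(1) subset_trans[OF V(2) affsp_subset_span] _ empty_subsetI fs.independent_empty]
    by auto
  obtain C where C: "B \<subseteq> C" "C \<subseteq> affsp r" "fs.independent C" "fs.span C = affsp r" "finite C"
    using fs.basis_of_subspace[OF subspace_affsp affsp_subset_span _ subset_trans[OF B(1) V(2)] B(2)] by auto
  have "C \<subseteq> fs.span (unit_vec ` {..r})" using C(2) affsp_subset_span by blast
  then have "card C \<le> card (unit_vec ` {..r} :: (nat \<Rightarrow> 'k) set)"
    using fs.independent_span_bound[OF _ C(3)] by auto
  then have cC: "card C \<le> Suc r" using card_unit_vecs[of r] by (rule order_trans)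
  have "fs.independent (unit_vec ` {..r} :: (nat \<Rightarrow> 'k) set) \<and> inj_on (unit_vec :: nat \<Rightarrow> nat \<Rightarrow> 'k) {..r}"
    using indep_unit_vec by (auto simp: fs.indep_fam_def)
  then have "Suc r \<le> card C"
    using fs.independent_span_bound[OF C(5), of "unit_vec ` {..r}"] C(4) unit_vec_affsp
    by (auto simp: card_image image_subset_iff)
  with cC have "card C = Suc r" by simp
  then obtain w where w: "bij_betw w {..r} C"
    using ex_bij_betw_nat_finite[OF C(5)] by (auto simp: atLeast0LessThan lessThan_Suc_atMost)
  have wC: "w i \<in> C" if "i \<le> r" for i using w that by (auto simp: bij_betw_def)
  have ind: "fs.indep_fam w {..r}" using w C(3) by (auto simp: fs.indep_fam_def bij_betw_def)
  define M where "M = (\<lambda>i j. w j i)"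
  have M: "linmap r r M x = (\<Sum>j\<le>r. fscale (x j) (w j))" for x
    unfolding M_def by (rule linmap_columns) (use wC C(2) in blast)
  have bij: "bij_betw (linmap r r M) (affsp r) (affsp r)"
  proof (rule linmap_bij)
    fix x :: "nat \<Rightarrow> 'k" assume x: "x \<in> affsp r" "linmap r r M x = 0"
    then have "x j = 0" if "j \<le> r" for j
      using fs.indep_famD[OF ind, of x j] that by (simp add: M)
    then show "x = 0" using x(1) by (auto simp: affsp_def fun_eq_iff not_le[symmetric])
  qed
  obtain N where N: "\<And>x. x \<in> affsp r \<Longrightarrow> linmap r r N (linmap r r M x) = x"
    "\<And>y. y \<in> affsp r \<Longrightarrow> linmap r r M (linmap r r N y) = y"
    using linmap_inverse[OF bij] by blast
  define l where "l i = (\<Sum>j\<le>r. const (N i j) * var j)" for i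
  have l: "eval (l i) y = linmap r r N y i" if "i \<le> r" for i y
    using that by (simp add: l_def eval_simps linmap_def)
  define F where "F = l ` {i\<in>{..r}. w i \<notin> B}"
  have "V - {0} = zero_set r F"
  proof (intro equalityI subsetI)
    fix y assume y: "y \<in> V - {0}"
    have "inv_into {..r} w b \<le> r" "w (inv_into {..r} w b) = b" if "b \<in> B" for b
    proof -
      have "b \<in> w ` {..r}" using w C(1) that by (auto simp: bij_betw_def)
      then show "inv_into {..r} w b \<le> r" "w (inv_into {..r} w b) = b"
        using inv_into_into[of b w "{..r}"] f_inv_into_f[of b w "{..r}"] by auto
    qed note inv = this
    have "linmap r r N y i = 0" if i: "i \<le> r" "w i \<notin> B" for i
    proof -
      have "y \<in> fs.span B" using y B(3) by simp
      then show ?thesis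
      proof (induction rule: fs.span_induct_alt)
        case base
        have "linmap r r N 0 i = 0 i" by (rule fun_cong[OF linmap_zero])
        also have "\<dots> = 0" by (rule zero_fun_apply)
        finally show ?case .
      next
        case (step c b y)
        define k where "k = inv_into {..r} w b"
        have k: "k \<le> r" "w k = b" using inv[OF step(1)] by (auto simp: k_def)
        then have "k \<noteq> i" using i step(1) by auto
        have "linmap r r M (unit_vec k) = b"
          unfolding M using k sum_unit_vec_fscale[of "{..r}" k w] by simp
        then have "linmap r r N b = unit_vec k" using N(1)[OF unit_vec_affsp[OF k(1)]] by simp
        then have "linmap r r N (fscale c b + y) i = c * unit_vec k i + linmap r r N y i"
          by (simp only: linmap_add linmap_scale plus_fun_apply fscale_apply)
        then show ?case using step \<open>k \<noteq> i\<close> by (simp only: unit_vec_def) simp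
      qed
    qed
    then show "y \<in> zero_set r F"
      using y V(2) by (auto simp: zero_set_def F_def l PP_iff)
  next
    fix y assume y: "y \<in> zero_set r F"
    then have ya: "y \<in> affsp r" "y \<noteq> 0" by (auto simp: zero_set_def PP_iff)
    have "y = linmap r r M (linmap r r N y)" using N(2)[OF ya(1)] by simp
    also have "\<dots> \<in> V"
      unfolding M
    proof (intro fs.subspace_sum[OF V(1)])
      fix j assume "j \<in> {..r}"
      show "fscale (linmap r r N y j) (w j) \<in> V"
      proof (cases "w j \<in> B")
        case True
        then show ?thesis using B(1) by (intro fs.subspace_scale[OF V(1)]) auto
      next
        case False
        then have "eval (l j) y = 0" using y \<open>j \<in> {..r}\<close> by (auto simp: zero_set_def F_def)
        then have "fscale (linmap r r N y j) (w j) = 0" using l[of j y] \<open>j \<in> {..r}\<close> by simp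
        then show ?thesis using fs.subspace_0[OF V(1)] by (simp only:)
      qed
    qed
    finally show "y \<in> V - {0}" using ya(2) by simp
  qed
  moreover have "l i \<in> polys r" "homog (l i)" if "i \<le> r" for i
  proof -
    show "l i \<in> polys r" unfolding l_def polys_eq_vpolys by (auto intro!: vpolys_sum vpolys_mult)
    have "homog_of_deg (0 + Suc 0) (l i)" unfolding l_def
      by (intro homog_of_deg_sum homog_of_deg_mult homog_of_deg_const homog_of_deg_var)
    then show "homog (l i)" by (auto simp: homog_def)
  qed
  ultimately show "closed_proj r (V - {0})"
    unfolding closed_proj_def by (intro exI[of _ F]) (auto simp: F_def)
  show "irred_proj r (V - {0})"
  proof (rule irred_proj_if_curves[OF inf])
    show "V - {0} \<noteq> {}" using V(3) fs.subspace_0[OF V(1)] by blast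
    show "V - {0} \<subseteq> PP r" using V(2) by (auto simp: PP_iff)
    fix x y assume xy: "x \<in> V - {0}" "y \<in> V - {0}"
    define p where "p i = [:x i, y i - x i:]" for i
    have "(\<lambda>i. poly (p i) t) = x + fscale t (y - x)" for t
      by (simp add: p_def fun_eq_iff)
    then have "(\<lambda>i. poly (p i) t) \<in> V" for t
      using xy fs.subspace_add[OF V(1)] fs.subspace_scale[OF V(1)] fs.subspace_diff[OF V(1)] by simp
    moreover have "x = (\<lambda>i. poly (p i) 0)" "y = (\<lambda>i. poly (p i) 1)" by (auto simp: p_def)
    ultimately show "\<exists>p. x = (\<lambda>i. poly (p i) 0) \<and> y = (\<lambda>i. poly (p i) 1) \<and>
      (\<forall>t. (\<lambda>i. poly (p i) t) \<noteq> 0 \<longrightarrow> (\<lambda>i. poly (p i) t) \<in> V - {0})" by blast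
  qed
qed

lemma dim_proj_eqI:
  assumes "Z \<noteq> {}" "\<And>i. i \<le> d \<Longrightarrow> closed_proj r (C i) \<and> irred_proj r (C i)" "\<And>i. i < d \<Longrightarrow> C i \<subset> C (Suc i)" "C d \<subseteq> Z"
    and "\<And>m C. (\<And>i. i \<le> m \<Longrightarrow> closed_proj r (C i) \<and> irred_proj r (C i)) \<Longrightarrow> (\<And>i. i < m \<Longrightarrow> C i \<subset> C (Suc i)) \<Longrightarrow>
      C m \<subseteq> Z \<Longrightarrow> m \<le> d"
  shows "dim_proj r Z = int d"
proof -
  let ?S = "{m. \<exists>C. (\<forall>i\<le>m. closed_proj r (C i) \<and> irred_proj r (C i)) \<and> (\<forall>i<m. C i \<subset> C (Suc i)) \<and> C m \<subseteq> Z}"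
  have "Sup ?S = d"
    by (rule cSup_eq_maximum) (use assms(2-5) in blast)+
  then show ?thesis using assms(1) by (simp add: dim_proj_def)
qed

text \<open>The lower bound is given by a flag of linear subspaces in the ruling \<open>x (Suc j) = 0\<close> for \<open>j \<in> J\<close>.\<close>
lemma dim_proj_image_det_scroll:
  fixes P :: "nat \<Rightarrow> nat \<Rightarrow> 'k::field" and r s :: nat
  defines "\<phi> \<equiv> linmap s r P"
  assumes inf: "infinite (UNIV :: 'k set)" and J: "J \<subseteq> {..<s}" "J \<noteq> {}"
    and Z: "closed_proj r (\<phi> ` det_scroll s J)"
    and inj: "\<And>x. x \<in> affsp s \<Longrightarrow> (\<And>j. j \<in> J \<Longrightarrow> x (Suc j) = 0) \<Longrightarrow> \<phi> x = 0 \<Longrightarrow> x = 0"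
    and neq: "\<phi> ` det_scroll s J \<noteq> \<phi> ` {x \<in> affsp s. x \<noteq> 0 \<and> (\<forall>j\<in>J. x (Suc j) = 0)}"
  shows "dim_proj r (\<phi> ` det_scroll s J) = int (s + 1) - int (card J)"
proof -
  define H where "H = {..s} - Suc ` J"
  define d where "d = card H"
  have sub: "Suc ` J \<subseteq> {..s}" using J by auto
  have finJ: "finite J" using J(1) finite_subset by blast
  have "card (Suc ` J) = card J" by (rule card_image) simp
  then have d: "d = Suc s - card J"
    using card_Diff_subset[OF finite_imageI[OF finJ] sub] by (simp add: d_def H_def)
  have cJ: "card J \<le> s" using card_mono[OF _ J(1)] by simp
  have d0: "d > 0" using d cJ by simp
  have finH: "finite H" by (simp add: H_def)
  obtain e where e: "bij_betw e {..<d} H"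
    using ex_bij_betw_nat_finite[OF finH] by (auto simp: atLeast0LessThan d_def)
  have eH: "e i \<in> H" if "i < d" for i using e that by (auto simp: bij_betw_def)
  define \<Lambda> where "\<Lambda> = {x \<in> affsp s. \<forall>j\<in>J. x (Suc j) = (0 :: 'k)}"
  have \<Lambda>_iff: "x \<in> \<Lambda> \<longleftrightarrow> (\<forall>i. i \<notin> H \<longrightarrow> x i = 0)" for x
    using sub by (auto simp: \<Lambda>_def H_def affsp_def)
  have s\<Lambda>: "fs.subspace \<Lambda>" by (auto simp: fs.subspace_def \<Lambda>_iff)
  define w where "w i = \<phi> (unit_vec (e i))" for i
  have unit\<Lambda>: "unit_vec (e i) \<in> \<Lambda>" if "i < d" for i using eH[OF that] by (auto simp: \<Lambda>_iff unit_vec_def)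
  have inj\<Lambda>: "x = 0" if "x \<in> \<Lambda>" "\<phi> x = 0" for x using inj that by (auto simp: \<Lambda>_def)
  have ind: "fs.indep_fam w {..<d}"
  proof (rule fs.indep_famI)
    fix c assume "(\<Sum>i<d. fscale (c i) (w i)) = 0"
    then have "\<phi> (\<Sum>i<d. fscale (c i) (unit_vec (e i))) = 0" by (simp only: w_def \<phi>_def linmap_sum)
    moreover have "(\<Sum>i<d. fscale (c i) (unit_vec (e i))) \<in> \<Lambda>"
      using unit\<Lambda> by (intro fs.subspace_sum[OF s\<Lambda>] fs.subspace_scale[OF s\<Lambda>]) auto
    ultimately have 0: "(\<Sum>i<d. fscale (c i) (unit_vec (e i))) = 0" using inj\<Lambda> by blast
    show "\<forall>k\<in>{..<d}. c k = 0"
    proof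
      fix k assume k: "k \<in> {..<d}"
      have "(\<Sum>i<d. c i * unit_vec (e i) (e k)) = 0" using fun_cong[OF 0, of "e k"] by simp
      moreover have "c i * unit_vec (e i) (e k) = (if i = k then c k else 0)" if "i \<in> {..<d}" for i
        using e k that by (auto simp: unit_vec_def bij_betw_def inj_on_def)
      ultimately show "c k = 0" using k by simp
    qed
  qed simp
  have span\<Lambda>: "\<phi> x \<in> fs.span (w ` {..<d})" if "x \<in> \<Lambda>" for x
  proof -
    have x: "x = (\<Sum>i<d. fscale (x (e i)) (unit_vec (e i)))"
    proof
      fix j
      have "(\<Sum>i<d. fscale (x (e i)) (unit_vec (e i))) j = (\<Sum>i<d. x (e i) * unit_vec (e i) j)" by simp
      also have "\<dots> = (\<Sum>h\<in>H. x h * unit_vec h j)"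
        by (rule sum.reindex_bij_betw[OF e, of "\<lambda>h. x h * unit_vec h j"])
      also have "\<dots> = x j" using that finH by (simp add: sum_unit_vec \<Lambda>_iff)
      finally show "x j = (\<Sum>i<d. fscale (x (e i)) (unit_vec (e i))) j" by simp
    qed
    have "\<phi> x = (\<Sum>i<d. fscale (x (e i)) (w i))"
      by (subst x) (simp only: \<phi>_def w_def linmap_sum)
    then show ?thesis by (auto intro: fs.sum_in_span)
  qed
  define V where "V k = fs.span (w ` {..k})" for k
  have waff: "w i \<in> affsp r" for i by (simp add: w_def \<phi>_def)
  have Vaff: "V k \<subseteq> affsp r" for k
    unfolding V_def using waff by (intro fs.span_minimal subspace_affsp) auto
  have w_notin: "w k \<notin> fs.span (w ` {..<k})" if "k < d" for k
  proof
    assume *: "w k \<in> fs.span (w ` {..<k})"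
    have "w ` {..<k} \<subseteq> w ` {..<d} - {w k}"
      using ind that by (auto simp: fs.indep_fam_def inj_on_def)
    then have "w k \<in> fs.span (w ` {..<d} - {w k})" using * fs.span_mono by blast
    then show False using ind that by (auto simp: fs.indep_fam_def fs.dependent_def)
  qed
  have V0: "V k \<noteq> {0}" if "k < d" for k
  proof -
    have "w k \<in> V k" unfolding V_def by (rule fs.span_base) simp
    moreover have "w k \<noteq> 0" using w_notin[OF that] fs.span_zero by metis
    ultimately show ?thesis by blast
  qed
  have Vsub: "V k - {0} \<subset> V (Suc k) - {0}" if "Suc k < d" for k
  proof -
    have "V k \<subseteq> V (Suc k)" unfolding V_def by (intro fs.span_mono) auto
    moreover have "w (Suc k) \<in> V (Suc k)" unfolding V_def by (intro fs.span_base) auto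
    moreover have "w (Suc k) \<notin> V k" using w_notin[OF that] by (simp add: V_def lessThan_Suc_atMost)
    moreover have "0 \<in> V k" unfolding V_def by (rule fs.span_zero)
    ultimately show ?thesis by (metis Diff_iff psubsetI Diff_mono order_refl singletonD)
  qed
  have last: "V (d - 1) = \<phi> ` \<Lambda>"
  proof
    show "\<phi> ` \<Lambda> \<subseteq> V (d - 1)"
      using span\<Lambda> d0 by (auto simp: V_def lessThan_Suc_atMost[symmetric])
    have "fs.subspace (\<phi> ` \<Lambda>)"
      unfolding \<phi>_def by (rule module_hom.subspace_image[OF Vector_Spaces.linear.axioms(3)[OF linear_linmap] s\<Lambda>])
    then show "V (d - 1) \<subseteq> \<phi> ` \<Lambda>"
      unfolding V_def using unit\<Lambda> d0 by (intro fs.span_minimal) (auto simp: w_def)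
  qed
  have img: "\<phi> ` \<Lambda> - {0} = \<phi> ` {x \<in> affsp s. x \<noteq> 0 \<and> (\<forall>j\<in>J. x (Suc j) = 0)}"
  proof -
    have eq: "{x \<in> affsp s. x \<noteq> 0 \<and> (\<forall>j\<in>J. x (Suc j) = 0)} = \<Lambda> - {0}" by (auto simp: \<Lambda>_def)
    have iff: "\<phi> x \<noteq> 0 \<longleftrightarrow> x \<noteq> 0" if "x \<in> \<Lambda>" for x
      using inj\<Lambda>[OF that] linmap_zero[of s r P] unfolding \<phi>_def by metis
    show ?thesis
    proof (intro equalityI subsetI)
      fix y assume "y \<in> \<phi> ` \<Lambda> - {0}"
      then obtain x where "x \<in> \<Lambda>" "y = \<phi> x" "\<phi> x \<noteq> 0" by blast
      then show "y \<in> \<phi> ` {x \<in> affsp s. x \<noteq> 0 \<and> (\<forall>j\<in>J. x (Suc j) = 0)}" unfolding eq using iff by blast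
    next
      fix y assume "y \<in> \<phi> ` {x \<in> affsp s. x \<noteq> 0 \<and> (\<forall>j\<in>J. x (Suc j) = 0)}"
      then obtain x where "x \<in> \<Lambda>" "y = \<phi> x" "x \<noteq> 0" unfolding eq by blast
      moreover from this have "\<phi> x \<noteq> 0" using iff[of x] by simp
      ultimately have "y \<in> \<phi> ` \<Lambda>" "y \<noteq> 0" by (simp_all only: imageI not_False_eq_True)
      then show "y \<in> \<phi> ` \<Lambda> - {0}" by (simp only: Diff_iff singleton_iff not_False_eq_True simp_thms)
    qed
  qed
  have sub_scroll: "{x \<in> affsp s. x \<noteq> 0 \<and> (\<forall>j\<in>J. x (Suc j) = 0)} \<subseteq> det_scroll s J"
    by (auto simp: det_scroll_def PP_iff)
  have lastZ: "V (d - 1) - {0} \<subset> \<phi> ` det_scroll s J"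
    unfolding last img using image_mono[OF sub_scroll, of \<phi>] neq by (simp only: psubset_eq) (metis (no_types, lifting))
  have irrZ: "irred_proj r (\<phi> ` det_scroll s J)"
    unfolding \<phi>_def using closed_proj_PP[OF Z] by (intro irred_proj_image_det_scroll[OF inf J(1)]) (simp add: \<phi>_def)
  \<comment> \<open>A flag of \<open>d\<close> linear spaces, topped by the scroll itself, hence
    \<open>d\<close> steps; \<open>neq\<close> makes the last inclusion strict.\<close>
  define C where "C i = (if i < d then V i - {0} else \<phi> ` det_scroll s J)" for i
  have "dim_proj r (\<phi> ` det_scroll s J) = int d"
  proof (rule dim_proj_eqI)
    show "\<phi> ` det_scroll s J \<noteq> {}" using irrZ by (auto simp: irred_proj_def)
    show "closed_proj r (C i) \<and> irred_proj r (C i)" if "i \<le> d" for i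
      using that closed_proj_irred_proj_subspace[OF inf fs.subspace_span Vaff[unfolded V_def] V0[unfolded V_def]] Z irrZ
      by (simp add: C_def V_def)
    show "C i \<subset> C (Suc i)" if "i < d" for i
    proof (cases "Suc i < d")
      case False
      then have "i = d - 1" "Suc i = d" using that by auto
      then show ?thesis using lastZ by (simp add: C_def)
    qed (use that Vsub[of i] in \<open>simp add: C_def\<close>)
    show "C d \<subseteq> \<phi> ` det_scroll s J" by (simp add: C_def)
  next
    fix m and D :: "nat \<Rightarrow> (nat \<Rightarrow> 'k) set"
    assume D: "\<And>i. i \<le> m \<Longrightarrow> closed_proj r (D i) \<and> irred_proj r (D i)" "\<And>i. i < m \<Longrightarrow> D i \<subset> D (Suc i)"
      "D m \<subseteq> \<phi> ` det_scroll s J"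
    obtain g where g: "\<forall>i\<le>m. g i \<in> polys r" "\<not> alg_dep {..m} g (D m)"
      using chain_alg_indep[OF inf, of m r D] D(1,2) by blast
    show "m \<le> d"
    proof (rule ccontr)
      assume "\<not> m \<le> d"
      then have "card {..m} + card J > s + 2" using d cJ by simp
      then have "alg_dep {..m} g (\<phi> ` det_scroll s J)"
        unfolding \<phi>_def using g(1) by (intro alg_dep_image_det_scroll[OF inf J(1)]) auto
      then show False using g(2) D(3) alg_dep_subset by blast
    qed
  qed
  then show ?thesis using d cJ by simp
qed

section \<open>Polynomials in a homogeneous regular sequence\<close>

definition graded_ideal :: "nat \<Rightarrow> 'k::comm_ring_1 mpoly set \<Rightarrow> bool" where
  "graded_ideal r a \<longleftrightarrow> a \<subseteq> polys r \<and> 0 \<in> a \<and> (\<forall>x\<in>a. \<forall>y\<in>a. x + y \<in> a)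
     \<and> (\<forall>s\<in>polys r. \<forall>x\<in>a. s * x \<in> a) \<and> (\<forall>e. \<forall>x\<in>a. hcomp e x \<in> a)"

definition add_gen :: "nat \<Rightarrow> 'k::comm_ring_1 mpoly set \<Rightarrow> 'k mpoly \<Rightarrow> 'k mpoly set" where
  "add_gen r a f = {x + f * h | x h. x \<in> a \<and> h \<in> polys r}"

lemma add_genI: "x \<in> a \<Longrightarrow> h \<in> polys r \<Longrightarrow> g = x + f * h \<Longrightarrow> g \<in> add_gen r a f"
  by (auto simp: add_gen_def)

lemma graded_ideal_uminus: "graded_ideal r a \<Longrightarrow> x \<in> a \<Longrightarrow> - x \<in> a"
  unfolding graded_ideal_def polys_eq_vpolys
  by (metis mult_minus1 vpolys_one vpolys_uminus)

lemma graded_ideal_diff: "graded_ideal r a \<Longrightarrow> x \<in> a \<Longrightarrow> y \<in> a \<Longrightarrow> x - y \<in> a"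
  using graded_ideal_uminus[of r a y] unfolding graded_ideal_def
  by (metis add_uminus_conv_diff)

lemma graded_ideal_mult: "graded_ideal r a \<Longrightarrow> s \<in> polys r \<Longrightarrow> x \<in> a \<Longrightarrow> s * x \<in> a"
  by (simp add: graded_ideal_def)

lemma graded_ideal_add: "graded_ideal r a \<Longrightarrow> x \<in> a \<Longrightarrow> y \<in> a \<Longrightarrow> x + y \<in> a"
  by (simp add: graded_ideal_def)

lemma graded_ideal_zero: "graded_ideal r a \<Longrightarrow> 0 \<in> a"
  by (simp add: graded_ideal_def)

lemma graded_ideal_sum:
  "graded_ideal r a \<Longrightarrow> (\<And>i. i \<in> A \<Longrightarrow> x i \<in> a) \<Longrightarrow> (\<Sum>i\<in>A. x i) \<in> a"
  by (induction A rule: infinite_finite_induct) (auto simp: graded_ideal_def)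

lemma subset_add_gen: "a \<subseteq> add_gen r a f"
  by (auto simp: polys_eq_vpolys intro: add_genI[where h = 0])

lemma graded_ideal_add_gen:
  fixes f :: "'k::comm_ring_1 mpoly"
  assumes a: "graded_ideal r a" and f: "f \<in> polys r" and hf: "homog_of_deg d f"
  shows "graded_ideal r (add_gen r a f)"
  unfolding graded_ideal_def
proof (intro conjI ballI allI)
  show "add_gen r a f \<subseteq> polys r"
    using a f by (auto simp: add_gen_def graded_ideal_def polys_eq_vpolys intro!: vpolys_intros)
  show "0 \<in> add_gen r a f"
    using subset_add_gen a by (auto simp: graded_ideal_def)
next
  fix x y assume "x \<in> add_gen r a f" "y \<in> add_gen r a f"
  then obtain x1 h1 x2 h2 where "x1 \<in> a" "x2 \<in> a" "h1 \<in> polys r" "h2 \<in> polys r"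
    "x = x1 + f * h1" "y = x2 + f * h2" by (auto simp: add_gen_def)
  then show "x + y \<in> add_gen r a f"
    using a by (intro add_genI[of "x1 + x2" _ "h1 + h2"])
      (auto simp: graded_ideal_def algebra_simps polys_eq_vpolys)
next
  fix s x :: "'k mpoly" assume s: "s \<in> polys r" and "x \<in> add_gen r a f"
  then obtain x1 h1 where "x1 \<in> a" "h1 \<in> polys r" "x = x1 + f * h1" by (auto simp: add_gen_def)
  then show "s * x \<in> add_gen r a f"
    using a s by (intro add_genI[of "s * x1" _ "s * h1"])
      (auto simp: graded_ideal_def algebra_simps polys_eq_vpolys)
next
  fix e x assume "x \<in> add_gen r a f"
  then obtain x1 h1 where *: "x1 \<in> a" "h1 \<in> polys r" "x = x1 + f * h1" by (auto simp: add_gen_def)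
  then show "hcomp e x \<in> add_gen r a f"
    using a hcomp_mult_homog[OF hf, of e h1]
    by (intro add_genI[of "hcomp e x1" _ "if d \<le> e then hcomp (e - d) h1 else 0"])
      (auto simp: graded_ideal_def hcomp_add polys_eq_vpolys)
qed

text \<open>The degree argument that replaces Krull's intersection theorem.\<close>
lemma graded_ideal_separated:
  assumes a: "graded_ideal r a" and hf: "homog_of_deg d f" "d \<ge> 1"
    and g: "\<And>m. g \<in> add_gen r a (f ^ m)"
  shows "g \<in> a"
proof -
  have "hcomp e g \<in> a" for e
  proof -
    obtain x h where x: "x \<in> a" "g = x + f ^ Suc e * h"
      using g[of "Suc e"] by (auto simp: add_gen_def)
    have h: "homog_of_deg (Suc e * d) (f ^ Suc e)" by (intro homog_of_deg_power hf)
    have "\<not> Suc e * d \<le> e" using hf(2)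
      by (metis One_nat_def Suc_n_not_le_n le_trans mult.right_neutral mult_le_mono2)
    then have "hcomp e g = hcomp e x"
      using hcomp_mult_homog[OF h, of e h] by (simp only: x hcomp_add) simp
    then show ?thesis using a x by (simp add: graded_ideal_def)
  qed
  then show ?thesis
    using graded_ideal_sum[OF a, of "mdeg ` Poly_Mapping.keys g" "\<lambda>e. hcomp e g"] by (simp add: sum_hcomp)
qed

lemma ideal_plus_0: "ideal_plus r I f 0 = I"
  by (auto simp: ideal_plus_def polys_eq_vpolys)

lemma ideal_plus_Suc: "ideal_plus r I f (Suc i) = add_gen r (ideal_plus r I f i) (f i)"
proof (intro equalityI subsetI)
  fix x assume "x \<in> ideal_plus r I f (Suc i)"
  then obtain g a where "g \<in> I" "\<forall>j<Suc i. a j \<in> polys r" "x = g + (\<Sum>j<Suc i. a j * f j)"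
    by (auto simp: ideal_plus_def)
  then show "x \<in> add_gen r (ideal_plus r I f i) (f i)"
    by (intro add_genI[of "g + (\<Sum>j<i. a j * f j)" _ "a i"])
      (auto simp: ideal_plus_def algebra_simps intro!: exI[of _ g] exI[of _ a])
next
  fix x assume "x \<in> add_gen r (ideal_plus r I f i) (f i)"
  then obtain g a h where *: "g \<in> I" "\<forall>j<i. a j \<in> polys r" "h \<in> polys r"
    "x = g + (\<Sum>j<i. a j * f j) + f i * h" by (auto simp: ideal_plus_def add_gen_def)
  have "x = g + (\<Sum>j<Suc i. (a(i := h)) j * f j)" using *(4) by (simp add: algebra_simps)
  then show "x \<in> ideal_plus r I f (Suc i)"
    using * unfolding ideal_plus_def by (auto simp: less_Suc_eq intro!: exI[of _ g] exI[of _ "a(i := h)"])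
qed

text \<open>\<open>reg_poly r f V n i Q\<close>: \<open>Q\<close> is a nonzero polynomial in the members of \<open>f i, \<dots>, f (i + n - 1)\<close>
  whose index lies in \<open>V\<close>. Only its lowest coefficient with respect to \<open>f i\<close> has to be a polynomial
  in the later members; the remaining coefficients are irrelevant modulo \<open>f i\<close>.\<close>
primrec reg_poly :: "nat \<Rightarrow> (nat \<Rightarrow> 'k::comm_ring_1 mpoly) \<Rightarrow> nat set \<Rightarrow> nat \<Rightarrow> nat \<Rightarrow> 'k mpoly \<Rightarrow> bool" where
  "reg_poly r f V 0 i Q \<longleftrightarrow> (\<exists>c. c \<noteq> 0 \<and> Q = const c)"
| "reg_poly r f V (Suc n) i Q \<longleftrightarrow> homog Q \<and> (\<exists>k p q. reg_poly r f V n (Suc i) p \<and> q \<in> polys r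
      \<and> Q = f i ^ k * (p + f i * q) \<and> (i \<notin> V \<longrightarrow> Q = p))"

lemma reg_poly_homog: "reg_poly r f V n i Q \<Longrightarrow> homog Q"
  by (cases n) (auto simp: homog_def intro: homog_of_deg_const)

lemma reg_poly_mono: "reg_poly r f V n i Q \<Longrightarrow> V \<subseteq> V' \<Longrightarrow> reg_poly r f V' n i Q"
  by (induction n arbitrary: i Q) (simp; blast)+

lemma reg_poly_polys:
  "reg_poly r f V n i Q \<Longrightarrow> (\<And>j. j \<in> {i..<i + n} \<Longrightarrow> f j \<in> polys r) \<Longrightarrow> Q \<in> polys r"
proof (induction n arbitrary: i Q)
  case (Suc n)
  then obtain k p q where *: "reg_poly r f V n (Suc i) p" "q \<in> polys r" "Q = f i ^ k * (p + f i * q)"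
    by auto
  have "p \<in> polys r" using Suc.IH[OF *(1)] Suc.prems(2) by simp
  moreover have "f i \<in> polys r" using Suc.prems(2) by simp
  ultimately show ?case using *(2,3) by (auto simp: polys_eq_vpolys intro!: vpolys_intros)
qed (auto simp: polys_eq_vpolys)

section \<open>Cancellation and divisibility for polynomials in a regular sequence\<close>

locale homog_regular_seq =
  fixes r :: nat and I :: "'k::field mpoly set" and f :: "nat \<Rightarrow> 'k mpoly" and t :: nat
  assumes graded_I: "graded_ideal r I" and regular: "regular_seq r I f t"
begin

abbreviation J :: "nat \<Rightarrow> 'k mpoly set" where "J \<equiv> ideal_plus r I f"

lemma f_polys: "i < t \<Longrightarrow> f i \<in> polys r"
  using regular by (simp add: regular_seq_def)

lemma f_homog: "i < t \<Longrightarrow> \<exists>d\<ge>1. homog_of_deg d (f i)"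
  using regular by (simp add: regular_seq_def)

lemma graded_J: "i \<le> t \<Longrightarrow> graded_ideal r (J i)"
proof (induction i)
  case (Suc i)
  then obtain d where "homog_of_deg d (f i)" using f_homog[of i] by auto
  then show ?case using Suc f_polys[of i] by (auto simp: ideal_plus_Suc intro: graded_ideal_add_gen)
qed (simp add: ideal_plus_0 graded_I)

lemma cancel: "i < t \<Longrightarrow> f i * g \<in> J i \<Longrightarrow> g \<in> polys r \<Longrightarrow> g \<in> J i"
  using regular by (simp add: regular_seq_def)

lemma cancel_power: "i < t \<Longrightarrow> f i ^ k * g \<in> J i \<Longrightarrow> g \<in> polys r \<Longrightarrow> g \<in> J i"
proof (induction k)
  case (Suc k)
  have "f i * (f i ^ k * g) \<in> J i" using Suc.prems by (simp add: mult.assoc)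
  then have "f i ^ k * g \<in> J i"
    using Suc.prems f_polys[of i] by - (rule cancel, auto simp: polys_eq_vpolys intro!: vpolys_intros)
  then show ?case using Suc by simp
qed simp

lemma reg_poly_in_polys: "reg_poly r f V n i Q \<Longrightarrow> i + n \<le> t \<Longrightarrow> Q \<in> polys r"
  by (rule reg_poly_polys) (auto intro: f_polys)

text \<open>Powers of \<open>f i\<close> cancel by regularity, and modulo \<open>f i\<close> the
  remaining factor is \<open>p\<close>, which cancels by induction. Repetition puts \<open>g\<close>
  into \<open>J i\<close> up to arbitrarily high powers of \<open>f i\<close>.\<close>

lemma reg_poly_cancel:
  "reg_poly r f V n i Q \<Longrightarrow> i + n \<le> t \<Longrightarrow> Q * g \<in> J i \<Longrightarrow> g \<in> polys r \<Longrightarrow> g \<in> J i"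
proof (induction n arbitrary: i Q g)
  case 0
  then obtain c where c: "c \<noteq> 0" "Q = const c" by auto
  have "const (1 / c) * (Q * g) \<in> J i"
    using 0 graded_ideal_mult[OF graded_J[of i], of "const (1 / c)"] by (auto simp: polys_eq_vpolys)
  moreover have "const (1 / c) * (Q * g) = g"
    using c by (simp add: const_def mult.assoc[symmetric] mult_single)
  ultimately show ?case by simp
next
  case (Suc n)
  note IH = Suc.IH and S = \<open>g \<in> polys r\<close> and le = \<open>i + Suc n \<le> t\<close>
  obtain k p q where *: "reg_poly r f V n (Suc i) p" "q \<in> polys r" "Q = f i ^ k * (p + f i * q)"
    using Suc.prems(1) by auto
  have it: "i < t" and fi: "f i \<in> polys r" and p: "p \<in> polys r"
    using Suc.prems f_polys reg_poly_in_polys[OF *(1)] by auto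
  note gi = graded_J[OF less_imp_le[OF it]]
  have pq: "p + f i * q \<in> polys r" using p fi *(2) by (auto simp: polys_eq_vpolys intro!: vpolys_intros)
  have "(p + f i * q) * g \<in> J i"
    using Suc.prems(3) pq S it by - (rule cancel_power[of i k], auto simp: *(3) mult.assoc polys_eq_vpolys)
  \<comment> \<open>Successive approximation: the cofactor \<open>g'\<close> of
    \<open>f i ^ m\<close> satisfies the same hypothesis as \<open>g\<close>, hence is itself a
    multiple of \<open>f i\<close> modulo \<open>J i\<close>.\<close>
  moreover have "g \<in> add_gen r (J i) (f i ^ m)" for m
  proof (induction m)
    case 0
    then show ?case using graded_ideal_zero[OF gi] S by (auto intro!: add_genI[where x = 0])
  next
    case (Suc m)
    then obtain x g' where g': "x \<in> J i" "g' \<in> polys r" "g = x + f i ^ m * g'" by (auto simp: add_gen_def)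
    have "f i ^ m * ((p + f i * q) * g') = (p + f i * q) * g - (p + f i * q) * x"
      by (simp add: g' algebra_simps)
    also have "\<dots> \<in> J i"
      by (rule graded_ideal_diff[OF gi \<open>(p + f i * q) * g \<in> J i\<close> graded_ideal_mult[OF gi pq g'(1)]])
    finally have "(p + f i * q) * g' \<in> J i"
      using it pq g' by - (rule cancel_power, auto simp: polys_eq_vpolys)
    then have "p * g' \<in> J (Suc i)"
      unfolding ideal_plus_Suc using *(2) g'
      by (intro add_genI[of "(p + f i * q) * g'" _ "- q * g'"]) (auto simp: polys_eq_vpolys algebra_simps intro!: vpolys_intros)
    then have "g' \<in> J (Suc i)" using le g' by - (rule IH[OF *(1)], auto)
    then obtain y h where y: "y \<in> J i" "h \<in> polys r" "g' = y + f i * h"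
      by (auto simp: ideal_plus_Suc add_gen_def)
    have "f i ^ m \<in> polys r" using fi by (auto simp: polys_eq_vpolys)
    then have "x + f i ^ m * y \<in> J i" using g' y by (intro graded_ideal_add[OF gi] graded_ideal_mult[OF gi])
    then show ?case using y by (intro add_genI[of "x + f i ^ m * y" _ h]) (auto simp: g'(3) algebra_simps)
  qed
  ultimately show ?case using f_homog[OF it] graded_ideal_separated[OF gi] by blast
qed

text \<open>Replaces unique factorization: the \<open>Q j\<close> have no common factor, since no variable occurs in all
  of them.\<close>
lemma reg_poly_dvd:
  assumes "i + n \<le> t" "reg_poly r f UNIV n i P"
    and "\<And>j. j \<in> {i..<i + n} \<Longrightarrow> reg_poly r f (- {j}) n i (Q j)"
    and "\<And>j. j \<in> {i..<i + n} \<Longrightarrow> Q j * g \<in> add_gen r (J i) P"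
    and "g \<in> polys r"
  shows "g \<in> add_gen r (J i) P"
  using assms
proof (induction n arbitrary: i P Q g)
  case 0
  then obtain c where c: "c \<noteq> 0" "P = const c" by auto
  have "g = 0 + P * (const (1 / c) * g)" using c by (simp add: const_def mult.assoc[symmetric] mult_single)
  then show ?case using graded_ideal_zero[OF graded_J[of i]] 0
    by (intro add_genI[of 0 _ "const (1/c) * g"]) (auto simp: polys_eq_vpolys)
next
  case (Suc n)
  have it: "i < t" and sit: "Suc i \<le> t" and sn: "Suc i + n \<le> t" using Suc.prems(1) by auto
  note fi = f_polys[OF it]
  note gi = graded_J[OF less_imp_le[OF it]]
  note gsi = graded_J[OF sit]
  \<comment> \<open>\<open>Q i\<close> does not involve \<open>f i\<close>, so it is also a
    polynomial in the later members and can be cancelled modulo \<open>J (Suc i)\<close>.\<close>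
  define Q0 where "Q0 = Q i"
  have Q0: "reg_poly r f (- {i}) (Suc n) i Q0" using Suc.prems(3)[of i] by (simp add: Q0_def)
  then have Q0s: "reg_poly r f (- {i}) n (Suc i) Q0" by auto
  then have Q0U: "reg_poly r f UNIV n (Suc i) Q0" by (rule reg_poly_mono) simp
  have Q0p: "Q0 \<in> polys r" using reg_poly_in_polys[OF Q0] Suc.prems(1) by simp
  obtain e0 where "homog_of_deg e0 Q0" using reg_poly_homog[OF Q0] by (auto simp: homog_def)
  then have gQ: "graded_ideal r (add_gen r (J i) Q0)" using gi Q0p by (intro graded_ideal_add_gen)
  \<comment> \<open>Permutation of the regular sequence \<open>f i\<close>, \<open>Q0\<close> modulo
    \<open>J i\<close>: then \<open>f i\<close> can also be cancelled modulo
    \<open>Q0\<close>.\<close>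
  have cancel_f: "h \<in> add_gen r (J i) Q0" if h: "f i * h \<in> add_gen r (J i) Q0" "h \<in> polys r" for h
  proof -
    obtain x y where x: "x \<in> J i" "y \<in> polys r" "f i * h = x + Q0 * y" using h by (auto simp: add_gen_def)
    have "Q0 * y \<in> J (Suc i)" unfolding ideal_plus_Suc
      using x h graded_ideal_uminus[OF gi] by (intro add_genI[of "- x" _ h]) (auto simp: algebra_simps)
    then have "y \<in> J (Suc i)" using x by - (rule reg_poly_cancel[OF Q0U sn], auto)
    then obtain x' y' where y': "x' \<in> J i" "y' \<in> polys r" "y = x' + f i * y'"
      by (auto simp: ideal_plus_Suc add_gen_def)
    have "f i * (h - Q0 * y') = x + Q0 * x'" using x y' by (simp add: algebra_simps)
    also have "\<dots> \<in> J i" using x y' Q0p by (intro graded_ideal_add[OF gi] graded_ideal_mult[OF gi])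
    finally have "h - Q0 * y' \<in> J i"
      using h y' Q0p it by - (rule cancel, auto simp: polys_eq_vpolys intro!: vpolys_intros)
    then show ?thesis using y' by (intro add_genI[of "h - Q0 * y'" _ y']) auto
  qed
  have cancel_fk: "h \<in> add_gen r (J i) Q0" if h: "f i ^ k * h \<in> add_gen r (J i) Q0" "h \<in> polys r" for h k
    using h
  proof (induction k)
    case (Suc k)
    have "f i ^ k * h \<in> add_gen r (J i) Q0"
      using Suc.prems fi by - (rule cancel_f, auto simp: mult.assoc polys_eq_vpolys intro!: vpolys_intros)
    then show ?case using Suc by blast
  qed simp
  \<comment> \<open>It suffices that \<open>Q0\<close> divides \<open>b\<close> modulo
    \<open>J i\<close>: then \<open>Q0\<close> can be cancelled from
    \<open>Q0 * g = x + P * b\<close>.\<close>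
  obtain x b where b: "x \<in> J i" "b \<in> polys r" "Q0 * g = x + P * b"
    using Suc.prems(4)[of i] by (auto simp: Q0_def add_gen_def)
  have Qp: "Q j \<in> polys r" if "j \<in> {i..<i + Suc n}" for j
    using reg_poly_in_polys[OF Suc.prems(3)[OF that]] Suc.prems(1) by simp
  have Pp: "P \<in> polys r" using reg_poly_in_polys[OF Suc.prems(2)] Suc.prems(1) by simp
  \<comment> \<open>The divisibility hypothesis for the remaining indices, with \<open>Q0\<close> in
    place of \<open>P\<close>. It holds for \<open>b\<close> after cancelling \<open>P\<close>, and
    it is inherited by cofactors of \<open>f i\<close>.\<close>
  define good where "good b' \<longleftrightarrow> b' \<in> polys r \<and> (\<forall>j\<in>{Suc i..<Suc i + n}. Q j * b' \<in> add_gen r (J i) Q0)" for b'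
  have good_b: "good b"
    unfolding good_def
  proof (intro conjI ballI)
    fix j assume j: "j \<in> {Suc i..<Suc i + n}"
    then obtain xj bj where bj: "xj \<in> J i" "bj \<in> polys r" "Q j * g = xj + P * bj"
      using Suc.prems(4)[of j] by (auto simp: add_gen_def)
    have "P * (Q j * b - Q0 * bj) = Q0 * xj - Q j * x"
    proof -
      have "P * (Q j * b - Q0 * bj) = Q j * (P * b) - Q0 * (P * bj)" by (simp add: algebra_simps)
      also have "P * b = Q0 * g - x" using b by simp
      also have "P * bj = Q j * g - xj" using bj by simp
      finally show ?thesis by (simp add: algebra_simps)
    qed
    also have "\<dots> \<in> J i" using bj b Q0p Qp[of j] j
      by (intro graded_ideal_diff[OF gi] graded_ideal_mult[OF gi]) auto
    finally have "Q j * b - Q0 * bj \<in> J i"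
      using Qp[of j] j b bj Q0p
      by - (rule reg_poly_cancel[OF Suc.prems(2) Suc.prems(1)], auto simp: polys_eq_vpolys intro!: vpolys_intros)
    then show "Q j * b \<in> add_gen r (J i) Q0" using bj by (intro add_genI[of "Q j * b - Q0 * bj" _ bj]) auto
  qed (rule b)
  \<comment> \<open>Modulo \<open>f i\<close> the lowest coefficients of the \<open>Q j\<close>
    satisfy the hypotheses for one member less. By induction \<open>b'\<close> is a multiple of
    \<open>Q0\<close> up to a multiple of \<open>f i\<close>.\<close>
  have step: "\<exists>y b''. y \<in> add_gen r (J i) Q0 \<and> good b'' \<and> b' = y + f i * b''" if "good b'" for b'
  proof -
    have b': "b' \<in> polys r" using that by (simp add: good_def)
    have "\<exists>q. reg_poly r f (- {j}) n (Suc i) q \<and> q * b' \<in> add_gen r (J (Suc i)) Q0"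
      if j: "j \<in> {Suc i..<Suc i + n}" for j
    proof -
      obtain k q s where q: "reg_poly r f (- {j}) n (Suc i) q" "s \<in> polys r" "Q j = f i ^ k * (q + f i * s)"
        using Suc.prems(3)[of j] j by auto
      have qp: "q \<in> polys r" using reg_poly_in_polys[OF q(1) sn] .
      have "f i ^ k * ((q + f i * s) * b') \<in> add_gen r (J i) Q0"
        using bspec[OF conjunct2[OF \<open>good b'\<close>[unfolded good_def]] j] by (simp add: q(3) mult.assoc)
      then have "(q + f i * s) * b' \<in> add_gen r (J i) Q0"
        using qp q(2) fi b' by - (rule cancel_fk, auto simp: polys_eq_vpolys intro!: vpolys_intros)
      then obtain x y where x: "x \<in> J i" "y \<in> polys r" "(q + f i * s) * b' = x + Q0 * y" by (auto simp: add_gen_def)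
      have "x - f i * (s * b') \<in> J (Suc i)" unfolding ideal_plus_Suc
        using x q(2) b' by (intro add_genI[of x _ "- (s * b')"]) (auto simp: polys_eq_vpolys intro!: vpolys_intros)
      moreover have "q * b' = (x - f i * (s * b')) + Q0 * y" using x(3) by (simp add: algebra_simps)
      ultimately show ?thesis using q(1) x(2) by (auto intro: add_genI)
    qed
    then obtain q where q: "\<And>j. j \<in> {Suc i..<Suc i + n} \<Longrightarrow> reg_poly r f (- {j}) n (Suc i) (q j)"
      "\<And>j. j \<in> {Suc i..<Suc i + n} \<Longrightarrow> q j * b' \<in> add_gen r (J (Suc i)) Q0" by metis
    have "b' \<in> add_gen r (J (Suc i)) Q0" using Suc.IH[OF sn Q0U q b'] by simp
    then obtain x h b'' where x: "x \<in> J i" "h \<in> polys r" "b'' \<in> polys r" "b' = x + f i * b'' + Q0 * h"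
      by (auto simp: add_gen_def ideal_plus_Suc)
    have y: "x + Q0 * h \<in> add_gen r (J i) Q0" using x by (auto intro: add_genI)
    have "Q j * b'' \<in> add_gen r (J i) Q0" if j: "j \<in> {Suc i..<Suc i + n}" for j
    proof (rule cancel_f)
      have "f i * (Q j * b'') = Q j * b' - Q j * (x + Q0 * h)" by (simp add: x algebra_simps)
      also have "\<dots> \<in> add_gen r (J i) Q0"
        using bspec[OF conjunct2[OF \<open>good b'\<close>[unfolded good_def]] j] graded_ideal_mult[OF gQ Qp[of j] y] j
        by (intro graded_ideal_diff[OF gQ]) auto
      finally show "f i * (Q j * b'') \<in> add_gen r (J i) Q0" .
    qed (use Qp[of j] j x in \<open>auto simp: polys_eq_vpolys\<close>)
    then have "good b''" using x by (auto simp: good_def)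
    moreover have "b' = (x + Q0 * h) + f i * b''" using x by (simp add: algebra_simps)
    ultimately show ?thesis using y by blast
  qed
  have "\<exists>y b''. y \<in> add_gen r (J i) Q0 \<and> good b'' \<and> b = y + f i ^ m * b''" for m
  proof (induction m)
    case 0
    then show ?case using good_b graded_ideal_zero[OF gQ] by (intro exI[of _ 0] exI[of _ b]) auto
  next
    case (Suc m)
    then obtain y b' where 1: "y \<in> add_gen r (J i) Q0" "good b'" "b = y + f i ^ m * b'" by blast
    obtain y' b'' where 2: "y' \<in> add_gen r (J i) Q0" "good b''" "b' = y' + f i * b''" using step[OF 1(2)] by blast
    have "y + f i ^ m * y' \<in> add_gen r (J i) Q0"
      using 1 2 fi by (intro graded_ideal_add[OF gQ] graded_ideal_mult[OF gQ]) (auto simp: polys_eq_vpolys)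
    moreover have "b = (y + f i ^ m * y') + f i ^ Suc m * b''" by (simp add: 1(3) 2(3) algebra_simps)
    ultimately show ?case using 2(2) by blast
  qed
  then have "b \<in> add_gen r (add_gen r (J i) Q0) (f i ^ m)" for m
    unfolding add_gen_def[of _ "add_gen r (J i) Q0"] good_def by blast
  then have "b \<in> add_gen r (J i) Q0" using f_homog[OF it] graded_ideal_separated[OF gQ] by blast
  then obtain y c where c: "y \<in> J i" "c \<in> polys r" "b = y + Q0 * c" by (auto simp: add_gen_def)
  have "Q0 * (g - P * c) = x + P * y" using b c by (simp add: algebra_simps)
  also have "\<dots> \<in> J i" using b c Pp by (intro graded_ideal_add[OF gi] graded_ideal_mult[OF gi])
  finally have "g - P * c \<in> J i"
    using c Pp Suc.prems(5) by - (rule reg_poly_cancel[OF Q0 Suc.prems(1)], auto simp: polys_eq_vpolys intro!: vpolys_intros)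
  then show ?case using c by (intro add_genI[of "g - P * c" _ c]) auto
qed

end

lemma homog_regular_seq_prefix:
  assumes "homog_regular_seq r I f t" "t' \<le> t"
  shows "homog_regular_seq r I f t'"
proof -
  interpret homog_regular_seq r I f t by fact
  have "J t' \<subseteq> J t" using \<open>t' \<le> t\<close>
    by (induction rule: dec_induct) (auto simp: ideal_plus_Suc intro: subsetD[OF subset_add_gen])
  then show ?thesis using regular graded_I \<open>t' \<le> t\<close>
    unfolding homog_regular_seq_def regular_seq_def by auto
qed

text \<open>The terms with the lowest exponent of \<open>f i\<close> provide \<open>p\<close>; all
  others contain one more power of \<open>f i\<close>. The common weight \<open>e\<close> keeps the
  sum homogeneous, as \<open>reg_poly\<close> demands at every level.\<close>

lemma reg_poly_sum:
  fixes c :: "(nat \<Rightarrow> nat) \<Rightarrow> 'k::comm_ring_1" and f :: "nat \<Rightarrow> 'k mpoly"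
  assumes "finite K" "K \<noteq> {}" "\<And>\<mu>. \<mu> \<in> K \<Longrightarrow> c \<mu> \<noteq> 0"
    and "\<And>\<mu> j. \<mu> \<in> K \<Longrightarrow> j \<notin> {i..<i + n} \<inter> V \<Longrightarrow> \<mu> j = 0"
    and "\<And>\<mu>. \<mu> \<in> K \<Longrightarrow> (\<Sum>j\<in>{i..<i + n}. \<mu> j * d j) = e"
    and "\<And>j. j \<in> {i..<i + n} \<Longrightarrow> homog_of_deg (d j) (f j)"
    and "\<And>j. j \<in> {i..<i + n} \<Longrightarrow> f j \<in> polys r"
  shows "reg_poly r f V n i (\<Sum>\<mu>\<in>K. const (c \<mu>) * (\<Prod>j\<in>{i..<i + n}. f j ^ \<mu> j))"
  using assms
proof (induction n arbitrary: i K c e)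
  case 0
  then have "\<mu> = (\<lambda>_. 0)" if "\<mu> \<in> K" for \<mu> using that by (intro ext) auto
  then have "K = {\<lambda>_. 0}" using 0(2) by auto
  then show ?case using 0(3) by auto
next
  case (Suc n)
  let ?Q = "\<Sum>\<mu>\<in>K. const (c \<mu>) * (\<Prod>j\<in>{i..<i + Suc n}. f j ^ \<mu> j)"
  have ins: "{i..<i + Suc n} = insert i {Suc i..<Suc i + n}" by auto
  have fi: "f i \<in> polys r" using Suc.prems(7) by simp
  define k where "k = Min ((\<lambda>\<mu>. \<mu> i) ` K)"
  have k_le: "k \<le> \<mu> i" if "\<mu> \<in> K" for \<mu> using that Suc.prems(1) by (auto simp: k_def)
  have "k \<in> (\<lambda>\<mu>. \<mu> i) ` K" unfolding k_def using Suc.prems(1,2) by (intro Min_in) auto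
  then obtain \<mu>0 where \<mu>0: "\<mu>0 \<in> K" "\<mu>0 i = k" by auto
  define K0 where "K0 = {\<mu>\<in>K. \<mu> i = k}"
  define K1 where "K1 = (\<lambda>\<mu>. \<mu>(i := 0)) ` K0"
  have inj: "inj_on (\<lambda>\<mu>. \<mu>(i := 0)) K0"
    by (rule inj_on_inverseI[of _ "\<lambda>\<mu>. \<mu>(i := k)"]) (auto simp: K0_def)
  \<comment> \<open>Once the exponent at \<open>i\<close> is erased, the old coefficient is found by
    putting \<open>k\<close> back, the only exponent that occurs in \<open>K0\<close>.\<close>
  define c' where "c' \<mu> = c (\<mu>(i := k))" for \<mu>
  define p where "p = (\<Sum>\<mu>\<in>K1. const (c' \<mu>) * (\<Prod>j\<in>{Suc i..<Suc i + n}. f j ^ \<mu> j))"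
  define q where "q = (\<Sum>\<mu>\<in>K - K0. const (c \<mu>) * (f i ^ (\<mu> i - Suc k) * (\<Prod>j\<in>{Suc i..<Suc i + n}. f j ^ \<mu> j)))"
  have p_eq: "p = (\<Sum>\<mu>\<in>K0. const (c \<mu>) * (\<Prod>j\<in>{Suc i..<Suc i + n}. f j ^ \<mu> j))"
    unfolding p_def K1_def sum.reindex[OF inj] o_def
    by (intro sum.cong refl arg_cong2[where f = "(*)"] prod.cong) (auto simp: c'_def K0_def fun_upd_idem)
  have p: "reg_poly r f V n (Suc i) p"
    unfolding p_def
  proof (rule Suc.IH)
    show "finite K1" "K1 \<noteq> {}" using Suc.prems(1) \<mu>0 by (auto simp: K1_def K0_def)
    show "c' \<mu> \<noteq> 0" if "\<mu> \<in> K1" for \<mu>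
      using that Suc.prems(3) by (auto simp: K1_def K0_def c'_def fun_upd_idem)
    show "\<mu> j = 0" if mu: "\<mu> \<in> K1" "j \<notin> {Suc i..<Suc i + n} \<inter> V" for \<mu> j
    proof -
      obtain \<nu> where \<nu>: "\<nu> \<in> K" "\<mu> = \<nu>(i := 0)" using mu by (auto simp: K1_def K0_def)
      then show ?thesis using Suc.prems(4)[OF \<nu>(1), of j] mu(2) by (cases "j = i") auto
    qed
    show "(\<Sum>j\<in>{Suc i..<Suc i + n}. \<mu> j * d j) = e - k * d i" if mu: "\<mu> \<in> K1" for \<mu>
    proof -
      obtain \<nu> where \<nu>: "\<nu> \<in> K" "\<nu> i = k" "\<mu> = \<nu>(i := 0)" using mu by (auto simp: K1_def K0_def)
      have "(\<Sum>j\<in>{Suc i..<Suc i + n}. \<mu> j * d j) = (\<Sum>j\<in>{Suc i..<Suc i + n}. \<nu> j * d j)"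
        by (intro sum.cong) (auto simp: \<nu>)
      then show ?thesis using Suc.prems(5)[OF \<nu>(1)] \<nu>(2) unfolding ins by simp
    qed
  qed (use Suc.prems in auto)
  have q: "q \<in> polys r"
    unfolding q_def polys_eq_vpolys using Suc.prems(7)
    by (intro vpolys_intros vpolys_const) (auto simp: polys_eq_vpolys)
  have "?Q = (\<Sum>\<mu>\<in>K0. const (c \<mu>) * (\<Prod>j\<in>{i..<i + Suc n}. f j ^ \<mu> j))
      + (\<Sum>\<mu>\<in>K - K0. const (c \<mu>) * (\<Prod>j\<in>{i..<i + Suc n}. f j ^ \<mu> j))"
    using Suc.prems(1) by (subst sum.subset_diff[of K0 K]) (auto simp: K0_def)
  also have "(\<Sum>\<mu>\<in>K0. const (c \<mu>) * (\<Prod>j\<in>{i..<i + Suc n}. f j ^ \<mu> j)) = f i ^ k * p"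
    unfolding p_eq ins sum_distrib_left by (intro sum.cong) (auto simp: K0_def algebra_simps)
  also have "(\<Sum>\<mu>\<in>K - K0. const (c \<mu>) * (\<Prod>j\<in>{i..<i + Suc n}. f j ^ \<mu> j)) = f i ^ k * (f i * q)"
    unfolding q_def ins sum_distrib_left
  proof (intro sum.cong refl)
    fix \<mu> assume mu: "\<mu> \<in> K - K0"
    then have "\<mu> i = k + Suc (\<mu> i - Suc k)" using k_le[of \<mu>] by (auto simp: K0_def)
    then have "f i ^ \<mu> i = f i ^ k * (f i * f i ^ (\<mu> i - Suc k))"
      by (metis power_add power_Suc)
    then show "const (c \<mu>) * (\<Prod>j\<in>insert i {Suc i..<Suc i + n}. f j ^ \<mu> j) =
      f i ^ k * (f i * (const (c \<mu>) * (f i ^ (\<mu> i - Suc k) * (\<Prod>j\<in>{Suc i..<Suc i + n}. f j ^ \<mu> j))))"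
      by (simp add: algebra_simps)
  qed
  finally have Q: "?Q = f i ^ k * (p + f i * q)" by (simp add: algebra_simps)
  have "homog_of_deg e ?Q"
  proof (rule homog_of_deg_sum)
    fix \<mu> assume "\<mu> \<in> K"
    have "homog_of_deg (0 + (\<Sum>j\<in>{i..<i + Suc n}. \<mu> j * d j)) (const (c \<mu>) * (\<Prod>j\<in>{i..<i + Suc n}. f j ^ \<mu> j))"
      using Suc.prems(6) by (intro homog_of_deg_mult homog_of_deg_prod homog_of_deg_power) auto
    then show "homog_of_deg e (const (c \<mu>) * (\<Prod>j\<in>{i..<i + Suc n}. f j ^ \<mu> j))"
      using Suc.prems(5)[OF \<open>\<mu> \<in> K\<close>] by simp
  qed
  moreover have "?Q = p" if "i \<notin> V"
  proof -
    have z: "\<mu> i = 0" if "\<mu> \<in> K" for \<mu> using Suc.prems(4)[OF that, of i] \<open>i \<notin> V\<close> by auto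
    then have "k = 0" using \<mu>0 by auto
    then have "K0 = K" using z by (auto simp: K0_def)
    then have "q = 0" by (simp add: q_def)
    then show ?thesis using Q \<open>k = 0\<close> by simp
  qed
  ultimately show ?case using p q Q by (auto simp: homog_def simp del: sum.op_ivl_Suc prod.op_ivl_Suc)
qed

section \<open>Column sets of scrolls\<close>

lemma scroll_cols_lessThan: "scroll_cols n l a \<subseteq> {..<n}"
  by (auto simp: scroll_cols_def)

lemma scroll_data_gap:
  assumes "scroll_data_ok s n l a" "i < j" "j \<le> l"
  shows "a i + 2 \<le> a j"
proof -
  have st: "a k + 2 \<le> a (Suc k)" if "k < l" for k
    using assms(1) that by (auto simp: scroll_data_ok_def dest!: bspec[of _ _ "Suc k"])
  show ?thesis using assms(2,3)
  proof (induction j)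
    case (Suc j)
    then show ?case using st[of j] by (cases "i = j") auto
  qed simp
qed

lemma scroll_data_bounds:
  assumes "scroll_data_ok s n l a" "1 \<le> i" "i \<le> l"
  shows "1 \<le> a i" "a i \<le> int n"
  using scroll_data_gap[OF assms(1), of 0 i] scroll_data_gap[OF assms(1), of i l] assms
  by (auto simp: scroll_data_ok_def le_less)

text \<open>Every block has at least two entries, so the last index of a block is the successor of a
  column. The entries of the matrix are thus exactly the first \<open>n + 1\<close> variables, and
  \<open>n\<close> determines the vertex.\<close>

lemma scroll_cols_Un_Suc:
  assumes ok: "scroll_data_ok s n l a"
  shows "scroll_cols n l a \<union> Suc ` scroll_cols n l a = {..n}"
proof (intro equalityI subsetI)
  fix i assume "i \<in> {..n}"
  show "i \<in> scroll_cols n l a \<union> Suc ` scroll_cols n l a"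
  proof (cases "i \<in> scroll_cols n l a")
    case False
    have l: "1 \<le> l" "a l = int n" using ok by (auto simp: scroll_data_ok_def)
    obtain k where k: "1 \<le> k" "k \<le> l" "int i = a k"
      using False \<open>i \<in> {..n}\<close> l by (cases "i = n") (auto simp: scroll_cols_def)
    then have "i \<ge> 1" using scroll_data_bounds[OF ok, of k] by simp
    moreover have "int (i - 1) \<noteq> a j" if "j \<in> {1..<l}" for j
      using scroll_data_gap[OF ok, of k j] scroll_data_gap[OF ok, of j k] that k \<open>i \<ge> 1\<close>
      by (cases j k rule: linorder_cases) auto
    ultimately have "i - 1 \<in> scroll_cols n l a"
      using \<open>i \<in> {..n}\<close> by (auto simp: scroll_cols_def)
    then show ?thesis using \<open>i \<ge> 1\<close> by (metis Suc_diff_1 UnI2 imageI less_le_trans zero_less_one)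
  qed simp
qed (auto simp: scroll_cols_def)

text \<open>Strings of lengths \<open>b i + 1\<close> are laid out consecutively; the string \<open>i\<close> starts at \<open>string_start b i\<close>.\<close>
definition string_start :: "(nat \<Rightarrow> nat) \<Rightarrow> nat \<Rightarrow> nat" where
  "string_start b i = (\<Sum>k<i. Suc (b k))"

lemma string_start_Suc: "string_start b (Suc i) = string_start b i + Suc (b i)"
  by (simp add: string_start_def)

lemma string_start_mono: "i \<le> j \<Longrightarrow> string_start b i \<le> string_start b j"
  by (induction j rule: dec_induct) (auto simp: string_start_Suc)

lemma string_start_bij:
  "bij_betw (\<lambda>(i, j). string_start b i + j) (SIGMA i:{..<L}. {..b i}) {..<string_start b L}"
proof -
  have *: "string_start b i + j < string_start b i'" if "i < i'" "j \<le> b i" for i i' j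
    using string_start_mono[of "Suc i" i' b] that by (simp add: string_start_Suc)
  have "inj_on (\<lambda>(i, j). string_start b i + j) (SIGMA i:{..<L}. {..b i})"
  proof (rule inj_onI)
    fix p p' assume a: "p \<in> (SIGMA i:{..<L}. {..b i})" "p' \<in> (SIGMA i:{..<L}. {..b i})"
      "(case p of (i, j) \<Rightarrow> string_start b i + j) = (case p' of (i, j) \<Rightarrow> string_start b i + j)"
    obtain i j i' j' where p: "p = (i, j)" "p' = (i', j')" by (cases p, cases p')
    have "i = i'" using a *[of i i' j] *[of i' i j'] p by (cases i i' rule: linorder_cases) auto
    then show "p = p'" using a p by simp
  qed
  moreover have "(\<lambda>(i, j). string_start b i + j) ` (SIGMA i:{..<L}. {..b i}) = {..<string_start b L}"
  proof (intro equalityI subsetI)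
    fix p assume "p \<in> {..<string_start b L}"
    then have "\<exists>i j. i < L \<and> j \<le> b i \<and> p = string_start b i + j"
    proof (induction L)
      case 0
      then show ?case by (simp add: string_start_def)
    next
      case (Suc L)
      show ?case
      proof (cases "p < string_start b L")
        case True
        then show ?thesis using Suc.IH less_SucI by blast
      next
        case False
        then show ?thesis using Suc.prems
          by (intro exI[of _ L] exI[of _ "p - string_start b L"]) (auto simp: string_start_Suc)
      qed
    qed
    then show "p \<in> (\<lambda>(i, j). string_start b i + j) ` (SIGMA i:{..<L}. {..b i})" by force
  qed (use * in auto)
  ultimately show ?thesis by (simp add: bij_betw_def)
qed

text \<open>The index before the start of string \<open>i\<close> ends the preceding block; for
  \<open>i = 0\<close> it is -1, as the data require, which is why the subtraction is done in the
  integers.\<close>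

lemma scroll_data_string_start:
  assumes "1 \<le> l" "\<And>i. i < l \<Longrightarrow> 0 < b i" "string_start b l \<le> Suc r"
  shows "scroll_data_ok r (string_start b l - 1) l (\<lambda>i. int (string_start b i) - 1)"
    and "scroll_cols (string_start b l - 1) l (\<lambda>i. int (string_start b i) - 1) =
      (\<lambda>(i, j). string_start b i + j) ` (SIGMA i:{..<l}. {..<b i})"
proof -
  obtain l' where l': "l = Suc l'" using assms(1) by (cases l) auto
  have ge: "2 \<le> string_start b l" using assms(2)[of l'] by (simp add: l' string_start_Suc)
  have "int (string_start b i) - 1 - (int (string_start b (i - 1)) - 1) > 1" if i: "i \<in> {1..l}" for i
  proof -
    obtain k where k: "i = Suc k" using i by (cases i) auto
    then show ?thesis using assms(2)[of k] i by (simp add: string_start_Suc)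
  qed
  then show "scroll_data_ok r (string_start b l - 1) l (\<lambda>i. int (string_start b i) - 1)"
    using assms(1,3) ge by (auto simp: scroll_data_ok_def string_start_def[of _ 0] of_nat_diff)
  show "scroll_cols (string_start b l - 1) l (\<lambda>i. int (string_start b i) - 1) =
      (\<lambda>(i, j). string_start b i + j) ` (SIGMA i:{..<l}. {..<b i})"
  proof (intro equalityI subsetI)
    fix p assume p: "p \<in> scroll_cols (string_start b l - 1) l (\<lambda>i. int (string_start b i) - 1)"
    then have "p \<in> {..<string_start b l}" by (auto simp: scroll_cols_def)
    then have "p \<in> (\<lambda>(i, j). string_start b i + j) ` (SIGMA i:{..<l}. {..b i})"
      using string_start_bij[of b l] by (simp add: bij_betw_def)
    then obtain i j where ij: "i < l" "j \<le> b i" "p = string_start b i + j" by auto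
    have "j \<noteq> b i"
    proof
      assume "j = b i"
      then have "int p = int (string_start b (Suc i)) - 1" using ij by (simp add: string_start_Suc)
      moreover have "Suc i < l \<or> Suc i = l" using ij by auto
      ultimately show False using p by (auto simp: scroll_cols_def)
    qed
    then show "p \<in> (\<lambda>(i, j). string_start b i + j) ` (SIGMA i:{..<l}. {..<b i})" using ij by force
  next
    fix p assume "p \<in> (\<lambda>(i, j). string_start b i + j) ` (SIGMA i:{..<l}. {..<b i})"
    then obtain i j where ij: "i < l" "j < b i" "p = string_start b i + j" by auto
    have "Suc p < string_start b (Suc i)" using ij by (simp add: string_start_Suc)
    then have lt: "Suc p < string_start b k" if "i < k" for k
      using string_start_mono[of "Suc i" k b] that by simp
    have gt: "string_start b k < Suc p" if "k \<le> i" for k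
      using string_start_mono[OF that, of b] ij by simp
    have "int p \<noteq> int (string_start b k) - 1" for k
      using lt[of k] gt[of k] by (cases "i < k") auto
    then show "p \<in> scroll_cols (string_start b l - 1) l (\<lambda>i. int (string_start b i) - 1)"
      using lt[OF ij(1)] by (auto simp: scroll_cols_def)
  qed
qed

section \<open>The degree of projective space\<close>

lemma unit_vec_nonzero: "unit_vec i \<noteq> (0 :: nat \<Rightarrow> 'k::field)"
  by (metis unit_vec_apply zero_fun_apply zero_neq_one)

lemma affsp_mono: "k \<le> r \<Longrightarrow> affsp k \<subseteq> affsp r"
  by (auto simp: affsp_def)

text \<open>Along the flag of coordinate subspaces the next coordinate vanishes on the smaller space
  but not on the larger, so each step adds one independent variable.\<close>

lemma alg_indep_vars:
  assumes inf: "infinite (UNIV :: 'k::field set)" and "k \<le> r"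
  shows "\<not> alg_dep {..k} var (affsp k - {0} :: (nat \<Rightarrow> 'k) set)"
  using assms(2)
proof (induction k)
  have nz: "affsp k \<noteq> ({0} :: (nat \<Rightarrow> 'k) set)" for k
    using unit_vec_affsp[of k k, where 'a = 'k] unit_vec_nonzero[of k] by blast
  note cl = closed_proj_irred_proj_subspace[OF inf subspace_affsp affsp_mono nz]
  {
    case 0
    have "\<not> alg_dep (insert 0 {}) (var(0 := var 0)) (affsp 0 - {0} :: (nat \<Rightarrow> 'k) set)"
    proof (intro alg_dep_extend[OF inf cl, of 0 r "{\<lambda>_. 0}"] alg_indep_empty)
      show "\<exists>x\<in>affsp 0 - {0}. eval (var 0) x \<noteq> (0 :: 'k)"
        using unit_vec_affsp[of 0 0, where 'a = 'k] unit_vec_nonzero[of 0, where 'k = 'k]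
        by (intro bexI[of _ "unit_vec 0"]) (auto simp: unit_vec_apply)
    qed (auto simp: polys_eq_vpolys homog_def intro: homog_of_deg_var)
    then show ?case unfolding fun_upd_triv atMost_0 .
  next
    case (Suc k)
    have "\<not> alg_dep (insert (Suc k) {..k}) (var(Suc k := var (Suc k))) (affsp (Suc k) - {0} :: (nat \<Rightarrow> 'k) set)"
    proof (intro alg_dep_extend[OF inf cl, of "Suc k" r "affsp k - {0}"])
      show "\<exists>x\<in>affsp (Suc k) - {0}. eval (var (Suc k)) x \<noteq> (0 :: 'k)"
        using unit_vec_affsp[of "Suc k" "Suc k", where 'a = 'k] unit_vec_nonzero[of "Suc k", where 'k = 'k]
        by (intro bexI[of _ "unit_vec (Suc k)"]) (auto simp: unit_vec_apply)
      show "affsp k - {0} \<subseteq> insert (\<lambda>_. 0) (affsp (Suc k) - {0} :: (nat \<Rightarrow> 'k) set)"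
        using affsp_mono[of k "Suc k"] by auto
      show "\<not> alg_dep {..k} var (affsp k - {0} :: (nat \<Rightarrow> 'k) set)"
        by (rule Suc.IH) (use Suc.prems in simp)
    qed (use Suc in \<open>auto simp: polys_eq_vpolys homog_def affsp_def intro: homog_of_deg_var\<close>)
    then show ?case unfolding fun_upd_triv atMost_Suc .
  }
qed

text \<open>A nonzero polynomial that vanishes everywhere would be an algebraic relation among the
  coordinates.\<close>

lemma van_ideal_PP:
  assumes inf: "infinite (UNIV :: 'k::field set)"
  shows "van_ideal r (PP r) = {0 :: 'k mpoly}"
proof -
  have "f = 0" if f: "f \<in> polys r" "\<And>x. x \<in> PP r \<Longrightarrow> eval f x = (0 :: 'k)" for f
  proof (rule ccontr)
    assume "f \<noteq> 0"
    define K where "K = Poly_Mapping.lookup ` Poly_Mapping.keys f"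
    define c where "c \<mu> = Poly_Mapping.lookup f (Poly_Mapping.Abs_poly_mapping \<mu>)" for \<mu>
    have inj: "inj_on Poly_Mapping.lookup A" for A :: "(nat \<Rightarrow>\<^sub>0 nat) set"
      by (rule inj_onI, rule poly_mapping_eqI) simp
    have c: "c (Poly_Mapping.lookup m) = Poly_Mapping.lookup f m" for m
      unfolding c_def Poly_Mapping.lookup_inverse ..
    have "(\<Sum>\<mu>\<in>K. c \<mu> * (\<Prod>i\<le>r. eval (var i) x ^ \<mu> i)) = 0" if "x \<in> affsp r - {0}" for x
    proof -
      have "(\<Sum>\<mu>\<in>K. c \<mu> * (\<Prod>i\<le>r. eval (var i) x ^ \<mu> i)) =
        (\<Sum>m\<in>Poly_Mapping.keys f. Poly_Mapping.lookup f m * (\<Prod>i\<le>r. x i ^ Poly_Mapping.lookup m i))"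
        unfolding K_def by (subst sum.reindex[OF inj]) (simp add: c)
      also have "\<dots> = (\<Sum>m\<in>Poly_Mapping.keys f. Poly_Mapping.lookup f m * mono_eval m x)"
      proof (rule sum.cong[OF refl])
        fix m assume "m \<in> Poly_Mapping.keys f"
        then have "Poly_Mapping.keys m \<subseteq> {..r}" using f(1) by (auto simp: polys_def)
        then show "Poly_Mapping.lookup f m * (\<Prod>i\<le>r. x i ^ Poly_Mapping.lookup m i) = Poly_Mapping.lookup f m * mono_eval m x"
          using mono_eval_superset[of "{..r}" m x] by simp
      qed
      also have "\<dots> = eval f x" by (rule eval_superset[symmetric]) auto
      finally show ?thesis using f(2)[of x] that by (simp add: PP_iff)
    qed
    moreover have "finite K" "K \<noteq> {}" using \<open>f \<noteq> 0\<close> by (auto simp: K_def)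
    moreover have "c \<mu> \<noteq> 0 \<and> (\<forall>i. i \<notin> {..r} \<longrightarrow> \<mu> i = 0)" if "\<mu> \<in> K" for \<mu>
      using that f(1) by (auto simp: K_def c in_keys_iff polys_def subset_iff)
    ultimately have "alg_dep {..r} var (affsp r - {0} :: (nat \<Rightarrow> 'k) set)"
      unfolding alg_dep_def by (intro exI[of _ K] exI[of _ c]) simp
    then show False using alg_indep_vars[OF inf order_refl] by blast
  qed
  then show ?thesis by (auto simp: van_ideal_def polys_eq_vpolys)
qed

text \<open>Stars and bars: exponent vectors correspond to lists of \<open>Suc r\<close> numbers
  with sum \<open>d\<close>.\<close>

lemma card_monomials_of_degree:
  "finite {m. Poly_Mapping.keys m \<subseteq> {..r} \<and> mdeg m = d}"
  "card {m. Poly_Mapping.keys m \<subseteq> {..r} \<and> mdeg m = d} = (d + r) choose r"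
proof -
  let ?A = "{m. Poly_Mapping.keys m \<subseteq> {..r} \<and> mdeg m = d}"
  let ?B = "{l :: nat list. length l = Suc r \<and> sum_list l = d}"
  define F where "F m = map (Poly_Mapping.lookup m) [0..<Suc r]" for m :: "nat \<Rightarrow>\<^sub>0 nat"
  have nth: "F m ! i = Poly_Mapping.lookup m i" if "i \<le> r" for m i
    using that unfolding F_def by (subst nth_map) (auto simp del: upt_Suc)
  have sum: "sum_list (F m) = mdeg m" if "Poly_Mapping.keys m \<subseteq> {..r}" for m
    using mdeg_superset[OF _ that] by (simp add: F_def interv_sum_list_conv_sum_set_nat atLeast0_lessThan_Suc
        lessThan_Suc_atMost atLeast0LessThan del: upt_Suc)
  have "bij_betw F ?A ?B"
  proof (rule bij_betw_imageI)
    show "inj_on F ?A"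
    proof (rule inj_onI, rule poly_mapping_eqI)
      fix m m' k assume m: "m \<in> ?A" "m' \<in> ?A" "F m = F m'"
      show "Poly_Mapping.lookup m k = Poly_Mapping.lookup m' k"
      proof (cases "k \<le> r")
        case True
        then show ?thesis using nth m(3) by metis
      next
        case False
        then have "k \<notin> Poly_Mapping.keys m" "k \<notin> Poly_Mapping.keys m'" using m by auto
        then show ?thesis by (simp add: in_keys_iff)
      qed
    qed
    show "F ` ?A = ?B"
    proof (intro equalityI subsetI)
      fix l assume l: "l \<in> ?B"
      define m where "m = Poly_Mapping.Abs_poly_mapping (\<lambda>i. if i \<le> r then l ! i else 0)"
      have "finite {i. (if i \<le> r then l ! i else 0) \<noteq> 0}" by (rule finite_subset[of _ "{..r}"]) auto
      then have lk: "Poly_Mapping.lookup m i = (if i \<le> r then l ! i else 0)" for i by (simp add: m_def)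
      then have keys: "Poly_Mapping.keys m \<subseteq> {..r}" by (auto simp: in_keys_iff split: if_splits)
      have "F m = l" using l nth[of _ m] by (intro nth_equalityI) (auto simp: F_def lk simp del: upt_Suc)
      then show "l \<in> F ` ?A" using keys sum[OF keys] l by (intro image_eqI[of _ _ m]) auto
    qed (use sum in \<open>auto simp: F_def simp del: upt_Suc\<close>)
  qed
  note bij = this
  have cB: "card ?B = (d + r) choose r"
    using card_length_sum_list[of "Suc r" d] by (simp add: binomial_symmetric[of d "d + r"])
  then have "card ?B > 0" by simp
  then have "finite ?B" by (rule card_ge_0_finite)
  then show "finite ?A" using bij_betw_finite[OF bij] by simp
  show "card ?A = (d + r) choose r" using bij_betw_same_card[OF bij] cB by simp
qed

interpretation mp: vec_space "\<lambda>(c :: 'k::field) (f :: 'k mpoly). const c * f"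
proof unfold_locales
  fix a b :: 'k and x y :: "'k mpoly"
  show "const a * (x + y) = const a * x + const a * y" by (simp add: algebra_simps)
  show "const (a + b) * x = const a * x + const b * x"
    by (simp add: const_def single_add algebra_simps)
  show "const a * (const b * x) = const (a * b) * x"
    by (simp add: const_def mult.assoc[symmetric] mult_single)
  show "const 1 * x = x" by (simp add: const_def)
qed

text \<open>As the vanishing ideal is zero, the monomials of degree \<open>d\<close> are
  independent; they also span all forms of this degree, so they attain the supremum.\<close>

lemma hilbert_fun_PP:
  assumes inf: "infinite (UNIV :: 'k::field set)"
  shows "hilbert_fun r (PP r :: (nat \<Rightarrow> 'k) set) d = (d + r) choose r"
proof -
  let ?A = "{m. Poly_Mapping.keys m \<subseteq> {..r} \<and> mdeg m = d}"
  let ?s = "\<lambda>m :: nat \<Rightarrow>\<^sub>0 nat. Poly_Mapping.single m (1 :: 'k)"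
  let ?S = "{card B | B. finite B \<and> B \<subseteq> polys r \<and> (\<forall>b\<in>B. homog_of_deg d b) \<and>
      (\<forall>c. (\<Sum>b\<in>B. const (c b) * b) \<in> van_ideal r (PP r :: (nat \<Rightarrow> 'k) set) \<longrightarrow> (\<forall>b\<in>B. c b = 0))}"
  note A = card_monomials_of_degree[of r d]
  have inj: "inj_on ?s ?A" by (rule inj_onI) (metis keys_single one_neq_zero singleton_inject)
  have "card ?A \<in> ?S"
  proof -
    have "\<forall>b\<in>?s ` ?A. c b = 0" if "(\<Sum>b\<in>?s ` ?A. const (c b) * b) \<in> van_ideal r (PP r :: (nat \<Rightarrow> 'k) set)" for c
    proof -
      have 0: "(\<Sum>m\<in>?A. Poly_Mapping.single m (c (?s m))) = 0"
        using that by (simp add: van_ideal_PP[OF inf] sum.reindex[OF inj] const_def mult_single)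
      have "c (?s m) = 0" if "m \<in> ?A" for m
      proof -
        have "Poly_Mapping.lookup (\<Sum>m\<in>?A. Poly_Mapping.single m (c (?s m))) m = (\<Sum>m'\<in>?A. if m' = m then c (?s m) else 0)"
          unfolding lookup_sum by (intro sum.cong) (auto simp: lookup_single when_def)
        also have "\<dots> = c (?s m)" using that A(1) by simp
        finally show ?thesis using 0 by simp
      qed
      then show ?thesis by blast
    qed
    then show ?thesis
      using A(1) card_image[OF inj]
      by (intro CollectI exI[of _ "?s ` ?A"]) (auto simp: polys_eq_vpolys intro!: vpolys_single homog_of_deg_single)
  qed
  moreover have "x \<le> card ?A" if x: "x \<in> ?S" for x
  proof -
    obtain B where B: "x = card B" "finite B" "B \<subseteq> polys r" "\<forall>b\<in>B. homog_of_deg d b"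
      "\<forall>c. (\<Sum>b\<in>B. const (c b) * b) \<in> van_ideal r (PP r :: (nat \<Rightarrow> 'k) set) \<longrightarrow> (\<forall>b\<in>B. c b = 0)"
      using x by blast
    have "mp.independent B"
      using B(2,5) mp.dependent_finite[OF B(2)] by (auto simp: van_ideal_PP[OF inf])
    moreover have "B \<subseteq> mp.span (?s ` ?A)"
    proof
      fix b assume b: "b \<in> B"
      have "b = (\<Sum>m\<in>Poly_Mapping.keys b. const (Poly_Mapping.lookup b m) * ?s m)"
        by (subst sum_single_eq[of b, symmetric]) (simp add: const_def mult_single)
      also have "\<dots> \<in> mp.span (?s ` ?A)"
        using b B(3,4) by (intro mp.span_sum mp.span_scale mp.span_base imageI) (auto simp: polys_def homog_of_deg_def)
      finally show "b \<in> mp.span (?s ` ?A)" .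
    qed
    ultimately have "card B \<le> card (?s ` ?A)"
      using mp.independent_span_bound[OF finite_imageI[OF A(1)]] by blast
    then show ?thesis using B(1) card_image[OF inj] by simp
  qed
  ultimately have "Sup ?S = card ?A" by (intro cSup_eq_maximum)
  then show ?thesis using A(2) by (simp add: hilbert_fun_def)
qed

lemma poly_eq_if_eventually_eq:
  fixes p q :: "rat poly"
  assumes "\<forall>\<^sub>F d in sequentially. poly p (of_nat d) = poly q (of_nat d)"
  shows "p = q"
proof (rule ccontr)
  assume "p \<noteq> q"
  then have "finite {x. poly (p - q) x = 0}" by (intro poly_roots_finite) simp
  moreover obtain N where "\<And>d. d \<ge> N \<Longrightarrow> poly p (of_nat d) = poly q (of_nat d)"
    using assms by (auto simp: eventually_sequentially)
  then have "(of_nat ` {N..} :: rat set) \<subseteq> {x. poly (p - q) x = 0}" by auto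
  ultimately have "finite (of_nat ` {N..} :: rat set)" by (rule finite_subset[rotated])
  then have "finite {N..}" by (rule finite_imageD) simp
  then show False by (simp add: infinite_Ici)
qed

text \<open>The Hilbert polynomial is \<open>(d + 1) ... (d + r) / r!\<close>, with leading
  coefficient \<open>1 / r!\<close>. Polynomials that agree for all large \<open>d\<close> are
  equal, which makes the description definite.\<close>

lemma deg_proj_PP:
  assumes inf: "infinite (UNIV :: 'k::field set)"
  shows "deg_proj r (PP r :: (nat \<Rightarrow> 'k) set) = 1"
proof -
  define Q :: "rat poly" where "Q = (\<Prod>i<r. [:of_nat (Suc i), 1:])"
  define P where "P = smult (1 / fact r) Q"
  have degQ: "degree Q = r" unfolding Q_def by (subst degree_prod_eq_sum_degree) auto
  have lcQ: "lead_coeff Q = 1" unfolding Q_def by (simp add: lead_coeff_prod)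
  have "poly Q (of_nat d) * fact d = fact (d + r)" for d
  proof -
    have "(\<Prod>i<r. poly [:of_nat (Suc i), 1:] (of_nat d :: rat)) * fact d = fact (d + r)"
    proof (induction r)
      case (Suc r)
      have "fact (d + Suc r) = of_nat (Suc (d + r)) * (fact (d + r) :: rat)" by simp
      then show ?case unfolding Suc.IH[symmetric] by (simp add: algebra_simps)
    qed simp
    then show ?thesis by (simp add: Q_def poly_prod)
  qed
  then have "poly P (of_nat d) = of_nat ((d + r) choose r)" for d
  proof -
    have "fact d * poly Q (of_nat d) = fact d * (fact r * (of_nat ((d + r) choose r) :: rat))"
      using binomial_fact[of r "d + r", where 'a = rat] \<open>\<And>d. poly Q (of_nat d) * fact d = fact (d + r)\<close>[of d]
      by (simp add: field_simps)
    then have "poly Q (of_nat d) = fact r * (of_nat ((d + r) choose r) :: rat)"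
      by (rule mult_left_cancel[THEN iffD1, rotated]) simp
    then show ?thesis by (simp add: P_def)
  qed
  then have P: "of_nat (hilbert_fun r (PP r :: (nat \<Rightarrow> 'k) set) d) = poly P (of_nat d)" for d
    by (simp add: hilbert_fun_PP[OF inf])
  have lc: "fact (degree P) * lead_coeff P = 1" using degQ lcQ by (simp add: P_def)
  show ?thesis
    unfolding deg_proj_def
  proof (rule the_equality)
    show "\<exists>P' :: rat poly. (\<forall>\<^sub>F d in sequentially. of_nat (hilbert_fun r (PP r :: (nat \<Rightarrow> 'k) set) d) = poly P' (of_nat d))
        \<and> of_int 1 = fact (degree P') * lead_coeff P'"
      using P lc by (intro exI[of _ P]) auto
    fix e assume "\<exists>P' :: rat poly. (\<forall>\<^sub>F d in sequentially. of_nat (hilbert_fun r (PP r :: (nat \<Rightarrow> 'k) set) d) = poly P' (of_nat d))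
        \<and> of_int e = fact (degree P') * lead_coeff P'"
    then obtain P' where P': "\<forall>\<^sub>F d in sequentially. poly P (of_nat d) = poly P' (of_nat d)"
      "of_int e = fact (degree P') * lead_coeff P'" unfolding P by blast
    then have "P' = P" using poly_eq_if_eventually_eq by metis
    then have "(of_int e :: rat) = of_int 1" using P'(2) lc by simp
    then show "e = 1" by (rule of_int_eq_iff[THEN iffD1])
  qed
qed

text \<open>A case of the dimension formula for scrolls: the identity matrix and the single column
  \<open>0\<close>, which has no minors.\<close>

lemma dim_proj_PP:
  assumes inf: "infinite (UNIV :: 'k::field set)" and r: "r \<ge> 1"
  shows "dim_proj r (PP r :: (nat \<Rightarrow> 'k) set) = int r"
proof -
  let ?P = "unit_vec :: nat \<Rightarrow> nat \<Rightarrow> 'k"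
  have id: "linmap r r ?P x = x" if "x \<in> affsp r" for x
  proof
    fix i
    show "linmap r r ?P x i = x i"
      using that sum.delta[of "{..r}" i x]
      by (auto simp: linmap_def affsp_def unit_vec_def if_distrib[of "\<lambda>c. c * _"] cong: if_cong)
  qed
  have PP: "det_scroll r {0} = (PP r :: (nat \<Rightarrow> 'k) set)" by (auto simp: det_scroll_def)
  have img: "linmap r r ?P ` A = A" if "A \<subseteq> affsp r" for A
    using id that by (force simp: image_iff)
  have "closed_proj r (PP r :: (nat \<Rightarrow> 'k) set)"
    unfolding closed_proj_def by (intro exI[of _ "{}"]) (auto simp: zero_set_def)
  note cl = this
  let ?R = "{x \<in> affsp r. x \<noteq> 0 \<and> (\<forall>j\<in>{0}. x (Suc j) = (0 :: 'k))}"
  have imPP: "linmap r r ?P ` PP r = PP r" by (rule img) (auto simp: PP_def)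
  have imR: "linmap r r ?P ` ?R = ?R" by (rule img) blast
  have "unit_vec 1 \<in> PP r" "unit_vec 1 \<notin> ?R"
    using r unit_vec_affsp[of 1 r] unit_vec_nonzero[of 1] by (auto simp: PP_iff unit_vec_def)
  then have neq: "PP r \<noteq> ?R" by blast
  have "dim_proj r (linmap r r ?P ` det_scroll r {0}) = int (r + 1) - int (card {0 :: nat})"
  proof (rule dim_proj_image_det_scroll[OF inf])
    show "closed_proj r (linmap r r ?P ` det_scroll r {0})" unfolding PP imPP by (rule cl)
    show "linmap r r ?P ` det_scroll r {0} \<noteq> linmap r r ?P ` ?R" unfolding PP imPP imR by (rule neq)
  qed (use id r in auto)
  then show ?thesis unfolding PP imPP by simp
qed

section \<open>Linear forms on a projected scroll\<close>

definition dot :: "nat \<Rightarrow> (nat \<Rightarrow> 'k::field) \<Rightarrow> (nat \<Rightarrow> 'k) \<Rightarrow> 'k" where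
  "dot s v x = (\<Sum>i\<le>s. v i * x i)"

lemma dot_add_left: "dot s (v + w) x = dot s v x + dot s w x"
  by (simp add: dot_def algebra_simps sum.distrib)

lemma dot_diff_left: "dot s (v - w) x = dot s v x - dot s w x"
  by (simp add: dot_def algebra_simps sum_subtractf)

lemma dot_scale_left: "dot s (fscale c v) x = c * dot s v x"
  by (simp add: dot_def sum_distrib_left mult.assoc)

lemma dot_zero_left: "dot s 0 x = 0"
  by (simp add: dot_def)

lemma dot_sum_left: "dot s (\<Sum>i\<in>I. fscale (c i) (v i)) x = (\<Sum>i\<in>I. c i * dot s (v i) x)"
proof -
  have "dot s (\<Sum>i\<in>I. fscale (c i) (v i)) x = (\<Sum>k\<le>s. \<Sum>i\<in>I. c i * (v i k * x k))"
    by (simp add: dot_def sum_distrib_right mult.assoc)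
  also have "\<dots> = (\<Sum>i\<in>I. \<Sum>k\<le>s. c i * (v i k * x k))" by (rule sum.swap)
  finally show ?thesis by (simp add: dot_def sum_distrib_left)
qed

lemma dot_scale_right: "dot s v (fscale c x) = c * dot s v x"
  by (simp add: dot_def sum_distrib_left algebra_simps)

lemma dot_unit_vec: "i \<le> s \<Longrightarrow> dot s (unit_vec i) x = x i"
  by (simp add: dot_def unit_vec_def if_distrib[of "\<lambda>c. c * _"] cong: if_cong)

lemma linmap_dot: "i \<le> t \<Longrightarrow> linmap s t M x i = dot s (M i) x"
  by (simp add: linmap_def dot_def)

lemma subspace_dot: "fs.subspace {v. dot s v x = 0}"
  by (simp add: fs.subspace_def dot_add_left dot_scale_left dot_zero_left)

lemma curve_poly_dot: "curve_poly (dot s v)"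
proof -
  have "curve_poly (\<lambda>x. \<Sum>i\<le>s. v i * x i)" by (intro curve_poly_sum curve_poly_mult) auto
  then show ?thesis by (simp add: dot_def[abs_def])
qed

text \<open>Sends the form \<open>x j\<close> to \<open>x (Suc j)\<close>, that is, the upper entry
  of a column combination to its lower entry.\<close>

definition shift :: "(nat \<Rightarrow> 'k::field) \<Rightarrow> nat \<Rightarrow> 'k" where
  "shift w = (\<lambda>i. case i of 0 \<Rightarrow> 0 | Suc j \<Rightarrow> w j)"

lemma shift_0 [simp]: "shift w 0 = 0" and shift_Suc [simp]: "shift w (Suc j) = w j"
  by (simp_all add: shift_def)

lemma shift_add: "shift (v + w) = shift v + shift w"
  by (rule ext) (simp add: shift_def split: nat.split)

lemma shift_scale: "shift (fscale c w) = fscale c (shift w)"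
  by (rule ext) (simp add: shift_def split: nat.split)

lemma shift_diff: "shift (v - w) = shift v - shift w"
  by (rule ext) (simp add: shift_def split: nat.split)

lemma shift_zero: "shift 0 = 0"
  by (rule ext) (simp add: shift_def split: nat.split)

lemma linear_shift: "Vector_Spaces.linear fscale fscale (shift :: (nat \<Rightarrow> 'k::field) \<Rightarrow> nat \<Rightarrow> 'k)"
  using fs.vector_space_axioms by unfold_locales (auto simp: shift_add shift_scale)

lemma inj_shift: "inj shift"
  by (metis ext injI shift_Suc)

text \<open>A column combination is identified with its upper entry, which determines the
  coefficients.\<close>

definition colspace :: "nat set \<Rightarrow> (nat \<Rightarrow> 'k::field) set" where
  "colspace J = {w. \<forall>i. i \<notin> J \<longrightarrow> w i = 0}"

lemma subspace_colspace: "fs.subspace (colspace J)"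
  by (auto simp: fs.subspace_def colspace_def)

lemma dot_colspace:
  assumes "J \<subseteq> {..<Suc r}" "w \<in> colspace J"
  shows "dot (Suc r) w x = (\<Sum>j\<in>J. w j * x j)" "dot (Suc r) (shift w) x = (\<Sum>j\<in>J. w j * x (Suc j))"
proof -
  have fin: "finite J" using assms(1) finite_subset by blast
  show "dot (Suc r) w x = (\<Sum>j\<in>J. w j * x j)"
    unfolding dot_def using assms by (intro sum.mono_neutral_right) (auto simp: colspace_def)
  have "dot (Suc r) (shift w) x = (\<Sum>j\<le>r. w j * x (Suc j))"
    unfolding dot_def by (subst sum.atMost_Suc_shift) simp
  also have "\<dots> = (\<Sum>j\<in>J. w j * x (Suc j))"
    using assms by (intro sum.mono_neutral_right) (auto simp: colspace_def)
  finally show "dot (Suc r) (shift w) x = (\<Sum>j\<in>J. w j * x (Suc j))" .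
qed

text \<open>Minors are bilinear in the two columns, so those of column combinations vanish as
  well.\<close>

lemma dot_minor:
  assumes J: "J \<subseteq> {..<Suc r}" and w: "w \<in> colspace J" "w' \<in> colspace J" and x: "x \<in> det_scroll (Suc r) J"
  shows "dot (Suc r) w x * dot (Suc r) (shift w') x = dot (Suc r) w' x * dot (Suc r) (shift w) x"
proof -
  have "(\<Sum>i\<in>J. w i * x i) * (\<Sum>j\<in>J. w' j * x (Suc j)) = (\<Sum>i\<in>J. \<Sum>j\<in>J. w i * w' j * (x i * x (Suc j)))"
    by (simp add: sum_product algebra_simps)
  also have "\<dots> = (\<Sum>i\<in>J. \<Sum>j\<in>J. w i * w' j * (x j * x (Suc i)))"
    using x by (intro sum.cong refl) (auto simp: det_scroll_def)
  also have "\<dots> = (\<Sum>j\<in>J. \<Sum>i\<in>J. w i * w' j * (x j * x (Suc i)))" by (rule sum.swap)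
  also have "\<dots> = (\<Sum>j\<in>J. w' j * x j) * (\<Sum>i\<in>J. w i * x (Suc i))"
    by (simp add: sum_product algebra_simps)
  finally show ?thesis by (simp add: dot_colspace[OF J] w)
qed

text \<open>Nondegeneracy of scrolls. For each string the scroll contains the rational normal curve
  with coordinates \<open>t ^ (j - h)\<close>; along it a linear form is a polynomial in
  \<open>t\<close> whose coefficients are those of the form on this string.\<close>

lemma det_scroll_spans:
  fixes v :: "nat \<Rightarrow> 'k::field"
  assumes inf: "infinite (UNIV :: 'k set)" and J: "J \<subseteq> {..<s}"
    and v: "\<And>x. x \<in> det_scroll s J \<Longrightarrow> dot s v x = 0" and i: "i \<le> s"
  shows "v i = 0"
proof -
  \<comment> \<open>\<open>h\<close> is the first index of the string through
    \<open>i\<close>.\<close>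
  have "\<exists>h\<le>i. (\<forall>m\<in>{h..<i}. m \<in> J) \<and> h \<notin> Suc ` J"
  proof (induction i)
    case (Suc i)
    show ?case
    proof (cases "i \<in> J")
      case True
      obtain h where "h \<le> i" "\<forall>m\<in>{h..<i}. m \<in> J" "h \<notin> Suc ` J" using Suc by blast
      then show ?thesis using True by (intro exI[of _ h]) (auto simp: less_Suc_eq)
    next
      case False
      then show ?thesis by (intro exI[of _ "Suc i"]) auto
    qed
  qed auto
  then obtain h where h: "h \<le> i" "\<forall>m\<in>{h..<i}. m \<in> J" "h \<notin> Suc ` J" by blast
  define on where "on j \<longleftrightarrow> h \<le> j \<and> (\<forall>m\<in>{h..<j}. m \<in> J)" for j
  define X where "X t j = (if on j then t ^ (j - h) else 0)" for t :: 'k and j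
  have on_Suc: "on (Suc j) \<longleftrightarrow> on j" if "j \<in> J" for j
    using that h(3) by (auto simp: on_def less_Suc_eq le_Suc_eq)
  have on_le: "j \<le> s" if "on j" for j
  proof (rule ccontr)
    assume "\<not> j \<le> s"
    then have "s \<in> {h..<j}" using h(1) i by simp
    then show False using that J unfolding on_def by blast
  qed
  have "X t \<in> det_scroll s J" for t
  proof (rule det_scrollI[where \<tau> = t])
    have "on h" by (simp add: on_def)
    then have "X t h \<noteq> 0" by (simp add: X_def)
    moreover have "X t j = 0" if "j > s" for j using on_le[of j] that by (auto simp: X_def)
    ultimately show "X t \<in> PP s" by (auto simp: PP_def affsp_def fun_eq_iff)
    show "X t (Suc j) = t * X t j" if "j \<in> J" for j
      using on_Suc[OF that] by (auto simp: X_def on_def Suc_diff_le)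
  qed
  define p where "p = (\<Sum>j\<le>s. if on j then monom (v j) (j - h) else 0)"
  have "poly p t = dot s v (X t)" for t
    by (auto simp: p_def dot_def X_def poly_sum poly_monom intro!: sum.cong)
  then have "p = 0"
    using poly_zero_if_vanishes[OF inf, of "{}" p] v \<open>\<And>t. X t \<in> det_scroll s J\<close> by simp
  have on_i: "on i" using h by (simp add: on_def)
  have "poly.coeff p (i - h) = (\<Sum>j\<le>s. if j = i then v i else 0)"
    unfolding p_def coeff_sum
  proof (intro sum.cong refl)
    fix j
    show "poly.coeff (if on j then monom (v j) (j - h) else 0) (i - h) = (if j = i then v i else 0)"
      using on_i h(1) by (auto simp: on_def)
  qed
  then show ?thesis using \<open>p = 0\<close> i by simp
qed

lemma homog_linear_eval:
  assumes f: "homog_of_deg 1 f" "f \<in> polys r"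
  shows "eval f y = (\<Sum>k\<le>r. Poly_Mapping.lookup f (Poly_Mapping.single k 1) * y k)"
proof -
  let ?s = "\<lambda>k. Poly_Mapping.single k (1 :: nat)"
  have "m \<in> ?s ` {..r}" if m: "m \<in> Poly_Mapping.keys f" for m
  proof -
    have "(\<Sum>i\<in>Poly_Mapping.keys m. Poly_Mapping.lookup m i) = 1"
      using f(1) m by (auto simp: homog_of_deg_def mdeg_def)
    then obtain k where k: "k \<in> Poly_Mapping.keys m" "Poly_Mapping.lookup m k = 1"
      "\<forall>b\<in>Poly_Mapping.keys m. k \<noteq> b \<longrightarrow> Poly_Mapping.lookup m b = 0"
      using sum_eq_1_iff[OF finite_keys, of "Poly_Mapping.lookup m" m] by auto
    have "m = ?s k"
    proof (rule poly_mapping_eqI)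
      fix b
      show "Poly_Mapping.lookup m b = Poly_Mapping.lookup (?s k) b"
        using k by (cases "b = k"; cases "b \<in> Poly_Mapping.keys m") (auto simp: lookup_single when_def in_keys_iff)
    qed
    moreover have "k \<le> r" using k(1) m f(2) by (auto simp: polys_def)
    ultimately show ?thesis by blast
  qed
  then have "eval f y = (\<Sum>m\<in>?s ` {..r}. Poly_Mapping.lookup f m * mono_eval m y)"
    by (intro eval_superset) auto
  also have "\<dots> = (\<Sum>k\<le>r. Poly_Mapping.lookup f (?s k) * y k)"
  proof (subst sum.reindex)
    show "inj_on ?s {..r}" by (rule inj_onI) (metis keys_single one_neq_zero singleton_inject)
  qed (simp add: mono_eval_single)
  finally show ?thesis .
qed

section \<open>Projecting a scroll from a point\<close>

text \<open>Linear forms are coefficient vectors. A combination \<open>w\<close> of columns of the scroll matrix has the entries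
  \<open>dot s w\<close> and \<open>dot s (shift w)\<close>; it lies in \<open>W\<close> if both vanish at the centre \<open>q\<close>.\<close>

locale projected_scroll =
  fixes r :: nat and J :: "nat set" and q :: "nat \<Rightarrow> 'k::field" and P :: "nat \<Rightarrow> nat \<Rightarrow> 'k"
  assumes inf: "infinite (UNIV :: 'k set)" and J: "J \<subseteq> {..<Suc r}"
    and q: "q \<in> PP (Suc r)" "q \<notin> det_scroll (Suc r) J"
    and kernel: "\<And>x. x \<in> affsp (Suc r) \<Longrightarrow> linmap (Suc r) r P x = 0 \<longleftrightarrow> (\<exists>c. x = fscale c q)"
begin

abbreviation \<psi> :: "(nat \<Rightarrow> 'k) \<Rightarrow> nat \<Rightarrow> 'k" where "\<psi> \<equiv> linmap (Suc r) r P"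

abbreviation dt :: "(nat \<Rightarrow> 'k) \<Rightarrow> (nat \<Rightarrow> 'k) \<Rightarrow> 'k" where "dt \<equiv> dot (Suc r)"

text \<open>These are the linear forms that factor through the projection, since its kernel is the
  line of \<open>q\<close>.\<close>

definition U :: "(nat \<Rightarrow> 'k) set" where "U = {v \<in> affsp (Suc r). dt v q = 0}"

definition W :: "(nat \<Rightarrow> 'k) set" where "W = {w \<in> colspace J. dt w q = 0 \<and> dt (shift w) q = 0}"

lemma finite_J: "finite J"
  using J finite_subset by blast

lemma q_affsp: "q \<in> affsp (Suc r)"
  using q by (simp add: PP_iff)

lemma subspace_U: "fs.subspace U"
proof -
  have "U = affsp (Suc r) \<inter> {v. dt v q = 0}" by (auto simp: U_def)
  then show ?thesis using subspace_affsp subspace_dot fs.subspace_inter by metis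
qed

lemma subspace_W: "fs.subspace W"
proof -
  have "W = colspace J \<inter> {w. dt w q = 0 \<and> dt (shift w) q = 0}" by (auto simp: W_def)
  moreover have "fs.subspace {w. dt w q = 0 \<and> dt (shift w) q = 0}"
    unfolding fs.subspace_def mem_Collect_eq shift_zero shift_add shift_scale dot_zero_left dot_add_left dot_scale_left
    by simp
  ultimately show ?thesis using fs.subspace_inter[OF subspace_colspace] by simp
qed

lemma colspace_affsp: "colspace J \<subseteq> affsp r"
  using J by (auto simp: colspace_def affsp_def)

lemma shift_affsp: "w \<in> affsp k \<Longrightarrow> shift w \<in> affsp (Suc k)"
  by (auto simp: affsp_def shift_def split: nat.split)

lemma W_sub_U: "W \<subseteq> U"
  using colspace_affsp affsp_mono[of r "Suc r"] by (auto simp: W_def U_def)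

lemma shift_W: "shift ` W \<subseteq> U"
  using colspace_affsp shift_affsp by (auto simp: W_def U_def)

lemma q_minor:
  obtains i j where "i \<in> J" "j \<in> J" "q i * q (Suc j) \<noteq> q j * q (Suc i)"
  using q by (auto simp: det_scroll_def)

text \<open>A minor that does not vanish at \<open>q\<close> gives two columns with independent
  values there; Cramer's rule turns them into combinations with values \<open>(1, 0)\<close> and
  \<open>(0, 1)\<close>.\<close>

lemma section_vectors:
  obtains w1 w2 where "w1 \<in> colspace J" "w2 \<in> colspace J" "dt w1 q = 1" "dt (shift w1) q = 0"
    "dt w2 q = 0" "dt (shift w2) q = 1"
proof -
  obtain i j where ij: "i \<in> J" "j \<in> J" "q i * q (Suc j) \<noteq> q j * q (Suc i)" by (rule q_minor)
  define D where "D = q i * q (Suc j) - q j * q (Suc i)"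
  have D: "D \<noteq> 0" using ij(3) by (simp add: D_def)
  have ne: "i \<noteq> j" using ij(3) by auto
  define w1 where "w1 = (\<lambda>k. if k = i then q (Suc j) / D else if k = j then - q (Suc i) / D else 0)"
  define w2 where "w2 = (\<lambda>k. if k = i then - q j / D else if k = j then q i / D else 0)"
  have cs: "w1 \<in> colspace J" "w2 \<in> colspace J" using ij by (auto simp: colspace_def w1_def w2_def)
  have two: "(\<Sum>k\<in>J. (if k = i then a else if k = j then b else 0) * y k) = a * y i + b * y j" for a b :: 'k and y
  proof -
    have "(\<Sum>k\<in>J. (if k = i then a else if k = j then b else 0) * y k)
        = (\<Sum>k\<in>{i, j}. (if k = i then a else if k = j then b else 0) * y k)"
      using ij finite_J by (intro sum.mono_neutral_right) auto
    then show ?thesis using ne by simp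
  qed
  have d: "q (Suc j) * q i / D - q (Suc i) * q j / D = 1"
    using D by (simp add: diff_divide_distrib[symmetric] D_def mult.commute)
  have "dt w1 q = q (Suc j) / D * q i + - q (Suc i) / D * q j"
    unfolding dot_colspace(1)[OF J cs(1)] by (simp only: w1_def two)
  moreover have "dt (shift w1) q = q (Suc j) / D * q (Suc i) + - q (Suc i) / D * q (Suc j)"
    unfolding dot_colspace(2)[OF J cs(1)] by (simp only: w1_def two)
  moreover have "dt w2 q = - q j / D * q i + q i / D * q j"
    unfolding dot_colspace(1)[OF J cs(2)] by (simp only: w2_def two)
  moreover have "dt (shift w2) q = - q j / D * q (Suc i) + q i / D * q (Suc j)"
    unfolding dot_colspace(2)[OF J cs(2)] by (simp only: w2_def two)
  ultimately have "dt w1 q = 1" "dt (shift w1) q = 0" "dt w2 q = 0" "dt (shift w2) q = 1"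
    using d by (simp_all add: algebra_simps)
  then show ?thesis using that cs by blast
qed

lemma U_index:
  obtains m where "m \<le> Suc r" "q m \<noteq> 0" "unit_vec m \<notin> U"
    "\<And>v. v \<in> affsp (Suc r) \<Longrightarrow> v - fscale (dt v q / q m) (unit_vec m) \<in> U"
proof -
  obtain m where m: "q m \<noteq> 0" using q(1) by (rule PP_nonzeroE)
  then have le: "m \<le> Suc r" using q_affsp by (auto simp: affsp_def not_le[symmetric])
  have "dt (unit_vec m) q = q m" by (rule dot_unit_vec[OF le])
  moreover from this have "v - fscale (dt v q / q m) (unit_vec m) \<in> U" if "v \<in> affsp (Suc r)" for v
    using that m fs.subspace_diff[OF subspace_affsp that fs.subspace_scale[OF subspace_affsp unit_vec_affsp[OF le]]]
    by (simp add: U_def dot_diff_left dot_scale_left)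
  ultimately show ?thesis using that[OF le m] m by (simp add: U_def)
qed

lemma basis_U_card:
  assumes "fs.independent B" "fs.span B = U" "finite B"
  shows "card B = Suc r"
proof -
  obtain m where m: "m \<le> Suc r" "q m \<noteq> 0" "unit_vec m \<notin> U"
    "\<And>v. v \<in> affsp (Suc r) \<Longrightarrow> v - fscale (dt v q / q m) (unit_vec m) \<in> U" by (rule U_index) blast
  have BU: "B \<subseteq> U" using assms(2) fs.span_superset by blast
  then have nB: "unit_vec m \<notin> B" using m(3) by blast
  have "fs.independent (insert (unit_vec m) B)" using assms m(3) by (simp add: fs.independent_insert)
  moreover have "insert (unit_vec m) B \<subseteq> fs.span (unit_vec ` {..Suc r})"
    using BU affsp_subset_span[of "Suc r"] unit_vec_affsp[OF m(1)] by (auto simp: U_def)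
  ultimately have "card (insert (unit_vec m) B) \<le> card (unit_vec ` {..Suc r} :: (nat \<Rightarrow> 'k) set)"
    using fs.independent_span_bound by blast
  then have 1: "Suc (card B) \<le> Suc (Suc r)"
    using card_unit_vecs[of "Suc r", where 'k = 'k] nB assms(3) by simp
  have "unit_vec ` {..Suc r} \<subseteq> fs.span (insert (unit_vec m) B)"
  proof
    fix v :: "nat \<Rightarrow> 'k" assume "v \<in> unit_vec ` {..Suc r}"
    then have "v \<in> affsp (Suc r)" using unit_vec_affsp by auto
    then have "v - fscale (dt v q / q m) (unit_vec m) \<in> fs.span B" using m(4) assms(2) by simp
    then show "v \<in> fs.span (insert (unit_vec m) B)" unfolding fs.span_insert by blast
  qed
  then have "card (unit_vec ` {..Suc r} :: (nat \<Rightarrow> 'k) set) \<le> card (insert (unit_vec m) B)"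
    using fs.independent_span_bound[of "insert (unit_vec m) B"] assms(3) indep_unit_vec[of "Suc r"]
    by (auto simp: fs.indep_fam_def)
  moreover have "card (unit_vec ` {..Suc r} :: (nat \<Rightarrow> 'k) set) = Suc (Suc r)"
    using indep_unit_vec[of "Suc r", where 'k = 'k] by (simp add: fs.indep_fam_def card_image)
  ultimately show ?thesis using 1 nB assms(3) by simp
qed

text \<open>The normal form of the pencil of columns that vanish at the centre. The strings are laid
  out one after the other, those with at least two vectors first, so that they become the blocks of
  a standard scroll matrix.\<close>

lemma string_basis_U:
  "\<exists>u J'. fs.indep_fam u {..r} \<and> fs.span (u ` {..r}) = U \<and> fs.span (u ` J') = W \<and>
    (\<forall>j\<in>J'. shift (u j) = u (Suc j)) \<and> J' \<subseteq> {..<r} \<and>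
    (J' = {} \<or> (\<exists>n l a. scroll_data_ok r n l a \<and> J' = scroll_cols n l a))"
proof -
  \<comment> \<open>The shift raises the lowest nonzero index; this is the measure that excludes
    blocks other than strings.\<close>
  define \<mu> where "\<mu> w = (LEAST i. w i \<noteq> 0)" for w :: "nat \<Rightarrow> 'k"
  have \<mu>: "\<forall>w\<in>W. \<forall>w'\<in>W. w \<noteq> 0 \<longrightarrow> w = shift w' \<longrightarrow> \<mu> w' < \<mu> w"
  proof (intro ballI impI)
    fix w w' :: "nat \<Rightarrow> 'k" assume "w \<noteq> 0" "w = shift w'"
    then obtain i where "w i \<noteq> 0" by (auto simp: fun_eq_iff)
    then have "w (\<mu> w) \<noteq> 0" unfolding \<mu>_def by (rule LeastI)
    then obtain j where j: "\<mu> w = Suc j" "w' j \<noteq> 0"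
      using \<open>w = shift w'\<close> by (cases "\<mu> w") auto
    have "\<mu> w' \<le> j" unfolding \<mu>_def using j(2) by (rule Least_le)
    then show "\<mu> w' < \<mu> w" using j(1) by simp
  qed
  have UF: "U \<subseteq> fs.span (unit_vec ` {..Suc r})" using affsp_subset_span[of "Suc r"] by (auto simp: U_def)
  obtain l L :: nat and b :: "nat \<Rightarrow> nat" and u where lb: "l \<le> L" "\<forall>i<l. 0 < b i" "\<forall>i\<in>{l..<L}. b i = 0"
    and ind: "fs.indep_fam u (SIGMA i:{..<L}. {..b i})" and spU: "fs.span (u ` (SIGMA i:{..<L}. {..b i})) = U"
    and spW: "fs.span (u ` (SIGMA i:{..<l}. {..<b i})) = W" and sh: "\<forall>i<l. \<forall>j<b i. shift (u (i, j)) = u (i, Suc j)"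
    using fs.string_basis[OF subspace_W subspace_U W_sub_U _ UF linear_shift inj_on_subset[OF inj_shift subset_UNIV] shift_W \<mu>]
    by blast
  let ?S = "SIGMA i:{..<L}. {..b i}"
  let ?f = "\<lambda>(i, j). string_start b i + j"
  have finS: "finite ?S" by (rule finite_SigmaI) auto
  note bij = string_start_bij[of b L]
  \<comment> \<open>The strings form a basis of the hyperplane \<open>U\<close>, so their positions
    fill \<open>{..r}\<close> exactly.\<close>
  have "card ?S = Suc r"
    using basis_U_card[of "u ` ?S"] ind spU finS by (simp add: fs.indep_fam_def card_image)
  then have sL: "string_start b L = Suc r" using bij_betw_same_card[OF bij] by simp
  define g where "g = the_inv_into ?S ?f"
  have g: "bij_betw g {..r} ?S"
    using bij_betw_the_inv_into[OF bij] by (simp add: g_def sL lessThan_Suc_atMost)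
  have gf: "g (string_start b i + j) = (i, j)" if "i < L" "j \<le> b i" for i j
    using the_inv_into_f_f[OF bij_betw_imp_inj_on[OF bij], of "(i, j)"] that by (simp add: g_def)
  define u' where "u' p = u (g p)" for p
  define J' where "J' = ?f ` (SIGMA i:{..<l}. {..<b i})"
  have img: "u' ` {..r} = u ` ?S" using g by (simp add: u'_def image_image[symmetric] bij_betw_def)
  have "inj_on (u \<circ> g) {..r}"
    using g ind by (intro comp_inj_on) (auto simp: bij_betw_def fs.indep_fam_def)
  moreover have "u \<circ> g = u'" by (rule ext) (simp add: u'_def)
  ultimately have "inj_on u' {..r}" by (simp only:)
  then have "fs.indep_fam u' {..r}" using ind img by (simp add: fs.indep_fam_def)
  moreover have "fs.span (u' ` {..r}) = U" using img spU by simp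
  moreover have "u' ` J' = u ` (SIGMA i:{..<l}. {..<b i})"
  proof -
    have "u' (?f p) = u p" if "p \<in> (SIGMA i:{..<l}. {..<b i})" for p
      using that gf lb(1) by (auto simp: u'_def)
    then show ?thesis unfolding J'_def image_image by (intro image_cong) auto
  qed
  then have "fs.span (u' ` J') = W" using spW by simp
  moreover have "shift (u' j) = u' (Suc j)" if j: "j \<in> J'" for j
  proof -
    obtain i k where ik: "i < l" "k < b i" "j = string_start b i + k" using j by (auto simp: J'_def)
    have "u' (string_start b i + k) = u (i, k)" using ik lb(1) by (simp add: u'_def gf)
    moreover have "u' (string_start b i + Suc k) = u (i, Suc k)" using gf[of i "Suc k"] ik lb(1) by (simp add: u'_def)
    ultimately show ?thesis using sh ik by simp
  qed
  moreover have sc: "J' = {} \<or> (\<exists>n l a. scroll_data_ok r n l a \<and> J' = scroll_cols n l a)"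
  proof (cases "l = 0")
    case False
    then have "1 \<le> l" by simp
    moreover have "string_start b l \<le> Suc r" using string_start_mono[OF lb(1), of b] sL by simp
    ultimately show ?thesis
      using scroll_data_string_start[of l b r] lb(2) unfolding J'_def by blast
  qed (simp add: J'_def)
  moreover have "J' \<subseteq> {..<r}"
    using sc scroll_cols_lessThan by (fastforce simp: scroll_data_ok_def)
  ultimately show ?thesis by blast
qed

lemma dot_U_zero_iff:
  assumes "x \<in> affsp (Suc r)"
  shows "(\<forall>v\<in>U. dt v x = 0) \<longleftrightarrow> (\<exists>c. x = fscale c q)"
proof
  assume v: "\<forall>v\<in>U. dt v x = 0"
  obtain m where m: "m \<le> Suc r" "q m \<noteq> 0" "unit_vec m \<notin> U"
    "\<And>v. v \<in> affsp (Suc r) \<Longrightarrow> v - fscale (dt v q / q m) (unit_vec m) \<in> U" by (rule U_index) blast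
  have xi: "x i = x m / q m * q i" for i
  proof (cases "i \<le> Suc r")
    case True
    have "dt (unit_vec i - fscale (dt (unit_vec i) q / q m) (unit_vec m)) x = 0"
      using v m(4)[OF unit_vec_affsp[OF True]] by blast
    then show ?thesis
      using True m by (simp add: dot_diff_left dot_scale_left dot_unit_vec)
  next
    case False
    then show ?thesis using assms q_affsp by (simp add: affsp_def)
  qed
  have "x = fscale (x m / q m) q"
  proof
    fix i show "x i = fscale (x m / q m) q i" unfolding fscale_apply by (rule xi)
  qed
  then show "\<exists>c. x = fscale c q" by blast
qed (auto simp: U_def dot_scale_right)

text \<open>\<open>\<psi>\<close> and the map given by the basis \<open>u\<close> of
  \<open>U\<close> have the same kernel, the line of \<open>q\<close>, so they differ by an
  automorphism \<open>M\<close> of the target.\<close>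

lemma coordinates_exist:
  assumes ind: "fs.indep_fam u {..r}" and sp: "fs.span (u ` {..r}) = U"
  shows "\<exists>M. bij_betw (linmap r r M) (affsp r) (affsp r) \<and>
    (\<forall>x\<in>affsp (Suc r). linmap r r M (linmap (Suc r) r u x) = \<psi> x)"
    and "\<forall>y\<in>affsp r. \<exists>x\<in>affsp (Suc r). linmap (Suc r) r u x = y"
proof -
  let ?\<Theta> = "linmap (Suc r) r u"
  obtain m where m: "m \<le> Suc r" "q m \<noteq> 0" "unit_vec m \<notin> U"
    "\<And>v. v \<in> affsp (Suc r) \<Longrightarrow> v - fscale (dt v q / q m) (unit_vec m) \<in> U" by (rule U_index) blast
  \<comment> \<open>A form that is nonzero at \<open>q\<close> completes \<open>u\<close> to
    coordinates on the source, which yields surjectivity.\<close>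
  define u' where "u' = u(Suc r := unit_vec m)"
  have \<Theta>0: "(\<exists>c. x = fscale c q) \<longleftrightarrow> ?\<Theta> x = 0" if "x \<in> affsp (Suc r)" for x
  proof -
    have "?\<Theta> x = 0 \<longleftrightarrow> (\<forall>i\<le>r. dt (u i) x = 0)"
      by (auto simp: fun_eq_iff linmap_def dot_def)
    also have "\<dots> \<longleftrightarrow> u ` {..r} \<subseteq> {v. dt v x = 0}" by auto
    also have "\<dots> \<longleftrightarrow> U \<subseteq> {v. dt v x = 0}"
      using fs.span_minimal[OF _ subspace_dot, of "u ` {..r}" "Suc r" x] fs.span_superset[of "u ` {..r}"]
      unfolding sp by (meson subset_trans)
    finally show ?thesis using dot_U_zero_iff[OF that] by auto
  qed
  have bij': "bij_betw (linmap (Suc r) (Suc r) u') (affsp (Suc r)) (affsp (Suc r))"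
  proof (rule linmap_bij)
    fix x :: "nat \<Rightarrow> 'k" assume x: "x \<in> affsp (Suc r)" "linmap (Suc r) (Suc r) u' x = 0"
    have d: "dt (u' i) x = 0" if "i \<le> Suc r" for i
      using fun_cong[OF x(2), of i] that by (simp add: linmap_dot)
    have "dt (u i) x = 0" if "i \<le> r" for i using d[of i] that by (simp add: u'_def)
    then have "?\<Theta> x = 0" by (intro ext) (simp add: linmap_def dot_def)
    then obtain c where c: "x = fscale c q" using \<Theta>0[OF x(1)] by blast
    have "x m = 0" using d[of "Suc r"] m(1) by (simp add: u'_def dot_unit_vec)
    then show "x = 0" using c m(2) by (auto simp: fun_eq_iff)
  qed
  show surj: "\<forall>y\<in>affsp r. \<exists>x\<in>affsp (Suc r). ?\<Theta> x = y"
  proof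
    fix y :: "nat \<Rightarrow> 'k" assume y: "y \<in> affsp r"
    then have "y \<in> linmap (Suc r) (Suc r) u' ` affsp (Suc r)"
      using bij' affsp_mono[of r "Suc r"] by (auto simp: bij_betw_def)
    then obtain x where x: "x \<in> affsp (Suc r)" "y = linmap (Suc r) (Suc r) u' x" by blast
    have "?\<Theta> x i = y i" for i
    proof (cases "i \<le> r")
      case True
      then show ?thesis by (simp add: x linmap_dot u'_def)
    next
      case False
      then show ?thesis using y by (simp add: linmap_def affsp_def)
    qed
    then show "\<exists>x\<in>affsp (Suc r). ?\<Theta> x = y" using x(1) by blast
  qed
  define xs where "xs j = (SOME x. x \<in> affsp (Suc r) \<and> ?\<Theta> x = unit_vec j)" for j
  have xs: "xs j \<in> affsp (Suc r)" "?\<Theta> (xs j) = unit_vec j" if "j \<le> r" for j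
  proof -
    have "\<exists>x. x \<in> affsp (Suc r) \<and> ?\<Theta> x = unit_vec j" using surj unit_vec_affsp[OF that] by blast
    then have "xs j \<in> affsp (Suc r) \<and> ?\<Theta> (xs j) = unit_vec j" unfolding xs_def by (rule someI_ex)
    then show "xs j \<in> affsp (Suc r)" "?\<Theta> (xs j) = unit_vec j" by blast+
  qed
  define M where "M = (\<lambda>i j. \<psi> (xs j) i)"
  define X where "X y = (\<Sum>j\<le>r. fscale (y j) (xs j))" for y
  have Xa: "X y \<in> affsp (Suc r)" for y
    unfolding X_def by (intro fs.subspace_sum[OF subspace_affsp] fs.subspace_scale[OF subspace_affsp] xs) simp
  have MX: "linmap r r M y = \<psi> (X y)" for y
    unfolding M_def X_def linmap_sum by (rule linmap_columns) simp
  have \<Theta>X: "?\<Theta> (X y) = y" if "y \<in> affsp r" for y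
  proof -
    have "?\<Theta> (X y) = (\<Sum>j\<le>r. fscale (y j) (unit_vec j))"
      unfolding X_def linmap_sum by (intro sum.cong refl) (simp add: xs)
    then show ?thesis using affsp_expand[OF that] by simp
  qed
  have "bij_betw (linmap r r M) (affsp r) (affsp r)"
  proof (rule linmap_bij)
    fix y :: "nat \<Rightarrow> 'k" assume y: "y \<in> affsp r" "linmap r r M y = 0"
    then have "\<psi> (X y) = 0" by (simp add: MX)
    then have "?\<Theta> (X y) = 0" using kernel[OF Xa] \<Theta>0[OF Xa] by blast
    then show "y = 0" using \<Theta>X[OF y(1)] by simp
  qed
  moreover have "linmap r r M (?\<Theta> x) = \<psi> x" if x: "x \<in> affsp (Suc r)" for x
  proof -
    have a: "x - X (?\<Theta> x) \<in> affsp (Suc r)" using fs.subspace_diff[OF subspace_affsp x Xa] .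
    have "?\<Theta> (x - X (?\<Theta> x)) = 0" by (simp add: linmap_diff \<Theta>X)
    then have "\<psi> (x - X (?\<Theta> x)) = 0" using kernel[OF a] \<Theta>0[OF a] by blast
    then show ?thesis by (simp add: MX linmap_diff)
  qed
  ultimately show "\<exists>M. bij_betw (linmap r r M) (affsp r) (affsp r) \<and>
    (\<forall>x\<in>affsp (Suc r). linmap r r M (linmap (Suc r) r u x) = \<psi> x)" by blast
qed

lemma kernel_det_scroll: "x \<in> det_scroll (Suc r) J \<Longrightarrow> \<psi> x \<noteq> 0"
proof
  assume x: "x \<in> det_scroll (Suc r) J" "\<psi> x = 0"
  then have xa: "x \<in> affsp (Suc r)" "x \<noteq> 0" by (auto simp: det_scroll_def PP_iff)
  then obtain c where c: "x = fscale c q" using kernel x(2) by blast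
  then have "c \<noteq> 0" using xa(2) by (auto simp: fun_eq_iff)
  then have "q = fscale (1 / c) x" by (auto simp: c fun_eq_iff)
  then show False using det_scroll_scale[OF x(1), of "1 / c"] \<open>c \<noteq> 0\<close> q(2) by simp
qed

end

section \<open>The small scroll matrix in coordinates of the target\<close>

locale projected_scroll_basis = projected_scroll r J q P
  for r :: nat and J :: "nat set" and q :: "nat \<Rightarrow> 'k::field" and P :: "nat \<Rightarrow> nat \<Rightarrow> 'k" +
  fixes u :: "nat \<Rightarrow> nat \<Rightarrow> 'k" and J' :: "nat set" and M N :: "nat \<Rightarrow> nat \<Rightarrow> 'k"
  assumes ind: "fs.indep_fam u {..r}" and span_U: "fs.span (u ` {..r}) = U"
    and span_W: "fs.span (u ` J') = W" and shift_u: "\<And>j. j \<in> J' \<Longrightarrow> shift (u j) = u (Suc j)"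
    and J': "J' \<subseteq> {..<r}"
    and M: "bij_betw (linmap r r M) (affsp r) (affsp r)"
    and M_coord: "\<And>x. x \<in> affsp (Suc r) \<Longrightarrow> linmap r r M (linmap (Suc r) r u x) = \<psi> x"
    and surj: "\<And>y. y \<in> affsp r \<Longrightarrow> \<exists>x\<in>affsp (Suc r). linmap (Suc r) r u x = y"
    and NM: "\<And>x. x \<in> affsp r \<Longrightarrow> linmap r r N (linmap r r M x) = x"
    and MN: "\<And>y. y \<in> affsp r \<Longrightarrow> linmap r r M (linmap r r N y) = y"
begin

abbreviation \<Theta> :: "(nat \<Rightarrow> 'k) \<Rightarrow> nat \<Rightarrow> 'k" where "\<Theta> \<equiv> linmap (Suc r) r u"

abbreviation X :: "(nat \<Rightarrow> 'k) set" where "X \<equiv> \<psi> ` det_scroll (Suc r) J"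

abbreviation Y :: "(nat \<Rightarrow> 'k) set" where "Y \<equiv> linmap r r M ` det_scroll r J'"

lemma u_W: "j \<in> J' \<Longrightarrow> u j \<in> W"
  using span_W fs.span_superset by blast

lemma det_scroll_affsp: "x \<in> det_scroll s K \<Longrightarrow> x \<in> affsp s"
  by (simp add: det_scroll_def PP_def)

lemma M_zero: "x \<in> affsp r \<Longrightarrow> linmap r r M x = 0 \<Longrightarrow> x = 0"
  using NM[of x] by (metis linmap_zero)

text \<open>The columns of the small matrix are combinations of those of the large one, so their
  minors vanish on the scroll. This gives the inclusion of \<open>X\<close> in
  \<open>Y\<close>.\<close>

lemma coord_det_scroll:
  assumes x: "x \<in> det_scroll (Suc r) J"
  shows "\<Theta> x \<in> det_scroll r J'"
proof -
  have "\<Theta> x \<noteq> 0"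
    using kernel_det_scroll[OF x] M_coord[OF det_scroll_affsp[OF x]] by (metis linmap_zero)
  then have "\<Theta> x \<in> PP r" by (simp add: PP_iff)
  moreover have "\<Theta> x i * \<Theta> x (Suc j) = \<Theta> x j * \<Theta> x (Suc i)" if ij: "i \<in> J'" "j \<in> J'" for i j
  proof -
    have le: "i \<le> r" "Suc i \<le> r" "j \<le> r" "Suc j \<le> r" using ij J' by auto
    have "dt (u i) x * dt (shift (u j)) x = dt (u j) x * dt (shift (u i)) x"
      using u_W[OF ij(1)] u_W[OF ij(2)] by (intro dot_minor[OF J _ _ x]) (auto simp: W_def)
    then show ?thesis using le by (simp add: linmap_dot shift_u ij)
  qed
  ultimately show ?thesis by (simp add: det_scroll_def)
qed

lemma X_subset_Y: "X \<subseteq> Y"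
proof
  fix y assume "y \<in> X"
  then obtain x where x: "x \<in> det_scroll (Suc r) J" "y = \<psi> x" by blast
  then have "y = linmap r r M (\<Theta> x)" using M_coord[OF det_scroll_affsp[OF x(1)]] by simp
  then show "y \<in> Y" using coord_det_scroll[OF x(1)] by blast
qed

lemma indep_subfamily:
  assumes "fs.indep_fam g I" "K \<subseteq> I"
  shows "fs.independent (g ` K)" "card (g ` K) = card K"
proof -
  show "fs.independent (g ` K)" using assms by (meson fs.indep_fam_def fs.independent_mono image_mono)
  have "inj_on g K" using assms by (meson fs.indep_fam_def inj_on_subset)
  then show "card (g ` K) = card K" by (rule card_image)
qed

lemma indep_cols: "fs.independent (u ` J')" "inj_on u J'"
proof -
  have sub: "J' \<subseteq> {..r}" using J' by auto
  show "inj_on u J'" using ind sub by (auto simp: fs.indep_fam_def intro: inj_on_subset)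
  show "fs.independent (u ` J')"
    using ind sub by (meson fs.indep_fam_def fs.independent_mono image_mono)
qed

lemma finite_J': "finite J'"
  using J' finite_subset by blast

lemma colspace_decomp:
  assumes w: "w1 \<in> colspace J" "w2 \<in> colspace J" "dt w1 q = 1" "dt (shift w1) q = 0"
    "dt w2 q = 0" "dt (shift w2) q = 1" and v: "v \<in> colspace J"
  shows "v - fscale (dt v q) w1 - fscale (dt (shift v) q) w2 \<in> W"
proof -
  have "v - fscale (dt v q) w1 - fscale (dt (shift v) q) w2 \<in> colspace J"
    using w v by (simp add: colspace_def)
  then show ?thesis
    using w by (simp add: W_def dot_diff_left dot_scale_left shift_diff shift_scale)
qed

text \<open>\<open>w1\<close> and \<open>w2\<close> complement \<open>W\<close> in the space of
  columns: their values at \<open>q\<close> make them independent modulo \<open>W\<close>, and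
  subtracting multiples of them makes any column vanish there.\<close>

lemma card_cols: "card J' + 2 = card J"
proof -
  obtain w1 w2 where w: "w1 \<in> colspace J" "w2 \<in> colspace J" "dt w1 q = 1" "dt (shift w1) q = 0"
    "dt w2 q = 0" "dt (shift w2) q = 1" by (rule section_vectors)
  have w2: "w2 \<notin> W" using w by (simp add: W_def)
  have w1: "w1 \<notin> fs.span (insert w2 (u ` J'))"
  proof
    assume "w1 \<in> fs.span (insert w2 (u ` J'))"
    then obtain c where "w1 - fscale c w2 \<in> W" unfolding fs.span_insert span_W by blast
    then have "dt (w1 - fscale c w2) q = 0" by (simp add: W_def)
    then show False using w by (simp add: dot_diff_left dot_scale_left)
  qed
  let ?B = "insert w1 (insert w2 (u ` J'))"
  have fin: "finite ?B" using finite_J' by simp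
  have "fs.independent (insert w2 (u ` J'))" using indep_cols(1) w2 span_W by (simp add: fs.independent_insert)
  then have ind_B: "fs.independent ?B" using w1 fs.span_base[of w1 "insert w2 (u ` J')"] by (auto simp: fs.independent_insert)
  have "w2 \<notin> u ` J'" using w2 u_W by blast
  moreover have "w1 \<notin> insert w2 (u ` J')" using w1 fs.span_base[of w1 "insert w2 (u ` J')"] by blast
  ultimately have card_B: "card ?B = card J' + 2" using finite_J' indep_cols(2) by (simp add: card_image)
  have card_E: "card (unit_vec ` J :: (nat \<Rightarrow> 'k) set) = card J" and ind_E: "fs.independent (unit_vec ` J :: (nat \<Rightarrow> 'k) set)"
  proof -
    have "J \<subseteq> {..Suc r}" using J by auto
    note indep_subfamily[OF indep_unit_vec this]
    then show "card (unit_vec ` J :: (nat \<Rightarrow> 'k) set) = card J" "fs.independent (unit_vec ` J :: (nat \<Rightarrow> 'k) set)"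
      by simp_all
  qed
  have "?B \<subseteq> fs.span (unit_vec ` J)"
  proof
    fix v assume "v \<in> ?B"
    then have v: "v \<in> colspace J" using w u_W by (auto simp: W_def)
    have "v = (\<Sum>i\<in>J. fscale (v i) (unit_vec i))"
    proof
      fix j show "v j = (\<Sum>i\<in>J. fscale (v i) (unit_vec i)) j"
        using v finite_J unfolding sum_fun_apply fscale_apply by (subst sum_unit_vec) (auto simp: colspace_def)
    qed
    then show "v \<in> fs.span (unit_vec ` J)" using fs.sum_in_span[of J unit_vec "unit_vec ` J" v] by simp
  qed
  then have 1: "card J' + 2 \<le> card J"
    using fs.independent_span_bound[OF finite_imageI[OF finite_J] ind_B] card_B card_E by metis
  have "unit_vec ` J \<subseteq> fs.span ?B"
  proof
    fix v :: "nat \<Rightarrow> 'k" assume "v \<in> unit_vec ` J"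
    then have "v \<in> colspace J" by (auto simp: colspace_def unit_vec_def)
    then have "v - fscale (dt v q) w1 - fscale (dt (shift v) q) w2 \<in> fs.span (u ` J')"
      using colspace_decomp[OF w] span_W by simp
    then show "v \<in> fs.span ?B" unfolding fs.span_insert by blast
  qed
  then have "card J \<le> card J' + 2"
    using fs.independent_span_bound[OF fin ind_E] card_B card_E by metis
  with 1 show ?thesis by simp
qed

text \<open>Compares the spans of the entries, of dimensions \<open>n' + 1\<close> and
  \<open>n + 1\<close>. The vertices have dimensions \<open>r - n' - 1\<close> and
  \<open>r - n\<close>, so these inequalities become the bounds \<open>h\<close> and
  \<open>h + 3\<close>.\<close>

lemma vertex_bounds:
  assumes n: "J \<union> Suc ` J = {..n}" and n': "J' \<union> Suc ` J' = {..n'}"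
  shows "n' + 1 \<le> n" "n \<le> n' + 4"
proof -
  have n'r: "n' \<le> r"
  proof -
    have "n' \<in> J' \<union> Suc ` J'" using n' by simp
    then show ?thesis using J' by auto
  qed
  have Jn: "J \<subseteq> {..<n}"
  proof
    fix j assume "j \<in> J"
    then have "Suc j \<in> {..n}" using n by blast
    then show "j \<in> {..<n}" by simp
  qed
  have col: "w \<in> affsp n" "shift w \<in> affsp n" if "w \<in> colspace J" for w :: "nat \<Rightarrow> 'k"
    using that Jn by (auto simp: colspace_def affsp_def shift_def split: nat.split)
  have uc: "u p \<in> U \<and> (u p \<in> affsp n)" if p: "p \<le> n'" for p
  proof -
    have "p \<in> J' \<union> Suc ` J'" using n' p by simp
    then consider "p \<in> J'" | p' where "p' \<in> J'" "p = Suc p'" by blast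
    then show ?thesis
    proof cases
      case 1
      then show ?thesis using u_W[OF 1] W_sub_U col by (auto simp: W_def)
    next
      case 2
      then have "u p = shift (u p')" "u p' \<in> W" using shift_u u_W by auto
      then show ?thesis using shift_W col by (auto simp: W_def)
    qed
  qed
  have sub: "{..n'} \<subseteq> {..r}" using n'r by simp
  have ind': "fs.independent (u ` {..n'})" "card (u ` {..n'}) = Suc n'"
    using indep_subfamily[OF ind sub] by simp_all
  show "n' + 1 \<le> n"
  proof -
    obtain i j where ij: "i \<in> J" "j \<in> J" "q i * q (Suc j) \<noteq> q j * q (Suc i)" by (rule q_minor)
    then have "q i \<noteq> 0 \<or> q j \<noteq> 0" by auto
    \<comment> \<open>An entry of the large matrix that is nonzero at the centre is independent of
      the small entries, which all vanish there.\<close>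
    then obtain m where m: "m \<in> J \<union> Suc ` J" "q m \<noteq> 0" using ij by blast
    have "m \<in> {..n}" unfolding n[symmetric] by (rule m(1))
    moreover have "m \<le> Suc r" using m(1) J by auto
    ultimately have mn: "m \<le> n" "m \<le> Suc r" by auto
    have "unit_vec m \<notin> fs.span (u ` {..n'})"
    proof
      assume "unit_vec m \<in> fs.span (u ` {..n'})"
      also have "\<dots> \<subseteq> U" using uc by (intro fs.span_minimal subspace_U) auto
      finally show False using m(2) dot_unit_vec[OF mn(2), of q] by (simp add: U_def)
    qed
    then have "fs.independent (insert (unit_vec m) (u ` {..n'}))" using ind' by (simp add: fs.independent_insert)
    moreover have "insert (unit_vec m) (u ` {..n'}) \<subseteq> fs.span (unit_vec ` {..n})"
      using uc affsp_subset_span[of n] unit_vec_affsp[OF mn(1)] by auto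
    ultimately have "card (insert (unit_vec m) (u ` {..n'})) \<le> card (unit_vec ` {..n} :: (nat \<Rightarrow> 'k) set)"
      using fs.independent_span_bound by blast
    also have "\<dots> \<le> Suc n" by (rule card_unit_vecs)
    finally have "card (insert (unit_vec m) (u ` {..n'})) \<le> Suc n" .
    moreover have "unit_vec m \<notin> u ` {..n'}"
      using \<open>unit_vec m \<notin> fs.span (u ` {..n'})\<close> fs.span_base[of "unit_vec m" "u ` {..n'}"] by blast
    ultimately show ?thesis using ind'(2) by simp
  qed
  show "n \<le> n' + 4"
  proof -
    obtain w1 w2 where w: "w1 \<in> colspace J" "w2 \<in> colspace J" "dt w1 q = 1" "dt (shift w1) q = 0"
      "dt w2 q = 0" "dt (shift w2) q = 1" by (rule section_vectors)
    \<comment> \<open>Every column lies in \<open>W\<close> up to multiples of \<open>w1\<close> and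
      \<open>w2\<close>, so besides the small entries only the four entries of these two columns are
      needed.\<close>
    let ?T = "insert w1 (insert w2 (insert (shift w1) (insert (shift w2) (u ` {..n'}))))"
    have cT: "card ?T \<le> n' + 5"
      using ind'(2) by (auto intro!: order_trans[OF card_insert_le_m1] order_trans[OF card_insert_le] simp: card_insert_if)
    have base: "v \<in> fs.span ?T" if "v \<in> ?T" for v using that by (rule fs.span_base)
    have WT: "v \<in> fs.span ?T \<and> shift v \<in> fs.span ?T" if v: "v \<in> W" for v
    proof -
      have "v \<in> fs.span (u ` J')" using v span_W by simp
      then show ?thesis
      proof (induction rule: fs.span_induct_alt)
        case base
        show ?case unfolding shift_zero using fs.span_zero by blast
      next
        case (step c x y)
        obtain p where p: "p \<in> J'" "x = u p" using step(1) by blast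
        then have "p \<in> {..n'}" "Suc p \<in> {..n'}" using n' by blast+
        then have "x \<in> fs.span ?T" "shift x \<in> fs.span ?T"
          using p shift_u[OF p(1)] by (auto intro!: fs.span_base)
        then show ?case unfolding shift_add shift_scale
          by (intro conjI fs.span_add fs.span_scale conjunct1[OF step.IH] conjunct2[OF step.IH])
      qed
    qed
    have VT: "v \<in> fs.span ?T \<and> shift v \<in> fs.span ?T" if v: "v \<in> colspace J" for v
    proof -
      define x where "x = v - fscale (dt v q) w1 - fscale (dt (shift v) q) w2"
      have x: "x \<in> W" unfolding x_def by (rule colspace_decomp[OF w v])
      have v_eq: "v = x + fscale (dt v q) w1 + fscale (dt (shift v) q) w2" by (simp add: x_def)
      have "v \<in> fs.span ?T"
        by (subst v_eq) (intro fs.span_add fs.span_scale conjunct1[OF WT[OF x]] base; simp)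
      moreover have sv: "shift v = shift x + fscale (dt v q) (shift w1) + fscale (dt (shift v) q) (shift w2)"
        by (subst v_eq) (simp only: shift_add shift_scale)
      have "shift v \<in> fs.span ?T"
        by (subst sv) (intro fs.span_add fs.span_scale conjunct2[OF WT[OF x]] base; simp)
      ultimately show ?thesis by blast
    qed
    have shift_unit: "shift (unit_vec j) = (unit_vec (Suc j) :: nat \<Rightarrow> 'k)" for j
      by (rule ext) (simp add: shift_def unit_vec_def split: nat.split)
    have "unit_vec ` {..n} \<subseteq> fs.span ?T"
    proof
      fix v :: "nat \<Rightarrow> 'k" assume "v \<in> unit_vec ` {..n}"
      then obtain i where i: "i \<in> J \<union> Suc ` J" "v = unit_vec i" using n by blast
      have cs: "(unit_vec j :: nat \<Rightarrow> 'k) \<in> colspace J" if "j \<in> J" for j using that by (auto simp: colspace_def unit_vec_def)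
      show "v \<in> fs.span ?T"
      proof (cases "i \<in> J")
        case True
        then show ?thesis using VT[OF cs] i(2) by blast
      next
        case False
        then obtain j where "j \<in> J" "i = Suc j" using i(1) by blast
        then show ?thesis using VT[OF cs[of j]] i(2) shift_unit[of j] by simp
      qed
    qed
    then have "card (unit_vec ` {..n} :: (nat \<Rightarrow> 'k) set) \<le> card ?T"
      using fs.independent_span_bound[of ?T "unit_vec ` {..n}"] indep_unit_vec[of n, where 'k = 'k]
      by (auto simp: fs.indep_fam_def)
    moreover have "card (unit_vec ` {..n} :: (nat \<Rightarrow> 'k) set) = Suc n"
      using indep_unit_vec[of n, where 'k = 'k] by (simp add: fs.indep_fam_def card_image)
    ultimately show ?thesis using cT by simp
  qed
qed

lemma X_PP: "X \<subseteq> PP r"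
  using kernel_det_scroll by (auto simp: PP_iff)

lemma inj_ruling:
  assumes "x \<in> affsp (Suc r)" "\<And>j. j \<in> J \<Longrightarrow> x (Suc j) = 0" "\<psi> x = 0"
  shows "x = 0"
proof (rule ccontr)
  assume "x \<noteq> 0"
  then have "x \<in> det_scroll (Suc r) J"
    using assms by (intro det_scrollI[where \<tau> = 0]) (auto simp: PP_iff)
  then show False using kernel_det_scroll assms(3) by blast
qed

text \<open>Nondegeneracy excludes that \<open>X\<close> is only the image of the ruling
  \<open>x (Suc j) = 0\<close>, a linear space contained in a hyperplane.\<close>

lemma dim_X:
  assumes cl: "closed_proj r X" and nondeg: "nondegenerate r X"
  shows "dim_proj r X = int (r + 2) - int (card J)"
proof -
  let ?R = "{x \<in> affsp (Suc r). x \<noteq> 0 \<and> (\<forall>j\<in>J. x (Suc j) = 0)}"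
  have cJ: "card J \<ge> 2" using card_cols by simp
  have "X \<noteq> \<psi> ` ?R"
  proof
    assume eq: "X = \<psi> ` ?R"
    define H where "H = {..Suc r} - Suc ` J"
    have finH: "finite H" by (simp add: H_def)
    have sub: "Suc ` J \<subseteq> {..Suc r}" using J by auto
    have "card (Suc ` J) = card J" by (rule card_image) simp
    then have "card H = Suc (Suc r) - card J"
      using card_Diff_subset[OF finite_imageI[OF finite_J] sub] by (simp add: H_def)
    then have cH: "card H < Suc r" using cJ by simp
    \<comment> \<open>\<open>g i\<close> is the \<open>i\<close>-th target coordinate restricted to
      the ruling. These are \<open>r + 1\<close> forms in fewer variables, so a nontrivial
      combination of the coordinates vanishes on the image.\<close>
    define g where "g i = (\<lambda>h. if h \<in> H then \<psi> (unit_vec h) i else 0)" for i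
    have "g i \<in> fs.span (unit_vec ` H)" for i
    proof -
      have "g i = (\<Sum>h\<in>H. fscale (g i h) (unit_vec h))"
      proof
        fix j show "g i j = (\<Sum>h\<in>H. fscale (g i h) (unit_vec h)) j"
          unfolding sum_fun_apply fscale_apply using finH by (subst sum_unit_vec) (auto simp: g_def)
      qed
      then show ?thesis using fs.sum_in_span[of H unit_vec "unit_vec ` H" "g i"] by simp
    qed
    moreover have "card (unit_vec ` H :: (nat \<Rightarrow> 'k) set) < card {..r}"
      using le_less_trans[OF card_image_le[OF finH, of "unit_vec :: nat \<Rightarrow> nat \<Rightarrow> 'k"] cH] by simp
    ultimately obtain c where c: "\<exists>i\<le>r. c i \<noteq> 0" "(\<Sum>i\<le>r. fscale (c i) (g i)) = 0"
      using fs.nontrivial_relation[of "{..r}" "unit_vec ` H" g] finH by auto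
    define f where "f = (\<Sum>i\<le>r. const (c i) * var i)"
    have f_eval: "eval f y = (\<Sum>i\<le>r. c i * y i)" for y by (simp add: f_def eval_simps)
    have "eval f (\<psi> x) = 0" if x: "x \<in> ?R" for x
    proof -
      have "x = (\<Sum>h\<in>H. fscale (x h) (unit_vec h))"
      proof
        fix j
        have "x j = 0" if "j \<notin> H" using that x by (auto simp: H_def affsp_def)
        then show "x j = (\<Sum>h\<in>H. fscale (x h) (unit_vec h)) j"
          unfolding sum_fun_apply fscale_apply using finH by (subst sum_unit_vec) auto
      qed
      then have "\<psi> x = (\<Sum>h\<in>H. fscale (x h) (\<psi> (unit_vec h)))" by (metis linmap_sum)
      then have "\<psi> x i = (\<Sum>h\<in>H. x h * g i h)" for i by (simp add: g_def)
      then have "eval f (\<psi> x) = (\<Sum>i\<le>r. \<Sum>h\<in>H. x h * (c i * g i h))"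
        by (simp add: f_eval sum_distrib_left algebra_simps)
      also have "\<dots> = (\<Sum>h\<in>H. \<Sum>i\<le>r. x h * (c i * g i h))" by (rule sum.swap)
      also have "\<dots> = (\<Sum>h\<in>H. x h * (\<Sum>i\<le>r. c i * g i h))" by (simp add: sum_distrib_left)
      also have "\<dots> = 0"
      proof (intro sum.neutral ballI)
        fix h
        have "(\<Sum>i\<le>r. c i * g i h) = 0" using fun_cong[OF c(2), of h] by simp
        then show "x h * (\<Sum>i\<le>r. c i * g i h) = 0" by simp
      qed
      finally show ?thesis .
    qed
    then have "\<forall>y\<in>X. eval f y = 0" unfolding eq by blast
    moreover have "f \<in> polys r" unfolding f_def polys_eq_vpolys by (auto intro!: vpolys_sum vpolys_mult)
    moreover have "homog_of_deg (0 + Suc 0) f" unfolding f_def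
      by (intro homog_of_deg_sum homog_of_deg_mult homog_of_deg_const homog_of_deg_var)
    ultimately have "f = 0" using nondeg by (simp add: nondegenerate_def van_ideal_def)
    obtain i where i: "i \<le> r" "c i \<noteq> 0" using c(1) by blast
    have "eval f (unit_vec i) = (\<Sum>k\<le>r. if k = i then c i else 0)"
      unfolding f_eval by (intro sum.cong) (auto simp: unit_vec_def)
    then show False using \<open>f = 0\<close> i by simp
  qed
  moreover have "J \<noteq> {}" using cJ by auto
  ultimately have "dim_proj r X = int (Suc r + 1) - int (card J)"
    using inj_ruling by (intro dim_proj_image_det_scroll[OF inf J _ cl]) auto
  then show ?thesis by simp
qed

lemma dim_Y:
  assumes "J' \<noteq> {}"
  shows "dim_proj r Y = int (r + 1) - int (card J')"
proof (rule dim_proj_image_det_scroll[OF inf J' assms])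
  define l where "l i = (\<Sum>j\<le>r. const (N i j) * var j)" for i
  have l: "eval (l i) y = linmap r r N y i" if "i \<le> r" for i y
    using that by (simp add: l_def eval_simps linmap_def)
  have l_poly: "l i \<in> polys r" for i unfolding l_def polys_eq_vpolys by (auto intro!: vpolys_sum vpolys_mult)
  have l_hom: "homog_of_deg 1 (l i)" for i
  proof -
    have "homog_of_deg (0 + Suc 0) (l i)" unfolding l_def
      by (intro homog_of_deg_sum homog_of_deg_mult homog_of_deg_const homog_of_deg_var)
    then show ?thesis by simp
  qed
  \<comment> \<open>The minors, pulled back by the inverse coordinate change \<open>N\<close>, are
    equations of \<open>Y\<close>.\<close>
  define F where "F = (\<lambda>(i, j). l i * l (Suc j) - l j * l (Suc i)) ` (J' \<times> J')"
  have "Y = zero_set r F"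
  proof (intro equalityI subsetI)
    fix y assume "y \<in> Y"
    then obtain x where x: "x \<in> det_scroll r J'" "y = linmap r r M x" by blast
    have Ny: "linmap r r N y = x" using NM x det_scroll_affsp by metis
    have "x \<noteq> 0" using x by (auto simp: det_scroll_def PP_iff)
    then have "y \<noteq> 0" using x M_zero det_scroll_affsp by metis
    then have "y \<in> PP r" using x by (simp add: PP_iff)
    moreover have "eval f y = 0" if f: "f \<in> F" for f
    proof -
      obtain i j where ij: "i \<in> J'" "j \<in> J'" "f = l i * l (Suc j) - l j * l (Suc i)" using f by (auto simp: F_def)
      then have "i \<le> r" "Suc i \<le> r" "j \<le> r" "Suc j \<le> r" using J' by auto
      moreover have "x i * x (Suc j) = x j * x (Suc i)" using x(1) ij by (simp add: det_scroll_def)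
      ultimately show ?thesis by (simp add: ij(3) eval_simps l Ny)
    qed
    ultimately show "y \<in> zero_set r F" by (simp add: zero_set_def)
  next
    fix y assume y: "y \<in> zero_set r F"
    then have yP: "y \<in> affsp r" "y \<noteq> 0" by (auto simp: zero_set_def PP_iff)
    have "linmap r r N y \<noteq> 0" using MN[OF yP(1)] yP(2) by (metis linmap_zero)
    then have "linmap r r N y \<in> PP r" by (simp add: PP_iff)
    moreover have "linmap r r N y i * linmap r r N y (Suc j) = linmap r r N y j * linmap r r N y (Suc i)"
      if ij: "i \<in> J'" "j \<in> J'" for i j
    proof -
      have "i \<le> r" "Suc i \<le> r" "j \<le> r" "Suc j \<le> r" using ij J' by auto
      moreover have "eval (l i * l (Suc j) - l j * l (Suc i)) y = 0"
        using y ij by (auto simp: zero_set_def F_def)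
      ultimately show ?thesis by (simp add: eval_simps l)
    qed
    ultimately have "linmap r r N y \<in> det_scroll r J'" by (simp add: det_scroll_def)
    then show "y \<in> Y" using MN[OF yP(1)] by (metis imageI)
  qed
  moreover have "f \<in> polys r \<and> homog f" if f: "f \<in> F" for f
  proof -
    obtain i j where ij: "f = l i * l (Suc j) - l j * l (Suc i)" using f by (auto simp: F_def)
    have "homog_of_deg (1 + 1) f" unfolding ij by (intro homog_of_deg_diff homog_of_deg_mult l_hom)
    then show ?thesis using l_poly unfolding homog_def ij polys_eq_vpolys by blast
  qed
  ultimately show "closed_proj r Y" unfolding closed_proj_def by (intro exI[of _ F]) auto
next
  fix x assume "x \<in> affsp r" "linmap r r M x = 0"
  then show "x = 0" by (rule M_zero)
next
  \<comment> \<open>The point with all coordinates 1 lies on the scroll but not in the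
    ruling.\<close>
  let ?o = "\<lambda>i. if i \<le> r then 1 else 0 :: 'k"
  have o: "?o \<in> det_scroll r J'" by (rule ones_in_det_scroll[OF J'])
  obtain j where j: "j \<in> J'" using assms by blast
  have "linmap r r M ?o \<notin> linmap r r M ` {x \<in> affsp r. x \<noteq> 0 \<and> (\<forall>j\<in>J'. x (Suc j) = 0)}"
  proof
    assume "linmap r r M ?o \<in> linmap r r M ` {x \<in> affsp r. x \<noteq> 0 \<and> (\<forall>j\<in>J'. x (Suc j) = 0)}"
    then obtain x where x: "x \<in> affsp r" "\<forall>j\<in>J'. x (Suc j) = 0" "linmap r r M ?o = linmap r r M x" by blast
    have "?o = x" using inj_onD[OF bij_betw_imp_inj_on[OF M], of ?o x] x(3) det_scroll_affsp[OF o] x(1) by blast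
    then have "?o (Suc j) = 0" using x(2) j by blast
    moreover have "Suc j \<le> r" using j J' by auto
    ultimately show False by simp
  qed
  then show "Y \<noteq> linmap r r M ` {x \<in> affsp r. x \<noteq> 0 \<and> (\<forall>j\<in>J'. x (Suc j) = 0)}" using o by blast
qed

text \<open>Without small columns the large matrix has just two, and the scroll is a quadric that
  misses the centre. Over an algebraically closed field every line through the centre meets
  it.\<close>

lemma X_eq_PP:
  assumes ac: "alg_closed TYPE('k)" and "J' = {}"
  shows "X = PP r"
proof (intro equalityI subsetI)
  fix y :: "nat \<Rightarrow> 'k" assume y: "y \<in> PP r"
  then have ya: "y \<in> affsp r" "y \<noteq> 0" by (auto simp: PP_iff)
  obtain x0 where x0: "x0 \<in> affsp (Suc r)" "\<Theta> x0 = linmap r r N y" using surj[OF linmap_affsp] by blast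
  then have \<psi>x0: "\<psi> x0 = y" using M_coord[OF x0(1)] MN[OF ya(1)] by simp
  obtain i j where ij: "i \<in> J" "j \<in> J" "q i * q (Suc j) \<noteq> q j * q (Suc i)" by (rule q_minor)
  then have "i \<noteq> j" by auto
  then have "card {i, j} = card J" using card_cols \<open>J' = {}\<close> by simp
  then have Jij: "J = {i, j}" using ij card_subset_eq[OF finite_J, of "{i, j}"] by auto
  \<comment> \<open>The minor along the line \<open>x0 + t q\<close>; its quadratic coefficient is
    the minor at \<open>q\<close>, which is not zero.\<close>
  define m where "m = [:x0 i, q i:] * [:x0 (Suc j), q (Suc j):] - [:x0 j, q j:] * [:x0 (Suc i), q (Suc i):]"
  have "poly.coeff m 2 = q i * q (Suc j) - q j * q (Suc i)" by (simp add: m_def numeral_2_eq_2)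
  then have "poly.coeff m 2 \<noteq> 0" using ij(3) by simp
  then have "degree m \<ge> 2" by (rule le_degree)
  then obtain t where t: "poly m t = 0" using ac unfolding alg_closed_def by (metis Suc_1 Suc_leD One_nat_def)
  define x where "x = x0 + fscale t q"
  have xa: "x \<in> affsp (Suc r)"
    unfolding x_def by (intro fs.subspace_add[OF subspace_affsp] fs.subspace_scale[OF subspace_affsp] x0(1) q_affsp)
  have q0: "\<psi> q = 0" using kernel[OF q_affsp] by (metis fs.scale_one)
  have \<psi>x: "\<psi> x = y" unfolding x_def linmap_add linmap_scale q0 \<psi>x0 by (simp add: fun_eq_iff)
  then have "x \<noteq> 0" using ya(2) by (metis linmap_zero)
  then have "x \<in> PP (Suc r)" using xa by (simp add: PP_iff)
  moreover have "x i * x (Suc j) = x j * x (Suc i)"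
    using t by (simp add: m_def x_def algebra_simps)
  ultimately have "x \<in> det_scroll (Suc r) J" by (auto simp: det_scroll_def Jij)
  then show "y \<in> X" using \<psi>x by blast
qed (use X_PP in blast)

end

section \<open>Arithmetic depth\<close>

text \<open>Extracting one weight from an algebraic relation makes it homogeneous.\<close>
lemma (in homog_regular_seq) relation_on_subspace:
  fixes B :: "nat \<Rightarrow> nat \<Rightarrow> 'k"
  assumes inf: "infinite (UNIV :: 'k set)" and V: "finite V" "card V + 1 < t" and j: "j < t"
  shows "\<exists>Q. reg_poly r f (- {j}) t 0 Q \<and> (\<forall>v. eval Q (\<lambda>k. \<Sum>p\<in>V. B k p * v p) = 0)"
proof -
  define L where "L v = (\<lambda>k. \<Sum>p\<in>V. B k p * v p)" for v
  define d where "d i = (SOME d. homog_of_deg d (f i))" for i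
  have d: "homog_of_deg (d i) (f i)" if i: "i < t" for i
  proof -
    have "\<exists>d. homog_of_deg d (f i)" using f_homog[OF i] by blast
    then show ?thesis unfolding d_def by (rule someI_ex)
  qed
  \<comment> \<open>Leaving out member \<open>j\<close> still leaves more elements than the number
    \<open>card V\<close> of parameters.\<close>
  define A where "A = {..<t} - {j}"
  have A: "finite A" "card V < card A" using V j by (auto simp: A_def)
  define G where "G i = mpoly_subst (f i) (\<lambda>k. \<Sum>p\<in>V. const (B k p) * var p)" for i
  have G_eval: "eval (G i) v = eval (f i) (L v)" for i v
    unfolding G_def eval_mpoly_subst L_def by (simp add: eval_simps)
  have GV: "G i \<in> vpolys V" if i: "i \<in> A" for i
    unfolding G_def
  proof (rule mpoly_subst_vpolys)
    show "f i \<in> vpolys {..r}" using f_polys[of i] i by (simp add: A_def polys_eq_vpolys)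
  qed (auto intro!: vpolys_sum vpolys_mult)
  obtain K c where K: "finite K" "K \<noteq> {}" "\<forall>\<mu>\<in>K. c \<mu> \<noteq> 0 \<and> (\<forall>i. i \<notin> A \<longrightarrow> \<mu> i = 0)"
    "\<forall>y. (\<Sum>\<mu>\<in>K. c \<mu> * (\<Prod>i\<in>A. eval (G i) y ^ \<mu> i)) = 0"
    using algebraically_dependent[of V A G] V(1) A GV by blast
  define T where "T v \<mu> = (\<Prod>i\<in>A. eval (f i) (L v) ^ \<mu> i)" for v \<mu>
  define wt where "wt \<mu> = (\<Sum>i\<in>A. \<mu> i * d i)" for \<mu>
  obtain \<mu>0 where \<mu>0: "\<mu>0 \<in> K" using K(2) by blast
  define e where "e = wt \<mu>0"
  define K' where "K' = {\<mu>\<in>K. wt \<mu> = e}"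
  have T_scale: "T (\<lambda>p. s * v p) \<mu> = s ^ wt \<mu> * T v \<mu>" for s v \<mu>
  proof -
    have "L (\<lambda>p. s * v p) = (\<lambda>k. s * L v k)" by (simp add: L_def sum_distrib_left algebra_simps)
    then have "eval (f i) (L (\<lambda>p. s * v p)) = s ^ d i * eval (f i) (L v)" if "i \<in> A" for i
      using eval_scale[OF d[of i], of s "L v"] that by (simp add: A_def)
    then have "T (\<lambda>p. s * v p) \<mu> = (\<Prod>i\<in>A. s ^ (\<mu> i * d i) * eval (f i) (L v) ^ \<mu> i)"
      unfolding T_def by (intro prod.cong) (auto simp: power_mult_distrib mult.commute simp flip: power_mult)
    then show ?thesis by (simp add: T_def wt_def prod.distrib power_sum)
  qed
  have rel: "(\<Sum>\<mu>\<in>K'. c \<mu> * T v \<mu>) = 0" for v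
  proof -
    \<comment> \<open>The relation at the point \<open>s * v\<close> as a polynomial in
      \<open>s\<close>; its coefficient at \<open>s ^ e\<close> is the part of weight
      \<open>e\<close>.\<close>
    let ?q = "\<Sum>\<mu>\<in>K. monom (c \<mu> * T v \<mu>) (wt \<mu>)"
    have "poly ?q s = (\<Sum>\<mu>\<in>K. c \<mu> * T (\<lambda>p. s * v p) \<mu>)" for s
      unfolding poly_sum by (intro sum.cong refl) (simp add: poly_monom T_scale)
    also have "(\<Sum>\<mu>\<in>K. c \<mu> * T (\<lambda>p. s * v p) \<mu>) = 0" for s
      using K(4) by (simp add: T_def G_eval)
    finally have "?q = 0" using poly_zero_if_vanishes[OF inf, of "{}" ?q] by simp
    then have "0 = poly.coeff ?q e" by simp
    also have "\<dots> = (\<Sum>\<mu>\<in>K. if wt \<mu> = e then c \<mu> * T v \<mu> else 0)"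
      unfolding coeff_sum by (intro sum.cong) auto
    also have "\<dots> = (\<Sum>\<mu>\<in>K'. c \<mu> * T v \<mu>)"
      unfolding K'_def using K(1) by (simp add: sum.inter_filter)
    finally show ?thesis by simp
  qed
  define Q where "Q = (\<Sum>\<mu>\<in>K'. const (c \<mu>) * (\<Prod>i\<in>{0..<0 + t}. f i ^ \<mu> i))"
  have j0: "\<mu> j = 0" if "\<mu> \<in> K'" for \<mu> using that K(3) by (auto simp: K'_def A_def)
  have ins: "{0..<0 + t} = insert j A" "j \<notin> A" using j by (auto simp: A_def)
  have "reg_poly r f (- {j}) t 0 Q"
    unfolding Q_def
  proof (rule reg_poly_sum[where d = d and e = e])
    show "finite K'" "K' \<noteq> {}" using K(1) \<mu>0 by (auto simp: K'_def e_def)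
    show "c \<mu> \<noteq> 0" if "\<mu> \<in> K'" for \<mu> using that K(3) by (auto simp: K'_def)
    show "\<mu> i = 0" if "\<mu> \<in> K'" "i \<notin> {0..<0 + t} \<inter> - {j}" for \<mu> i
      using that K(3) by (auto simp: K'_def A_def)
    show "(\<Sum>i\<in>{0..<0 + t}. \<mu> i * d i) = e" if "\<mu> \<in> K'" for \<mu>
      unfolding ins(1) using ins(2) A(1) j0[OF that] that by (simp add: K'_def wt_def)
  qed (use d f_polys in auto)
  moreover have "eval Q (L v) = 0" for v
  proof -
    have "eval Q (L v) = (\<Sum>\<mu>\<in>K'. c \<mu> * T v \<mu>)"
      unfolding Q_def eval_sum
    proof (intro sum.cong refl)
      fix \<mu> assume "\<mu> \<in> K'"
      then show "eval (const (c \<mu>) * (\<Prod>i\<in>{0..<0 + t}. f i ^ \<mu> i)) (L v) = c \<mu> * T v \<mu>"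
        unfolding ins(1) using ins(2) A(1) by (simp add: eval_simps T_def j0)
    qed
    then show ?thesis using rel by simp
  qed
  ultimately show ?thesis unfolding L_def by blast
qed

section \<open>Functions on the scroll that come from the coordinate ring of
  \<open>X\<close>\<close>

context projected_scroll_basis
begin

text \<open>Membership in the coordinate ring \<open>A\<close> of \<open>X\<close>, viewed inside
  the functions on the cone over the scroll; only values on the scroll count.\<close>

definition regular_fun :: "((nat \<Rightarrow> 'k) \<Rightarrow> 'k) \<Rightarrow> bool" where
  "regular_fun F \<longleftrightarrow> (\<exists>f\<in>polys r. \<forall>x\<in>det_scroll (Suc r) J. F x = eval f (\<psi> x))"

lemma regular_fun_cong:
  "regular_fun F \<Longrightarrow> (\<And>x. x \<in> det_scroll (Suc r) J \<Longrightarrow> G x = F x) \<Longrightarrow> regular_fun G"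
  by (auto simp: regular_fun_def)

lemma regular_fun_eval: "f \<in> polys r \<Longrightarrow> regular_fun (\<lambda>x. eval f (\<psi> x))"
  by (auto simp: regular_fun_def)

lemma regular_fun_const: "regular_fun (\<lambda>_. c)"
  using regular_fun_eval[of "const c"] by (simp add: polys_eq_vpolys)

lemma regular_fun_coord: "regular_fun (\<lambda>x. \<psi> x k)"
proof (cases "k \<le> r")
  case True
  then show ?thesis using regular_fun_eval[of "var k"] by (simp add: polys_eq_vpolys)
next
  case False
  then show ?thesis using regular_fun_const[of 0] by (simp add: linmap_def)
qed

lemma regular_fun_add: "regular_fun F \<Longrightarrow> regular_fun G \<Longrightarrow> regular_fun (\<lambda>x. F x + G x)"
  unfolding regular_fun_def polys_eq_vpolys by (metis eval_add vpolys_add)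

lemma regular_fun_diff: "regular_fun F \<Longrightarrow> regular_fun G \<Longrightarrow> regular_fun (\<lambda>x. F x - G x)"
  unfolding regular_fun_def polys_eq_vpolys by (metis eval_diff vpolys_diff)

lemma regular_fun_mult: "regular_fun F \<Longrightarrow> regular_fun G \<Longrightarrow> regular_fun (\<lambda>x. F x * G x)"
  unfolding regular_fun_def polys_eq_vpolys by (metis eval_mult vpolys_mult)

lemma regular_fun_sum: "(\<And>i. i \<in> I \<Longrightarrow> regular_fun (F i)) \<Longrightarrow> regular_fun (\<lambda>x. \<Sum>i\<in>I. F i x)"
  by (induction I rule: infinite_finite_induct) (auto intro: regular_fun_const regular_fun_add)

lemma coord_eq: "x \<in> affsp (Suc r) \<Longrightarrow> \<Theta> x = linmap r r N (\<psi> x)"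
  using M_coord[of x] NM[OF linmap_affsp] by metis

lemma regular_fun_Theta: "i \<le> r \<Longrightarrow> regular_fun (\<lambda>x. \<Theta> x i)"
proof -
  assume i: "i \<le> r"
  have "regular_fun (\<lambda>x. \<Sum>j\<le>r. N i j * \<psi> x j)"
    by (intro regular_fun_sum regular_fun_mult regular_fun_const regular_fun_coord)
  then show ?thesis
  proof (rule regular_fun_cong)
    fix x :: "nat \<Rightarrow> 'k" assume "x \<in> det_scroll (Suc r) J"
    then have "\<Theta> x = linmap r r N (\<psi> x)" by (rule coord_eq[OF det_scroll_affsp])
    then show "\<Theta> x i = (\<Sum>j\<le>r. N i j * \<psi> x j)" using i by (simp add: linmap_def)
  qed
qed

lemma regular_fun_dot: "v \<in> U \<Longrightarrow> regular_fun (dt v)"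
proof -
  assume "v \<in> U"
  then have "v \<in> fs.span (u ` {..r})" using span_U by simp
  then obtain c where c: "v = (\<Sum>i\<le>r. fscale (c i) (u i))" by (blast elim: fs.span_famE)
  have "regular_fun (\<lambda>x. \<Sum>i\<le>r. c i * \<Theta> x i)"
    by (intro regular_fun_sum regular_fun_mult regular_fun_const regular_fun_Theta) simp
  then show ?thesis
    by (rule regular_fun_cong) (simp add: c dot_sum_left linmap_dot)
qed

text \<open>Congruence in \<open>A\<close> modulo the ideal of all elements that multiply
  \<open>z\<close> into \<open>A\<close>; hence its compatibility with sums and products.\<close>

definition cong_fun :: "((nat \<Rightarrow> 'k) \<Rightarrow> 'k) \<Rightarrow> ((nat \<Rightarrow> 'k) \<Rightarrow> 'k) \<Rightarrow> ((nat \<Rightarrow> 'k) \<Rightarrow> 'k) \<Rightarrow> bool" where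
  "cong_fun z F G \<longleftrightarrow> regular_fun F \<and> regular_fun G \<and> regular_fun (\<lambda>x. z x * (F x - G x))"

lemma cong_fun_refl: "regular_fun F \<Longrightarrow> cong_fun z F F"
  by (simp add: cong_fun_def regular_fun_const)

lemma cong_fun_add: "cong_fun z F G \<Longrightarrow> cong_fun z F' G' \<Longrightarrow> cong_fun z (\<lambda>x. F x + F' x) (\<lambda>x. G x + G' x)"
  unfolding cong_fun_def
proof (intro conjI regular_fun_add)
  assume *: "regular_fun F \<and> regular_fun G \<and> regular_fun (\<lambda>x. z x * (F x - G x))"
    "regular_fun F' \<and> regular_fun G' \<and> regular_fun (\<lambda>x. z x * (F' x - G' x))"
  then have "regular_fun (\<lambda>x. z x * (F x - G x) + z x * (F' x - G' x))" by (intro regular_fun_add) auto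
  then show "regular_fun (\<lambda>x. z x * (F x + F' x - (G x + G' x)))"
    by (rule regular_fun_cong) (simp add: algebra_simps)
qed auto

lemma cong_fun_mult: "cong_fun z F G \<Longrightarrow> cong_fun z F' G' \<Longrightarrow> cong_fun z (\<lambda>x. F x * F' x) (\<lambda>x. G x * G' x)"
  unfolding cong_fun_def
proof (intro conjI)
  assume *: "regular_fun F \<and> regular_fun G \<and> regular_fun (\<lambda>x. z x * (F x - G x))"
    "regular_fun F' \<and> regular_fun G' \<and> regular_fun (\<lambda>x. z x * (F' x - G' x))"
  then have "regular_fun (\<lambda>x. z x * (F x - G x) * F' x + G x * (z x * (F' x - G' x)))"
    by (intro regular_fun_add regular_fun_mult[of "\<lambda>x. z x * (F x - G x)" F'] regular_fun_mult[of G "\<lambda>x. z x * (F' x - G' x)"]) auto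
  then show "regular_fun (\<lambda>x. z x * (F x * F' x - G x * G' x))"
    by (rule regular_fun_cong) (simp add: algebra_simps)
  show "regular_fun (\<lambda>x. F x * F' x)" "regular_fun (\<lambda>x. G x * G' x)" using * by (auto intro: regular_fun_mult)
qed

lemma cong_fun_sum: "(\<And>i. i \<in> I \<Longrightarrow> cong_fun z (F i) (G i)) \<Longrightarrow> cong_fun z (\<lambda>x. \<Sum>i\<in>I. F i x) (\<lambda>x. \<Sum>i\<in>I. G i x)"
  by (induction I rule: infinite_finite_induct) (auto intro: cong_fun_refl regular_fun_const cong_fun_add)

lemma cong_fun_prod: "(\<And>i. i \<in> I \<Longrightarrow> cong_fun z (F i) (G i)) \<Longrightarrow> cong_fun z (\<lambda>x. \<Prod>i\<in>I. F i x) (\<lambda>x. \<Prod>i\<in>I. G i x)"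
  by (induction I rule: infinite_finite_induct) (auto intro: cong_fun_refl regular_fun_const cong_fun_mult)

lemma cong_fun_power: "cong_fun z F G \<Longrightarrow> cong_fun z (\<lambda>x. F x ^ n) (\<lambda>x. G x ^ n)"
  by (induction n) (auto intro: cong_fun_refl regular_fun_const cong_fun_mult)

lemma cong_fun_eval:
  "(\<And>k. cong_fun z (\<lambda>x. F x k) (\<lambda>x. G x k)) \<Longrightarrow> cong_fun z (\<lambda>x. eval f (F x)) (\<lambda>x. eval f (G x))"
  unfolding eval_def
  by (intro cong_fun_sum cong_fun_mult cong_fun_prod cong_fun_power cong_fun_refl regular_fun_const)

text \<open>The choice is \<open>z = w1\<close>. For \<open>v\<close> in \<open>W\<close>, the minor
  of \<open>v\<close> and \<open>w1\<close> rewrites \<open>w1 * shift v\<close> as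
  \<open>v * shift w1\<close>, and the minor of \<open>v\<close> and \<open>w2\<close> rewrites
  \<open>w1 * v\<close>; all factors obtained vanish at the centre, hence lie in
  \<open>A\<close>.\<close>

lemma conductor:
  assumes n': "J' \<union> Suc ` J' = {..n'}"
  obtains z where "dt z q = 1" "\<And>p. p \<le> n' \<Longrightarrow> regular_fun (\<lambda>x. dt z x * \<Theta> x p)"
proof -
  obtain w1 w2 where w: "w1 \<in> colspace J" "w2 \<in> colspace J" "dt w1 q = 1" "dt (shift w1) q = 0"
    "dt w2 q = 0" "dt (shift w2) q = 1" by (rule section_vectors)
  have aff: "v \<in> affsp (Suc r)" "shift v \<in> affsp (Suc r)" if "v \<in> colspace J" for v :: "nat \<Rightarrow> 'k"
    using that colspace_affsp affsp_mono[of r "Suc r"] shift_affsp[of v r] by auto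
  \<comment> \<open>The values at the centre cancel: \<open>shift w2\<close> and \<open>w1\<close>
    are both 1 there.\<close>
  have U1: "shift w1 \<in> U" "shift w2 - w1 \<in> U"
    using w aff fs.subspace_diff[OF subspace_affsp aff(2)[OF w(2)] aff(1)[OF w(1)]] by (auto simp: U_def dot_diff_left)
  have shift_v: "regular_fun (\<lambda>x. dt w1 x * dt (shift v) x)" if v: "v \<in> W" for v
  proof -
    have "regular_fun (\<lambda>x. dt v x * dt (shift w1) x)"
      using v W_sub_U U1 by (intro regular_fun_mult regular_fun_dot) auto
    then show ?thesis
      by (rule regular_fun_cong) (use v w in \<open>auto simp: W_def intro: dot_minor[OF J]\<close>)
  qed
  have id_v: "regular_fun (\<lambda>x. dt w1 x * dt v x)" if v: "v \<in> W" for v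
  proof -
    have "w2 \<in> U" "shift v \<in> U" "v \<in> U" using w aff affsp_mono v shift_W W_sub_U by (auto simp: U_def)
    then have "regular_fun (\<lambda>x. dt w2 x * dt (shift v) x - dt v x * dt (shift w2 - w1) x)"
      using U1 by (intro regular_fun_diff regular_fun_mult regular_fun_dot) auto
    then show ?thesis
    proof (rule regular_fun_cong)
      fix x :: "nat \<Rightarrow> 'k" assume x: "x \<in> det_scroll (Suc r) J"
      have "dt v x * dt (shift w2) x = dt w2 x * dt (shift v) x"
        using v w by (intro dot_minor[OF J _ _ x]) (auto simp: W_def)
      then show "dt w1 x * dt v x = dt w2 x * dt (shift v) x - dt v x * dt (shift w2 - w1) x"
        by (simp add: dot_diff_left algebra_simps)
    qed
  qed
  have "regular_fun (\<lambda>x. dt w1 x * \<Theta> x p)" if p: "p \<le> n'" for p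
  proof -
    have "n' \<in> J' \<union> Suc ` J'" using n' by simp
    then have pr: "p \<le> r" using J' p by auto
    have "p \<in> J' \<union> Suc ` J'" using n' p by simp
    then consider "p \<in> J'" | p' where "p' \<in> J'" "p = Suc p'" by blast
    then have "regular_fun (\<lambda>x. dt w1 x * dt (u p) x)"
    proof cases
      case 1
      then show ?thesis by (intro id_v u_W)
    next
      case 2
      then show ?thesis using shift_v[OF u_W[OF 2(1)]] shift_u[OF 2(1)] by simp
    qed
    then show ?thesis using pr by (simp add: linmap_dot)
  qed
  then show ?thesis using that w(3) by blast
qed

lemma graded_van_ideal:
  assumes cl: "closed_proj r X"
  shows "graded_ideal r (van_ideal r X)"
  unfolding graded_ideal_def
proof (intro conjI ballI allI)
  fix e f assume f: "f \<in> van_ideal r X"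
  have "eval f y = 0" if "y \<in> X" for y using f that unfolding van_ideal_def by blast
  then have "eval (hcomp e f) y = 0" if "y \<in> X" for y
    using closed_proj_hcomp_vanishes[OF inf cl _ that, of f e] by blast
  then show "hcomp e f \<in> van_ideal r X" using f by (auto simp: van_ideal_def polys_eq_vpolys)
qed (auto simp: van_ideal_def polys_eq_vpolys eval_simps intro!: vpolys_intros)

text \<open>\<open>Q\<close> vanishes on the vertex of \<open>Y\<close>, hence lies in the ideal of the matrix entries.\<close>
lemma conductor_multiple:
  assumes n': "n' \<le> r" and z: "\<And>p. p \<le> n' \<Longrightarrow> regular_fun (\<lambda>x. z x * \<Theta> x p)"
    and Q: "Q \<in> polys r" "\<And>v. eval Q (\<lambda>k. \<Sum>p\<in>{n'<..r}. M k p * v p) = 0"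
    and Mr: "\<And>k p. k > r \<Longrightarrow> M k p = 0"
  shows "regular_fun (\<lambda>x. z x * eval Q (\<psi> x))"
proof -
  let ?L = "\<lambda>v k. \<Sum>p\<in>{n'<..r}. M k p * v p"
  have L_reg: "regular_fun (\<lambda>x. ?L (\<Theta> x) k)" for k
    by (intro regular_fun_sum regular_fun_mult regular_fun_const regular_fun_Theta) simp
  \<comment> \<open>Modulo that ideal the coordinates \<open>\<Theta> x p\<close> with
    \<open>p \<le> n'\<close> are zero, so a point may be replaced by its component in the
    vertex.\<close>
  have "cong_fun z (\<lambda>x. \<psi> x k) (\<lambda>x. ?L (\<Theta> x) k)" for k
    unfolding cong_fun_def
  proof (intro conjI regular_fun_coord L_reg)
    have "regular_fun (\<lambda>x. \<Sum>p\<le>n'. M k p * (z x * \<Theta> x p))"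
      by (intro regular_fun_sum regular_fun_mult[OF regular_fun_const] z) simp
    then show "regular_fun (\<lambda>x. z x * (\<psi> x k - ?L (\<Theta> x) k))"
    proof (rule regular_fun_cong)
      fix x :: "nat \<Rightarrow> 'k" assume "x \<in> det_scroll (Suc r) J"
      then have "\<psi> x = linmap r r M (\<Theta> x)" using M_coord[OF det_scroll_affsp] by simp
      then have "\<psi> x k = (\<Sum>p\<le>r. M k p * \<Theta> x p)" using Mr by (simp add: linmap_def)
      also have "\<dots> = (\<Sum>p\<le>n'. M k p * \<Theta> x p) + ?L (\<Theta> x) k"
        using n' by (subst sum.union_disjoint[symmetric]) (auto intro!: sum.cong)
      finally show "z x * (\<psi> x k - ?L (\<Theta> x) k) = (\<Sum>p\<le>n'. M k p * (z x * \<Theta> x p))"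
        by (simp add: sum_distrib_left algebra_simps)
    qed
  qed
  then have "cong_fun z (\<lambda>x. eval Q (\<psi> x)) (\<lambda>x. eval Q (?L (\<Theta> x)))"
    by (rule cong_fun_eval)
  then show ?thesis unfolding Q(2) by (simp add: cong_fun_def)
qed

text \<open>The degree one part of a polynomial representing \<open>z\<close> would make
  \<open>z\<close> a form pulled back from the target, since a linear form is determined by its
  values on the scroll. Such forms vanish at \<open>q\<close>.\<close>

lemma linear_form_not_regular:
  assumes z: "dt z q = 1"
  shows "\<not> regular_fun (dt z)"
proof
  assume "regular_fun (dt z)"
  then obtain h where h: "h \<in> polys r" "\<And>x. x \<in> det_scroll (Suc r) J \<Longrightarrow> dt z x = eval h (\<psi> x)"
    by (auto simp: regular_fun_def)
  define h1 where "h1 = hcomp 1 h"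
  have lin: "eval h1 y = (\<Sum>k\<le>r. Poly_Mapping.lookup h1 (Poly_Mapping.single k 1) * y k)" for y
    using h(1) by (intro homog_linear_eval) (auto simp: h1_def polys_eq_vpolys intro: homog_hcomp)
  have h1: "dt z x = eval h1 (\<psi> x)" if x: "x \<in> det_scroll (Suc r) J" for x
  proof -
    let ?p = "\<Sum>e\<in>mdeg ` Poly_Mapping.keys h. monom (eval (hcomp e h) (\<psi> x)) e"
    have "poly (?p - monom (dt z x) 1) t = 0" if t: "t \<notin> {0}" for t
    proof -
      have "(\<lambda>i. t * \<psi> x i) = \<psi> (fscale t x)" 
        unfolding linmap_scale by (simp only: fscale_def)
      then have "poly ?p t = eval h (\<psi> (fscale t x))" using eval_scale_poly[of h t "\<psi> x"] by simp
      also have "\<dots> = dt z (fscale t x)" using h(2)[OF det_scroll_scale[OF x]] t by simp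
      finally show ?thesis by (simp add: dot_scale_right poly_monom mult.commute)
    qed
    then have "?p - monom (dt z x) 1 = 0" by (intro poly_zero_if_vanishes[OF inf, of "{0}"]) auto
    then have "poly.coeff ?p 1 = dt z x" by simp
    moreover have "poly.coeff ?p 1 = (\<Sum>e\<in>mdeg ` Poly_Mapping.keys h. if e = 1 then eval h1 (\<psi> x) else 0)"
      unfolding coeff_sum h1_def by (intro sum.cong) auto
    moreover have "h1 = 0" if "1 \<notin> mdeg ` Poly_Mapping.keys h"
      unfolding h1_def using that by (intro poly_mapping_eqI) (force simp: lookup_hcomp in_keys_iff)
    ultimately show ?thesis by auto
  qed
  define v where "v = z - (\<Sum>k\<le>r. fscale (Poly_Mapping.lookup h1 (Poly_Mapping.single k 1)) (P k))"
  have v: "dt v x = dt z x - eval h1 (\<psi> x)" for x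
    unfolding v_def dot_diff_left dot_sum_left lin by (simp add: linmap_dot)
  have "dt v x = 0" if x: "x \<in> det_scroll (Suc r) J" for x using h1[OF x] v[of x] by simp
  then have "v i = 0" if "i \<le> Suc r" for i using det_scroll_spans[OF inf J _ that, of v] by blast
  then have "dt v q = 0" by (simp add: dot_def)
  moreover have "\<psi> q = 0" using kernel[OF q_affsp] by (metis fs.scale_one)
  ultimately show False using v[of q] z by (simp add: lin)
qed

text \<open>With the vertex dimension \<open>v = r - n' - 1\<close> the bound reads
  \<open>t \<le> v + 2\<close>. A longer sequence would force \<open>z\<close> into the coordinate
  ring of \<open>X\<close>.\<close>

lemma regular_seq_bound:
  assumes cl: "closed_proj r X" and n': "J' \<union> Suc ` J' = {..n'}"
    and reg: "regular_seq r (van_ideal r X) f t" and Mr: "\<And>k p. k > r \<Longrightarrow> M k p = 0"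
  shows "t + n' \<le> r + 1"
proof (rule ccontr)
  assume "\<not> t + n' \<le> r + 1"
  have "n' \<in> J' \<union> Suc ` J'" using n' by simp
  then have n'r: "n' \<le> r" using J' by auto
  \<comment> \<open>The cone over the vertex has dimension \<open>r - n'\<close>. Omitting any one
    of \<open>t'\<close> members leaves \<open>r - n' + 1\<close>, just enough for a
    relation.\<close>
  define t' where "t' = r - n' + 2"
  have "t' \<le> t" using \<open>\<not> t + n' \<le> r + 1\<close> n'r by (simp add: t'_def)
  moreover have "homog_regular_seq r (van_ideal r X) f t"
    using reg graded_van_ideal[OF cl] by (simp add: homog_regular_seq_def)
  ultimately interpret S: homog_regular_seq r "van_ideal r X" f t' by (rule homog_regular_seq_prefix[rotated])
  obtain z where z: "dt z q = 1" "\<And>p. p \<le> n' \<Longrightarrow> regular_fun (\<lambda>x. dt z x * \<Theta> x p)"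
    using conductor[OF n'] by blast
  have t'0: "0 < t'" and lt: "card {n'<..r} + 1 < t'" using n'r by (auto simp: t'_def)
  have "\<exists>Q b. reg_poly r f (- {j}) t' 0 Q \<and> b \<in> polys r \<and>
      (\<forall>x\<in>det_scroll (Suc r) J. dt z x * eval Q (\<psi> x) = eval b (\<psi> x))" if j: "j < t'" for j
  proof -
    obtain Q where Q: "reg_poly r f (- {j}) t' 0 Q" "\<forall>v. eval Q (\<lambda>k. \<Sum>p\<in>{n'<..r}. M k p * v p) = 0"
      using S.relation_on_subspace[OF inf _ lt j, of M] by blast
    have "Q \<in> polys r" using S.reg_poly_in_polys[OF Q(1)] by simp
    then have "regular_fun (\<lambda>x. dt z x * eval Q (\<psi> x))"
      using conductor_multiple[OF n'r z(2) _ _ Mr] Q(2) by blast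
    then show ?thesis using Q(1) by (auto simp: regular_fun_def)
  qed
  then obtain Q b where Q: "\<And>j. j < t' \<Longrightarrow> reg_poly r f (- {j}) t' 0 (Q j)"
    and b: "\<And>j. j < t' \<Longrightarrow> b j \<in> polys r"
    and Qb: "\<And>j x. j < t' \<Longrightarrow> x \<in> det_scroll (Suc r) J \<Longrightarrow> dt z x * eval (Q j) (\<psi> x) = eval (b j) (\<psi> x)"
    by metis
  have Qp: "Q j \<in> polys r" if "j < t'" for j using S.reg_poly_in_polys[OF Q[OF that]] by simp
  \<comment> \<open>On the scroll \<open>z\<close> is formally the fraction \<open>b j / Q j\<close>
    for every \<open>j\<close>, so \<open>Q 0\<close> divides each \<open>Q j * b 0\<close>; by the
    coprimality of the \<open>Q j\<close> it divides \<open>b 0\<close>.\<close>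
  have "b 0 \<in> add_gen r (S.J 0) (Q 0)"
  proof (rule S.reg_poly_dvd)
    show "0 + t' \<le> t'" by simp
    show "reg_poly r f UNIV t' 0 (Q 0)" by (rule reg_poly_mono[OF Q[OF t'0]]) simp
    show "b 0 \<in> polys r" by (rule b[OF t'0])
    fix j assume "j \<in> {0..<0 + t'}"
    then have j: "j < t'" by simp
    show "reg_poly r f (- {j}) t' 0 (Q j)" by (rule Q[OF j])
    have "Q j * b 0 - Q 0 * b j \<in> polys r"
      using Qp[OF j] Qp[OF t'0] b[OF j] b[OF t'0] by (auto simp: polys_eq_vpolys intro!: vpolys_intros)
    moreover have "eval (Q j * b 0 - Q 0 * b j) (\<psi> x) = 0" if x: "x \<in> det_scroll (Suc r) J" for x
      using Qb[OF j x] Qb[OF t'0 x] by (simp add: eval_simps flip: Qb[OF j x] Qb[OF t'0 x])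
    ultimately have "Q j * b 0 - Q 0 * b j \<in> S.J 0" by (auto simp: ideal_plus_0 van_ideal_def)
    then show "Q j * b 0 \<in> add_gen r (S.J 0) (Q 0)"
      by (rule add_genI[OF _ b[OF j]]) simp
  qed
  then obtain i h where h: "i \<in> van_ideal r X" "h \<in> polys r" "b 0 = i + Q 0 * h"
    by (auto simp: add_gen_def ideal_plus_0)
  have prod0: "eval (Q 0) (\<psi> x) * (dt z x - eval h (\<psi> x)) = 0" if x: "x \<in> det_scroll (Suc r) J" for x
    using Qb[OF t'0 x] h(1) x by (simp add: h(3) eval_simps van_ideal_def algebra_simps)
  \<comment> \<open>One of the two factors is zero on the whole scroll: either \<open>Q 0\<close>
    lies in the vanishing ideal, and cancellation puts 1 there, or \<open>z\<close> is represented
    by \<open>h\<close>.\<close>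
  have "(\<forall>x\<in>det_scroll (Suc r) J. eval (Q 0) (\<psi> x) = 0) \<or> (\<forall>x\<in>det_scroll (Suc r) J. dt z x - eval h (\<psi> x) = 0)"
    by (rule det_scroll_domain[OF inf J curve_poly_eval_linmap curve_poly_diff[OF curve_poly_dot curve_poly_eval_linmap] prod0])
  then show False
  proof
    assume "\<forall>x\<in>det_scroll (Suc r) J. eval (Q 0) (\<psi> x) = 0"
    then have "Q 0 * 1 \<in> S.J 0" using Qp[OF t'0] by (auto simp: ideal_plus_0 van_ideal_def)
    then have "1 \<in> S.J 0"
      using S.reg_poly_cancel[OF Q[OF t'0]] by (simp add: polys_eq_vpolys)
    then have "\<forall>y\<in>X. (1 :: 'k) = 0" by (auto simp: ideal_plus_0 van_ideal_def)
    then show False using ones_in_det_scroll[OF J] by auto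
  next
    assume "\<forall>x\<in>det_scroll (Suc r) J. dt z x - eval h (\<psi> x) = 0"
    then have "regular_fun (dt z)" using h(2) by (auto simp: regular_fun_def)
    then show False using linear_form_not_regular[OF z(1)] by contradiction
  qed
qed

end

lemma linmap_truncate: "linmap s t (\<lambda>i j. if i \<le> t then M i j else 0) = linmap s t M"
  by (rule ext) (auto simp: linmap_def)

theorem theorem7p5:
  fixes r :: nat and h :: int
    and X :: "(nat \<Rightarrow> 'k::field) set" and Xt :: "(nat \<Rightarrow> 'k) set"
    and p :: "nat \<Rightarrow> 'k" and P :: "nat \<Rightarrow> nat \<Rightarrow> 'k"
  assumes "alg_closed TYPE('k)"
    and "r \<ge> 2"
    and "almost_minimal_degree r X"
    and "is_scroll (Suc r) Xt h"
    and "is_projection_from r p P"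
    and "p \<notin> Xt"
    and "X = linmap (Suc r) r P ` Xt"
  shows "(\<exists>Y v. is_scroll r Y v \<and> X \<subseteq> Y \<and> dim_proj r Y - dim_proj r X = 1 \<and> h \<le> v \<and> v \<le> h + 3)
         \<and> int (arith_depth r X) \<le> h + 5"
proof -
  have inf: "infinite (UNIV :: 'k set)" using assms(1) by (rule alg_closed_infinite)
  have cl: "closed_proj r X" and nondeg: "nondegenerate r X" and deg: "deg_proj r X = codim_proj r X + 2"
    using assms(3) by (auto simp: almost_minimal_degree_def proj_variety_def)
  obtain T n l a where T: "bij_betw (linmap (Suc r) (Suc r) T) (affsp (Suc r)) (affsp (Suc r))"
    and ok: "scroll_data_ok (Suc r) n l a" and h: "h = int (Suc r) - int n - 1"
    and Xt: "Xt = linmap (Suc r) (Suc r) T ` std_scroll (Suc r) n l a"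
    using assms(4) by (auto simp: is_scroll_def)
  define J where "J = scroll_cols n l a"
  have nr: "1 \<le> n" "n \<le> Suc r" using ok by (auto simp: scroll_data_ok_def)
  have J: "J \<subseteq> {..<Suc r}" using scroll_cols_lessThan[of n l a] nr by (auto simp: J_def)
  have Jn: "J \<union> Suc ` J = {..n}" using scroll_cols_Un_Suc[OF ok] by (simp add: J_def)
  have p: "p \<in> PP (Suc r)" and ker: "\<And>x. x \<in> affsp (Suc r) \<Longrightarrow> linmap (Suc r) r P x = 0 \<longleftrightarrow> (\<exists>c. x = fscale c p)"
    using assms(5) by (auto simp: is_projection_from_def zero_fun_def fscale_def)
  have pa: "p \<in> affsp (Suc r)" "p \<noteq> 0" using p by (auto simp: PP_iff)
  obtain T' where T': "\<And>x. x \<in> affsp (Suc r) \<Longrightarrow> linmap (Suc r) (Suc r) T' (linmap (Suc r) (Suc r) T x) = x"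
    "\<And>y. y \<in> affsp (Suc r) \<Longrightarrow> linmap (Suc r) (Suc r) T (linmap (Suc r) (Suc r) T' y) = y"
    using linmap_inverse[OF T] by blast
  \<comment> \<open>The coordinate change \<open>T\<close> is moved from the scroll to the centre
    and the projection, so that the scroll is in standard form.\<close>
  define q where "q = linmap (Suc r) (Suc r) T' p"
  have Tq: "linmap (Suc r) (Suc r) T q = p" using T'(2)[OF pa(1)] by (simp add: q_def)
  have q: "q \<in> PP (Suc r)" using Tq pa(2) by (auto simp: PP_iff q_def)
  have qJ: "q \<notin> det_scroll (Suc r) J"
    using assms(6) Tq by (auto simp: Xt std_scroll_eq J_def)
  define P' where "P' = (\<lambda>i j. \<Sum>k\<le>Suc r. P i k * T k j)"
  have P': "linmap (Suc r) r P' x = linmap (Suc r) r P (linmap (Suc r) (Suc r) T x)" for x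
    unfolding P'_def by (rule linmap_comp[symmetric])
  have ker': "linmap (Suc r) r P' x = 0 \<longleftrightarrow> (\<exists>c. x = fscale c q)" if x: "x \<in> affsp (Suc r)" for x
  proof -
    have "x = fscale c q \<longleftrightarrow> linmap (Suc r) (Suc r) T x = fscale c p" for c
    proof
      assume "linmap (Suc r) (Suc r) T x = fscale c p"
      then have "linmap (Suc r) (Suc r) T' (linmap (Suc r) (Suc r) T x) = fscale c q"
        by (simp only: q_def linmap_scale)
      then show "x = fscale c q" using T'(1)[OF x] by simp
    qed (simp only: linmap_scale Tq)
    then show ?thesis unfolding P' using ker[OF linmap_affsp] by simp
  qed
  interpret projected_scroll r J q P' by unfold_locales (use inf J q qJ ker' in auto)
  obtain u J' where u: "fs.indep_fam u {..r}" "fs.span (u ` {..r}) = U" "fs.span (u ` J') = W"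
    "\<forall>j\<in>J'. shift (u j) = u (Suc j)" "J' \<subseteq> {..<r}"
    and J'_scroll: "J' = {} \<or> (\<exists>n l a. scroll_data_ok r n l a \<and> J' = scroll_cols n l a)"
    using string_basis_U by blast
  obtain M0 where M0: "bij_betw (linmap r r M0) (affsp r) (affsp r)"
    "\<forall>x\<in>affsp (Suc r). linmap r r M0 (linmap (Suc r) r u x) = \<psi> x"
    using coordinates_exist(1)[OF u(1,2)] by blast
  \<comment> \<open>Rows beyond \<open>r\<close> do not affect \<open>linmap\<close>; they are set
    to zero because the vertex component of a point is computed with all rows.\<close>
  define M where "M = (\<lambda>i j. if i \<le> r then M0 i j else 0)"
  have M_eq: "linmap r r M = linmap r r M0" unfolding M_def by (rule linmap_truncate)
  obtain N where N: "\<And>x. x \<in> affsp r \<Longrightarrow> linmap r r N (linmap r r M x) = x"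
    "\<And>y. y \<in> affsp r \<Longrightarrow> linmap r r M (linmap r r N y) = y"
    using linmap_inverse[OF M0(1)] unfolding M_eq by blast
  interpret B: projected_scroll_basis r J q P' u J' M N
    using u M0 N coordinates_exist(2)[OF u(1,2)] by unfold_locales (auto simp: M_eq)
  have X: "X = B.X" unfolding assms(7) Xt std_scroll_eq J_def[symmetric] image_image P' ..
  show ?thesis
  proof (cases "J' = {}")
    case True
    then have "X = PP r" using B.X_eq_PP[OF assms(1)] X by simp
    \<comment> \<open>Degree 1 against codimension 0 plus 2.\<close>
    then have False
      using deg deg_proj_PP[OF inf, of r] dim_proj_PP[OF inf, of r] assms(2) by (simp add: codim_proj_def)
    then show ?thesis ..
  next
    case False
    then obtain n' l' a' where ok': "scroll_data_ok r n' l' a'" and J': "J' = scroll_cols n' l' a'"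
      using J'_scroll by blast
    have Jn': "J' \<union> Suc ` J' = {..n'}" using scroll_cols_Un_Suc[OF ok'] by (simp add: J')
    have nr': "n' \<le> r" using ok' by (simp add: scroll_data_ok_def)
    define v where "v = int r - int n' - 1"
    have "is_scroll r B.Y v"
      unfolding is_scroll_def using B.M ok' by (auto simp: v_def std_scroll_eq J')
    moreover have "X \<subseteq> B.Y" using B.X_subset_Y X by simp
    moreover have "dim_proj r B.Y - dim_proj r X = 1"
      using B.dim_Y[OF False] B.dim_X cl nondeg B.card_cols unfolding X by simp
    moreover have hv: "h \<le> v" "v \<le> h + 3" using B.vertex_bounds[OF Jn Jn'] by (auto simp: v_def h)
    have depth: "arith_depth r X \<le> r + 1 - n'"
    proof -
      have bound: "t \<le> r + 1 - n'" if "\<exists>f. regular_seq r (van_ideal r X) f t" for t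
        using that B.regular_seq_bound[OF cl[unfolded X] Jn'] unfolding X by (fastforce simp: M_def)
      show ?thesis
      \<comment> \<open>\<open>cSup_least\<close> needs a nonempty set; the supremum of the empty
        set of naturals is 0.\<close>
      proof (cases "{t. \<exists>f. regular_seq r (van_ideal r X) f t} = {}")
        case True
        then show ?thesis by (simp only: arith_depth_def) simp
      next
        case False
        then show ?thesis unfolding arith_depth_def by (rule cSup_least) (use bound in blast)
      qed
    qed
    moreover have "int (arith_depth r X) \<le> h + 5" using depth hv(2) nr' by (simp add: v_def)
    ultimately show ?thesis using hv by blast
  qed
qed

end
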